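(* Let $\omega$ be the radial weight given by $$\omega(r)=\begin{cases}\dfrac e4,&0\le r\le1-e^{-1},\\[6pt]\dfrac1{(1-r)\left(\log\frac e{1-r}\right)^2},&1-e^{-1}<r<1.\end{cases}$$ Then $\omega$ is log-subharmonic and $\omega\in\widehat{\mathcal D}$. Moreover, there exist functions $u,v\in L^\infty(\mathbb D)$ such that the operator $S=T_{\omega,v}T_{\omega,u}$ is not compact on $A^2_\omega$, but its Berezin transform $\widetilde S_\omega(a)=\langle Sk_a^\omega,k_a^\omega\rangle_{A^2_\omega}$ satisfies $$\lim_{|a|\to1^-}\widetilde S_\omega(a)=0.$$
   Context: $\mathbb D$ is the open unit disk and $dA=dx\,dy/\pi$. A radial weight is a nonnegative integrable function $\omega$ on $[0,1)$, extended to $\mathbb D$ by $\omega(z)=\omega(|z|)$. It is log-subharmonic if $\log\omega$ is subharmonic on $\mathbb D$ in the sense of distributions. With $\widehat\omega(r)=\int_r^1\omega(s)\,ds$, $\omega\in\widehat{\mathcal D}$ means that there is $C_\omega\ge1$ with $\widehat\omega(r)\le C_\omega\widehat\omega\left(\frac{1+r}2\right)$ for all $0\le r<1$. $L^2_\omega=L^2(\mathbb D,\omega\,dA)$, and $A^2_\omega$ is the subspace of holomorphic functions, a reproducing kernel Hilbert space with kernel $B_z^\omega$; $k_a^\omega=B_a^\omega/\|B_a^\omega\|_{A^2_\omega}$. For $u\in L^\infty(\mathbb D)$, $T_{\omega,u}f=P_\omega(uf)$ for $f\in A^2_\omega$, where $P_\omega:L^2_\omega\to A^2_\omega$ is the orthogonal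 projection. *)

theory Defs
  imports "HOL-Complex_Analysis.Complex_Analysis"
begin

text \<open>A radial weight is a function on \<open>[0,1)\<close>, represented by a total function
  \<open>\<omega> :: real \<Rightarrow> real\<close> whose values outside \<open>[0,1)\<close> are never used.\<close>

definition radial_weight :: "(real \<Rightarrow> real) \<Rightarrow> bool" where
  "radial_weight \<omega> \<longleftrightarrow> (\<forall>r\<in>{0..<1}. 0 \<le> \<omega> r) \<and> set_integrable lborel {0..<1} \<omega>"

definition weight_hat :: "(real \<Rightarrow> real) \<Rightarrow> real \<Rightarrow> real" where
  "weight_hat \<omega> r = (LINT s:{r..<1}|lborel. \<omega> s)"

definition D_hat :: "(real \<Rightarrow> real) set" where
  "D_hat = {\<omega>. radial_weight \<omega> \<and>
     (\<exists>C\<ge>1. \<forall>r. 0 \<le> r \<and> r < 1 \<longrightarrow> weight_hat \<omega> r \<le> C * weight_hat \<omega> ((1 + r) / 2))}"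

definition disk_area :: "complex measure" where
  "disk_area = density (restrict_space lborel (ball 0 1)) (\<lambda>_. ennreal (1 / pi))"

primrec k_times_cont_diff :: "nat \<Rightarrow> (complex \<Rightarrow> real) \<Rightarrow> bool" where
  "k_times_cont_diff 0 f \<longleftrightarrow> continuous_on UNIV f"
| "k_times_cont_diff (Suc k) f \<longleftrightarrow>
     (\<forall>z. f differentiable (at z)) \<and>
     (\<forall>v. k_times_cont_diff k (\<lambda>z. frechet_derivative f (at z) v))"

definition test_function_on :: "complex set \<Rightarrow> (complex \<Rightarrow> real) \<Rightarrow> bool" where
  "test_function_on U \<phi> \<longleftrightarrow> (\<forall>k. k_times_cont_diff k \<phi>) \<and>
     compact (closure {z. \<phi> z \<noteq> 0}) \<and> closure {z. \<phi> z \<noteq> 0} \<subseteq> U"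

definition directional_deriv :: "complex \<Rightarrow> (complex \<Rightarrow> real) \<Rightarrow> complex \<Rightarrow> real" where
  "directional_deriv v f z = frechet_derivative f (at z) v"

definition laplacian :: "(complex \<Rightarrow> real) \<Rightarrow> complex \<Rightarrow> real" where
  "laplacian f z = directional_deriv 1 (directional_deriv 1 f) z
     + directional_deriv \<i> (directional_deriv \<i> f) z"

definition distr_subharmonic_on_disk :: "(complex \<Rightarrow> real) \<Rightarrow> bool" where
  "distr_subharmonic_on_disk h \<longleftrightarrow>
     (\<forall>K. compact K \<and> K \<subseteq> ball 0 1 \<longrightarrow> set_integrable disk_area K h) \<and>
     (\<forall>\<phi>. test_function_on (ball 0 1) \<phi> \<and> (\<forall>z. 0 \<le> \<phi> z) \<longrightarrow>
        0 \<le> (LINT z|disk_area. h z * laplacian \<phi> z))"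

text \<open>Since \<open>ln 0 = 0\<close> in HOL, positivity almost everywhere is required separately; classically
  it is part of the local integrability of the logarithm.\<close>

definition log_subharmonic :: "(real \<Rightarrow> real) \<Rightarrow> bool" where
  "log_subharmonic \<omega> \<longleftrightarrow> (AE z in disk_area. 0 < \<omega> (cmod z)) \<and>
     distr_subharmonic_on_disk (\<lambda>z. ln (\<omega> (cmod z)))"

definition weighted_area :: "(real \<Rightarrow> real) \<Rightarrow> complex measure" where
  "weighted_area \<omega> = density disk_area (\<lambda>z. ennreal (\<omega> (cmod z)))"

text \<open>The elements of \<open>L2 \<omega>\<close> and \<open>Linf\<close> are functions rather than classes modulo null sets;
  the inner product, the projection and the Toeplitz operators below depend only on the class.\<close>

definition L2 :: "(real \<Rightarrow> real) \<Rightarrow> (complex \<Rightarrow> complex) set" where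
  "L2 \<omega> = {f \<in> borel_measurable (weighted_area \<omega>).
     integrable (weighted_area \<omega>) (\<lambda>z. (cmod (f z))\<^sup>2)}"

definition L2_inner ::
    "(real \<Rightarrow> real) \<Rightarrow> (complex \<Rightarrow> complex) \<Rightarrow> (complex \<Rightarrow> complex) \<Rightarrow> complex" where
  "L2_inner \<omega> f g = (LINT z|weighted_area \<omega>. f z * cnj (g z))"

definition L2_norm :: "(real \<Rightarrow> real) \<Rightarrow> (complex \<Rightarrow> complex) \<Rightarrow> real" where
  "L2_norm \<omega> f = sqrt (LINT z|weighted_area \<omega>. (cmod (f z))\<^sup>2)"

definition Linf :: "(complex \<Rightarrow> complex) set" where
  "Linf = {u \<in> borel_measurable disk_area. \<exists>C. AE z in disk_area. cmod (u z) \<le> C}"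

text \<open>Holomorphic functions on the disk are represented by their extension by zero, so that
  equality in \<open>A2 \<omega>\<close> is equality of HOL functions.\<close>

definition A2 :: "(real \<Rightarrow> real) \<Rightarrow> (complex \<Rightarrow> complex) set" where
  "A2 \<omega> = {f \<in> L2 \<omega>. f holomorphic_on ball 0 1 \<and> (\<forall>z. z \<notin> ball 0 1 \<longrightarrow> f z = 0)}"

definition bergman_kernel :: "(real \<Rightarrow> real) \<Rightarrow> complex \<Rightarrow> complex \<Rightarrow> complex" where
  "bergman_kernel \<omega> a = (THE g. g \<in> A2 \<omega> \<and> (\<forall>f\<in>A2 \<omega>. f a = L2_inner \<omega> f g))"

definition normalized_kernel :: "(real \<Rightarrow> real) \<Rightarrow> complex \<Rightarrow> complex \<Rightarrow> complex" where
  "normalized_kernel \<omega> a =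
     (\<lambda>z. bergman_kernel \<omega> a z / of_real (L2_norm \<omega> (bergman_kernel \<omega> a)))"

definition bergman_proj :: "(real \<Rightarrow> real) \<Rightarrow> (complex \<Rightarrow> complex) \<Rightarrow> complex \<Rightarrow> complex" where
  "bergman_proj \<omega> f =
     (THE g. g \<in> A2 \<omega> \<and> (\<forall>h\<in>A2 \<omega>. L2_inner \<omega> (\<lambda>z. f z - g z) h = 0))"

definition toeplitz ::
    "(real \<Rightarrow> real) \<Rightarrow> (complex \<Rightarrow> complex) \<Rightarrow> (complex \<Rightarrow> complex) \<Rightarrow> complex \<Rightarrow> complex" where
  "toeplitz \<omega> u f = bergman_proj \<omega> (\<lambda>z. u z * f z)"

definition berezin ::
    "(real \<Rightarrow> real) \<Rightarrow> ((complex \<Rightarrow> complex) \<Rightarrow> complex \<Rightarrow> complex) \<Rightarrow> complex \<Rightarrow> complex" where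
  "berezin \<omega> S a = L2_inner \<omega> (S (normalized_kernel \<omega> a)) (normalized_kernel \<omega> a)"

definition A2_topology :: "(real \<Rightarrow> real) \<Rightarrow> (complex \<Rightarrow> complex) topology" where
  "A2_topology \<omega> = Metric_space.mtopology (A2 \<omega>) (\<lambda>f g. L2_norm \<omega> (\<lambda>z. f z - g z))"

definition compact_operator_A2 ::
    "(real \<Rightarrow> real) \<Rightarrow> ((complex \<Rightarrow> complex) \<Rightarrow> complex \<Rightarrow> complex) \<Rightarrow> bool" where
  "compact_operator_A2 \<omega> S \<longleftrightarrow>
     compactin (A2_topology \<omega>)
       (A2_topology \<omega> closure_of (S ` {f \<in> A2 \<omega>. L2_norm \<omega> f \<le> 1}))"

end

theory Submission
  imports Defs "HOL-Real_Asymp.Real_Asymp"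
begin

text \<open>The weight has the form \<open>\<omega>(z) = dens (max |z| r0)\<close> with \<open>ln dens\<close> convex and increasing on
  \<open>[r0, 1)\<close>, so \<open>ln \<omega>\<close> is convex on the disk; a convex function is subharmonic because its
  second differences are nonnegative.

  In the coordinate \<open>t = ln (e / (1 - r))\<close> the tail mass of \<open>\<omega>\<close> beyond \<open>t\<close> is \<open>1 / t\<close>, and the moments
  \<open>mom n\<close> are comparable to \<open>1 / ln n\<close>. Fix very sparse scales \<open>s\<close>. Let \<open>u\<close> be the indicator of the
  annuli \<open>s \<le> t < 2 s\<close>, and let \<open>v\<close> be \<open>(z / |z|) ^ k\<close>, \<open>k = e ^ (4 s - 4)\<close>, on \<open>4 s \<le> t < 8 s\<close>.
  Then \<open>T\<^sub>u\<close> is diagonal, with eigenvalues bounded below at \<open>n = e ^ (s - 4)\<close> and almost zero for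
  \<open>n\<close> between \<open>e ^ (3 s)\<close> and the next scale, while \<open>T\<^sub>v\<close> moves the normalized monomial of degree \<open>n\<close> to
  degree \<open>n + k\<close> with a coefficient bounded below, because the moments vary only logarithmically.
  Hence the product is not compact. The Berezin transform of the product at \<open>a\<close> contains, for each scale,
  the factor \<open>|a| ^ k\<close> times an average over \<open>n\<close> with weights proportional to \<open>|a| ^ (2 n) / mom (2 n)\<close>.
  If \<open>|a| ^ k\<close> is not small, these weights charge the indices below \<open>e ^ (3 s)\<close>, far less than \<open>k\<close>,
  only a little, and beyond these indices \<open>T\<^sub>u\<close> is small.\<close>

section \<open>Rotations and radial integration over the disk\<close>

text \<open>Neither factor could serve alone: at \<open>1 - |a|\<close> comparable to
  \<open>e ^ (- s)\<close>, respectively \<open>1 / k\<close>, its Berezin transform averages over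
  degrees where the eigenvalue of \<open>T_u\<close>, respectively the coefficient of
  \<open>T_v\<close>, is bounded below. The product separates the two ranges. It effectively acts on
  degrees below \<open>e ^ (3 s)\<close>, whereas \<open>|a| ^ k\<close> not small pushes the
  average towards degrees of order \<open>k\<close>, larger by a factor of order
  \<open>e ^ s\<close>. The windows \<open>[s, 2 s)\<close> and \<open>[4 s, 8 s)\<close> have a
  fixed ratio because \<open>[t, 2 t)\<close> has mass \<open>1 / (2 t)\<close>, the order of the
  moments it is compared with; a window of bounded length would only have mass of order
  \<open>1 / t ^ 2\<close>. The exponent \<open>3 s\<close> leaves exponential room on both sides,
  above \<open>2 s\<close> and below \<open>4 s\<close>. Sparseness is forced by the later annuli of
  \<open>u\<close>: a scale \<open>s'\<close> may add \<open>2 / s'\<close> to a moment without any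
  decay in the degree, so \<open>s'\<close> has to be chosen after \<open>s\<close>. The
  contributions of the scales are added by Tannery's theorem: a majorant uniform in
  \<open>a\<close>, and limit 0 for each scale.\<close>

definition vec_of :: "complex \<Rightarrow> real ^ 2" where
  "vec_of z = (\<chi> i. if i = 1 then Re z else Im z)"

definition of_vec :: "real ^ 2 \<Rightarrow> complex" where
  "of_vec v = Complex (vec_nth v 1) (vec_nth v 2)"

lemma of_vec_vec_of [simp]: "of_vec (vec_of z) = z"
  by (simp add: of_vec_def vec_of_def)

lemma vec_of_of_vec [simp]: "vec_of (of_vec v) = v"
  by (simp add: of_vec_def vec_of_def vec_eq_iff forall_2)

lemma vimage_vec_of_box: "vec_of -` box l u = box (of_vec l) (of_vec u)"
  by (auto simp: vec_of_def of_vec_def mem_box_cart forall_2 in_box_complex_iff)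

lemma vec_of_measurable [measurable]: "vec_of \<in> borel_measurable borel"
proof -
  have "continuous_on UNIV (\<lambda>x. if i = 1 then Re x else Im x)" for i :: 2
    by (cases "i = 1") (auto intro!: continuous_intros)
  then have "continuous_on UNIV vec_of"
    unfolding vec_of_def by (intro continuous_on_vec_lambda)
  then show ?thesis by (rule borel_measurable_continuous_onI)
qed

lemma prod_Basis_vec2: "(\<Prod>b\<in>Basis. (v::real^2) \<bullet> b) = vec_nth v 1 * vec_nth v 2"
  by (simp add: Basis_vec_def UNION_singleton_eq_range axis_eq_axis inj_on_def prod.reindex
    cart_eq_inner_axis UNIV_2 prod.UNION_disjoint)

lemma distr_vec_of: "distr lborel borel vec_of = lborel"
proof (rule lborel_eqI[symmetric])
  fix l u :: "real ^ 2"
  assume "\<And>b. b \<in> Basis \<Longrightarrow> l \<bullet> b \<le> u \<bullet> b"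
  then have le: "vec_nth l i \<le> vec_nth u i" for i
    by (metis axis_in_Basis_iff inner_axis mult.right_neutral real_inner_1_right cart_eq_inner_axis insertI1 Basis_real_def)
  have "emeasure (distr lborel borel vec_of) (box l u) = emeasure lborel (box (of_vec l) (of_vec u))"
    by (subst emeasure_distr) (auto simp: vimage_vec_of_box)
  also have "\<dots> = (\<Prod>b\<in>Basis. (of_vec u - of_vec l) \<bullet> b)"
    using le by (subst emeasure_lborel_box) (auto simp: Basis_complex_def of_vec_def)
  also have "(\<Prod>b\<in>Basis. (of_vec u - of_vec l) \<bullet> b) = (\<Prod>b\<in>Basis. (u - l) \<bullet> b)"
    by (simp add: Basis_complex_def of_vec_def prod_Basis_vec2)
  finally show "emeasure (distr lborel borel vec_of) (box l u) = (\<Prod>b\<in>Basis. (u - l) \<bullet> b)" .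
qed auto

lemma emeasure_vimage_vec_of:
  "X \<in> sets borel \<Longrightarrow> emeasure lborel (vec_of -` X) = emeasure lborel X"
  using emeasure_distr[of vec_of lborel borel X] by (simp add: distr_vec_of)

lemma norm_vec_of: "norm (vec_of z) = cmod z"
  by (simp add: norm_vec_def L2_set_def sum_2 vec_of_def cmod_def)

lemma linear_vec_of: "linear vec_of" and linear_of_vec: "linear of_vec"
  by (auto intro!: linearI simp: vec_of_def of_vec_def vec_eq_iff complex_eq_iff)

text \<open>Conjugation by \<open>vec_of\<close> turns multiplication by \<open>c\<close> into an
  orthogonal transformation of \<open>real ^ 2\<close>, and Lebesgue measure is invariant under
  orthogonal images. It is enough to compare the two measures on boxes.\<close>

lemma lborel_rotation:
  fixes c :: complex
  assumes c: "cmod c = 1"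
  shows "distr lborel borel ((*) c) = lborel"
proof (rule lborel_eqI[symmetric])
  fix l u :: complex
  assume le: "\<And>b. b \<in> Basis \<Longrightarrow> l \<bullet> b \<le> u \<bullet> b"
  \<comment> \<open>The inverse rotation: the push-forward measures preimages under multiplication
    by \<open>c\<close>, while invariance is available for images.\<close>
  define f where "f v = vec_of (inverse c * of_vec v)" for v
  have c0: "c \<noteq> 0" using c by auto
  define Y where "Y = box (vec_of l) (vec_of u)"
  have "linear f"
    unfolding f_def using linear_compose[OF linear_of_vec linear_compose[OF _ linear_vec_of], of "(*) (inverse c)"]
    by (simp add: o_def linear_times)
  moreover have "norm (f v) = norm v" for v
    using c norm_vec_of[of "of_vec v"] by (simp add: f_def norm_vec_of norm_mult norm_inverse)
  ultimately have orth: "orthogonal_transformation f"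
    by (simp add: orthogonal_transformation)
  have Yl: "Y \<in> lmeasurable" by (simp add: Y_def)
  have im: "(*) c -` box l u = vec_of -` (f ` Y)"
  proof (intro set_eqI iffI)
    fix z assume "z \<in> (*) c -` box l u"
    then have "vec_of (c * z) \<in> Y"
      using vimage_vec_of_box[of "vec_of l" "vec_of u"] by (auto simp: Y_def)
    moreover have "vec_of z = f (vec_of (c * z))"
      using c0 by (simp add: f_def field_simps)
    ultimately show "z \<in> vec_of -` (f ` Y)" by auto
  next
    fix z assume "z \<in> vec_of -` (f ` Y)"
    then obtain v where v: "v \<in> Y" "vec_of z = f v" by auto
    then have "z = inverse c * of_vec v" unfolding f_def by (metis of_vec_vec_of)
    then have "c * z = of_vec v" using c0 by simp
    then show "z \<in> (*) c -` box l u"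
      using v vimage_vec_of_box[of "vec_of l" "vec_of u"] by (auto simp: Y_def)
  qed
  \<comment> \<open>The image is rewritten as a preimage under a continuous map, which makes it
    Borel.\<close>
  have fY: "f ` Y = (\<lambda>v. vec_of (c * of_vec v)) -` Y"
  proof -
    have "inverse c * (c * w) = w" "c * (inverse c * w) = w" for w
      using c0 by (simp_all add: field_simps)
    then have 1: "f (vec_of (c * of_vec v)) = v" and 2: "vec_of (c * of_vec (f v)) = v" for v
      unfolding f_def of_vec_vec_of by (simp_all only: vec_of_of_vec)
    show ?thesis
    proof (intro set_eqI iffI)
      fix v assume "v \<in> (\<lambda>v. vec_of (c * of_vec v)) -` Y"
      then show "v \<in> f ` Y" using 1[of v] by (intro image_eqI[of _ f]) simp_all
    next
      fix v assume "v \<in> f ` Y"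
      then show "v \<in> (\<lambda>v. vec_of (c * of_vec v)) -` Y" using 2 by force
    qed
  qed
  have cont: "continuous_on UNIV (\<lambda>v. vec_of (c * of_vec v))"
  proof -
    have "linear (\<lambda>v. vec_of (c * of_vec v))"
      using linear_compose[OF linear_of_vec linear_compose[OF _ linear_vec_of], of "(*) c"]
      by (simp add: o_def linear_times)
    then show ?thesis
      by (intro linear_continuous_on) (simp add: linear_conv_bounded_linear)
  qed
  have fYb: "f ` Y \<in> sets borel"
    unfolding fY using measurable_sets[OF borel_measurable_continuous_onI[OF cont], of Y]
    by (simp add: Y_def)
  have "emeasure (distr lborel borel ((*) c)) (box l u) = emeasure lborel (vec_of -` (f ` Y))"
    by (subst emeasure_distr) (auto simp: im)
  also have "\<dots> = emeasure lebesgue (f ` Y)"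
    unfolding emeasure_vimage_vec_of[OF fYb] using fYb by simp
  also have "\<dots> = emeasure lebesgue Y"
    unfolding emeasure_eq_measure2[OF measurable_orthogonal_image[OF orth Yl]]
      emeasure_eq_measure2[OF Yl] measure_orthogonal_image[OF orth Yl] ..
  also have "\<dots> = emeasure lborel Y"
    by (simp add: Y_def)
  also have "\<dots> = emeasure lborel (vec_of -` Y)"
    by (rule emeasure_vimage_vec_of[symmetric]) (simp add: Y_def)
  also have "vec_of -` Y = box l u"
    by (simp add: Y_def vimage_vec_of_box)
  finally show "emeasure (distr lborel borel ((*) c)) (box l u) = (\<Prod>b\<in>Basis. (u - l) \<bullet> b)"
    using emeasure_lborel_box[OF le] by (rule trans)
qed (rule sets_distr)

lemma space_disk_area [simp]: "space disk_area = ball 0 1"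
  by (simp add: disk_area_def space_restrict_space)

lemma sets_disk_area: "sets disk_area = sets (restrict_space borel (ball 0 1))"
  unfolding disk_area_def by (simp add: sets_restrict_space)

lemma measurable_disk_area:
  "f \<in> borel_measurable borel \<Longrightarrow> f \<in> borel_measurable disk_area"
  unfolding disk_area_def by (simp add: measurable_restrict_space1)

lemma cmod_measurable_disk_area [measurable]: "cmod \<in> borel_measurable disk_area"
  by (rule measurable_disk_area) simp

lemma nn_integral_disk_area:
  assumes f [measurable]: "f \<in> borel_measurable borel"
  shows "(\<integral>\<^sup>+z. f z \<partial>disk_area) = (\<integral>\<^sup>+z. ennreal (1 / pi) * f z * indicator (ball 0 1) z \<partial>lborel)"
proof -
  have [measurable]: "f \<in> borel_measurable (restrict_space lborel (ball 0 1))"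
    by (intro measurable_restrict_space1) simp
  have "(\<integral>\<^sup>+z. f z \<partial>disk_area) = (\<integral>\<^sup>+z. ennreal (1 / pi) * f z \<partial>restrict_space lborel (ball 0 1))"
    unfolding disk_area_def by (rule nn_integral_density) measurable
  then show ?thesis
    by (simp add: nn_integral_restrict_space)
qed

lemma emeasure_lborel_complex_ball:
  "0 \<le> r \<Longrightarrow> emeasure lborel (ball (0 :: complex) r) = ennreal (pi * r\<^sup>2)"
  "0 \<le> r \<Longrightarrow> emeasure lborel (cball (0 :: complex) r) = ennreal (pi * r\<^sup>2)"
  by (simp_all add: emeasure_ball emeasure_cball unit_ball_vol_2)

text \<open>Radial half of polar coordinates: the part of the disk outside radius \<open>x\<close>
  has normalized area 1 - x^2, and the half-lines \<open>{x<..}\<close> determine a finite measure.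
  The angular half is supplied by rotation invariance.\<close>

lemma distr_cmod_disk_area:
  "distr disk_area borel cmod = density lborel (\<lambda>r. ennreal (2 * r * indicator {0..<1} r))"
proof (rule measure_eqI_lessThan)
  fix x :: real
  have 1: "emeasure (distr disk_area borel cmod) {x<..} = ennreal (if x < 0 then 1 else if x < 1 then 1 - x\<^sup>2 else 0)"
  proof -
    have "emeasure (distr disk_area borel cmod) {x<..} = (\<integral>\<^sup>+z. indicator {x<..} (cmod z) \<partial>disk_area)"
      using nn_integral_distr[of cmod disk_area borel "indicator {x<..}"] by simp
    also have "\<dots> = (\<integral>\<^sup>+z. ennreal (1 / pi) * indicator (ball (0::complex) 1 - cball 0 x) z \<partial>lborel)"
      by (subst nn_integral_disk_area) (auto intro!: nn_integral_cong simp: indicator_def not_le mult.assoc of_bool_conj mult_ac)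
    also have "\<dots> = ennreal (1 / pi) * emeasure lborel (ball (0::complex) 1 - cball 0 x)"
      by (intro nn_integral_cmult_indicator) simp
    also have "emeasure lborel (ball (0::complex) 1 - cball 0 x) =
       ennreal (pi * (if x < 0 then 1 else if x < 1 then 1 - x\<^sup>2 else 0))"
    proof -
      consider "x < 0" | "0 \<le> x" "x < 1" | "1 \<le> x" by linarith
      then show ?thesis
      proof cases
        case 1
        then show ?thesis by (simp add: emeasure_lborel_complex_ball)
      next
        case 2
        then have "cball (0::complex) x \<subseteq> ball 0 1" by auto
        then have "emeasure lborel (ball (0::complex) 1 - cball 0 x)
          = emeasure lborel (ball (0::complex) 1) - emeasure lborel (cball (0::complex) x)"
          by (intro emeasure_Diff) (simp_all add: emeasure_lborel_complex_ball(2) 2)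
        then show ?thesis
          using 2 by (simp add: emeasure_lborel_complex_ball ennreal_minus right_diff_distrib)
      next
        case 3
        then have "ball (0::complex) 1 - cball 0 x = {}"
          by (intro equals0I) auto
        then show ?thesis using 3 by (simp only: emeasure_empty) simp
      qed
    qed
    also have "ennreal (1 / pi) * ennreal (pi * (if x < 0 then 1 else if x < 1 then 1 - x\<^sup>2 else 0))
      = ennreal (if x < 0 then 1 else if x < 1 then 1 - x\<^sup>2 else 0)"
      by (subst ennreal_mult'[symmetric]) simp_all
    finally show ?thesis .
  qed
  have 2: "emeasure (density lborel (\<lambda>r. ennreal (2 * r * indicator {0..<1} r))) {x<..}
     = ennreal (if x < 0 then 1 else if x < 1 then 1 - x\<^sup>2 else 0)"
  proof -
    have "emeasure (density lborel (\<lambda>r. ennreal (2 * r * indicator {0..<1} r))) {x<..}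
      = (\<integral>\<^sup>+r. ennreal (2 * r * indicator {0..<1} r) * indicator {x<..} r \<partial>lborel)"
      by (intro emeasure_density) simp_all
    \<comment> \<open>Clamping \<open>x\<close> to [0, 1] treats all positions of \<open>x\<close>
      by one integral; the intervals differ only in the points \<open>x\<close> and 1, which are
      null.\<close>
    also have "\<dots> = (\<integral>\<^sup>+r. ennreal (2 * r) * indicator {max 0 (min x 1)..1} r \<partial>lborel)"
      using AE_lborel_singleton[of x] AE_lborel_singleton[of 1]
      by (intro nn_integral_cong_AE, eventually_elim)
        (auto simp: indicator_def min_def split: if_splits)
    also have "\<dots> = ennreal (1\<^sup>2 - (max 0 (min x 1))\<^sup>2)"
      by (rule nn_integral_FTC_Icc[where F = "\<lambda>x. x\<^sup>2"])
        (auto intro!: derivative_eq_intros)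
    also have "1\<^sup>2 - (max 0 (min x 1))\<^sup>2 = (if x < 0 then 1 else if x < 1 then 1 - x\<^sup>2 else 0)"
      by (simp add: max_def min_def)
    finally show ?thesis .
  qed
  show "emeasure (distr disk_area borel cmod) {x<..} =
    emeasure (density lborel (\<lambda>r. ennreal (2 * r * indicator {0..<1} r))) {x<..}"
    using 1 2 by simp
  show "emeasure (distr disk_area borel cmod) {x<..} < \<infinity>"
    unfolding 1 infinity_ennreal_def by (rule ennreal_less_top)
qed (simp_all only: sets_distr sets_density sets_lborel)

lemma nn_integral_disk_area_radial:
  assumes [measurable]: "g \<in> borel_measurable borel"
  shows "(\<integral>\<^sup>+z. g (cmod z) \<partial>disk_area) = (\<integral>\<^sup>+r. ennreal (2 * r * indicator {0..<1} r) * g r \<partial>lborel)"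
proof -
  have "(\<integral>\<^sup>+z. g (cmod z) \<partial>disk_area) = (\<integral>\<^sup>+r. g r \<partial>distr disk_area borel cmod)"
    by (subst nn_integral_distr) auto
  then show ?thesis
    by (simp add: distr_cmod_disk_area nn_integral_density)
qed

section \<open>Convex functions are subharmonic\<close>

lemma directional_deriv_DERIV:
  assumes "\<And>z. f differentiable (at z)"
  shows "((\<lambda>s. f (z + s *\<^sub>R v)) has_real_derivative directional_deriv v f (z + s *\<^sub>R v)) (at s)"
proof -
  let ?D = "frechet_derivative f (at (z + s *\<^sub>R v))"
  have D: "(f has_derivative ?D) (at (z + s *\<^sub>R v))"
    using assms frechet_derivative_works by blast
  have "((\<lambda>s. z + s *\<^sub>R v) has_derivative (\<lambda>s. s *\<^sub>R v)) (at s)"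
    by (auto intro!: derivative_eq_intros)
  from has_derivative_compose[OF this D]
  have "((\<lambda>s. f (z + s *\<^sub>R v)) has_derivative (\<lambda>s. ?D (s *\<^sub>R v))) (at s)" .
  moreover have "?D (s *\<^sub>R v) = ?D v * s" for s
    using linear_scale[OF has_derivative_linear[OF D], of s v] by (simp add: mult.commute)
  ultimately show ?thesis
    by (simp add: has_field_derivative_def directional_deriv_def)
qed

text \<open>As a function of the step, the sum of the two shifted values is even, so its first
  derivative vanishes at 0 and Maclaurin's formula of order 2 leaves only the second derivative at
  an intermediate point.\<close>

lemma second_difference_eq:
  fixes f :: "complex \<Rightarrow> real"
  assumes f: "\<And>z. f differentiable (at z)" "\<And>z. directional_deriv v f differentiable (at z)" and h: "0 < h"
  obtains t where "0 < t" "t < h"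
    "f (z + h *\<^sub>R v) + f (z - h *\<^sub>R v) - 2 * f z = h\<^sup>2 / 2 *
      (directional_deriv v (directional_deriv v f) (z + t *\<^sub>R v) + directional_deriv v (directional_deriv v f) (z - t *\<^sub>R v))"
proof -
  let ?d = "directional_deriv v f" and ?dd = "directional_deriv v (directional_deriv v f)"
  define D where "D m s = (if m = (0::nat) then f (z + s *\<^sub>R v) + f (z - s *\<^sub>R v)
    else if m = 1 then ?d (z + s *\<^sub>R v) - ?d (z - s *\<^sub>R v)
    else ?dd (z + s *\<^sub>R v) + ?dd (z - s *\<^sub>R v))" for m s
  have neg: "((\<lambda>s. g (z - s *\<^sub>R v)) has_real_derivative (- directional_deriv v g (z - s *\<^sub>R v))) (at s)"
    if "\<And>z. g differentiable (at z)" for g :: "complex \<Rightarrow> real" and s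
    using DERIV_chain2[OF directional_deriv_DERIV[OF that, of z v "- s"] DERIV_minus[OF DERIV_ident]] by simp
  have "\<exists>t::real. 0 < t \<and> t < h \<and> D 0 h = sum (\<lambda>m. (D m 0 / fact m) * h ^ m) {..<2} + (D 2 t / fact 2) * h ^ 2"
  proof (rule Maclaurin[OF h])
    show "\<forall>m t. m < 2 \<and> 0 \<le> t \<and> t \<le> h \<longrightarrow> DERIV (D m) t :> D (Suc m) t"
    proof (intro allI impI)
      fix m :: nat and t :: real assume "m < 2 \<and> 0 \<le> t \<and> t \<le> h"
      then consider "m = 0" | "m = 1" by linarith
      then show "DERIV (D m) t :> D (Suc m) t"
      proof cases
        case 1
        then show ?thesis
          using DERIV_add[OF directional_deriv_DERIV[OF f(1), of z v t] neg[OF f(1), of t]] by (simp add: D_def[abs_def])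
      next
        case 2
        then show ?thesis
          using DERIV_diff[OF directional_deriv_DERIV[OF f(2), of z v t] neg[OF f(2), of t]] by (simp add: D_def[abs_def])
      qed
    qed
  qed simp_all
  then obtain t where t: "0 < t" "t < h" "D 0 h = sum (\<lambda>m. (D m 0 / fact m) * h ^ m) {..<2} + (D 2 t / fact 2) * h ^ 2"
    by blast
  show ?thesis
    by (rule that[OF t(1,2)]) (use t(3) in \<open>simp add: D_def numeral_2_eq_2 algebra_simps\<close>)
qed

lemma lborel_integral_translate:
  fixes f :: "complex \<Rightarrow> real"
  assumes [measurable]: "f \<in> borel_measurable borel"
  shows "(LINT z|lborel. f (w + z)) = (LINT z|lborel. f z)"
proof -
  have "(LINT z|lborel. f z) = (LINT z|distr lborel borel ((+) w). f z)"
    by (simp add: lborel_distr_plus)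
  also have "\<dots> = (LINT z|lborel. f (w + z))"
    by (intro integral_distr) auto
  finally show ?thesis by simp
qed

lemma integrable_bounded_support:
  fixes f :: "complex \<Rightarrow> real"
  assumes "f \<in> borel_measurable borel" "compact K" "\<And>z. z \<notin> K \<Longrightarrow> f z = 0" "\<And>z. z \<in> K \<Longrightarrow> \<bar>f z\<bar> \<le> B"
  shows "integrable lborel f"
proof (rule Bochner_Integration.integrable_bound)
  show "integrable lborel (\<lambda>z. indicator K z *\<^sub>R B)"
    using emeasure_compact_finite[OF assms(2)] assms(2)
    by (intro integrable_scaleR_left integrable_real_indicator) (auto simp: borel_compact less_top)
  show "AE z in lborel. norm (f z) \<le> norm (indicator K z *\<^sub>R B)"
    using assms(3,4) by (intro AE_I2) (fastforce simp: indicator_def)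
qed (use assms(1) in simp)

lemma compact_support_margin:
  fixes K :: "complex set"
  assumes K: "compact K" "K \<subseteq> ball 0 1"
  obtains d L where "0 < d" "compact L" "K \<subseteq> L" "L \<subseteq> ball 0 1"
    "\<And>z w. z \<in> K \<Longrightarrow> cmod w \<le> d \<Longrightarrow> z + w \<in> L"
proof -
  have "\<exists>s<1. K \<subseteq> cball 0 s"
  proof (cases "K = {}")
    case False
    obtain x where x: "x \<in> K" "\<And>y. y \<in> K \<Longrightarrow> cmod y \<le> cmod x"
      using continuous_attains_sup[OF K(1) False, of cmod] by (auto intro: continuous_intros)
    then show ?thesis using K(2) by (intro exI[of _ "cmod x"]) auto
  qed (auto intro: exI[of _ 0])
  then obtain s where s: "s < 1" "K \<subseteq> cball 0 s" by blast
  define d where "d = (1 - s) / 2"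
  have sd: "s \<le> s + d" "s + d < 1" "0 < d" using s(1) by (simp_all add: d_def field_simps)
  show ?thesis
  proof (rule that[of d "cball 0 (s + d)"])
    show "z + w \<in> cball 0 (s + d)" if "z \<in> K" "cmod w \<le> d" for z w
      using that s norm_triangle_ineq[of z w] by fastforce
    show "K \<subseteq> cball 0 (s + d)" using s(2) sd(1) by fastforce
    show "cball 0 (s + d) \<subseteq> ball 0 1" using sd(2) by auto
  qed (use sd in auto)
qed

lemma directional_deriv_eq_0:
  assumes "open S" "z \<in> S" "\<And>w. w \<in> S \<Longrightarrow> f w = 0"
  shows "directional_deriv v f z = 0"
proof -
  have "(f has_derivative (\<lambda>_. 0)) (at z)"
    by (rule has_derivative_transform_within_open[OF _ assms(1,2), of "\<lambda>_. 0"]) (auto simp: assms(3))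
  then have "frechet_derivative f (at z) = (\<lambda>_. 0)"
    by (rule frechet_derivative_at[symmetric])
  then show ?thesis by (simp add: directional_deriv_def)
qed

lemma compactly_supported_bounded:
  fixes f :: "complex \<Rightarrow> real"
  assumes "compact K" "continuous_on UNIV f" "\<And>z. z \<notin> K \<Longrightarrow> f z = 0"
  obtains M where "0 \<le> M" "\<And>z. \<bar>f z\<bar> \<le> M"
proof -
  have "bounded (f ` K)"
    by (intro compact_imp_bounded compact_continuous_image continuous_on_subset[OF assms(2)] assms(1)) simp
  then obtain M where "\<And>z. z \<in> K \<Longrightarrow> \<bar>f z\<bar> \<le> M" by (auto simp: bounded_iff)
  then have "\<bar>f z\<bar> \<le> max M 0" for z
    using assms(3)[of z] by (cases "z \<in> K") (auto intro: max.coboundedI1)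
  then show ?thesis by (intro that[of "max M 0"]) auto
qed

text \<open>A convex function need not be twice differentiable, so the second derivative of \<phi>
  is replaced by symmetric difference quotients. Translation invariance moves these onto the convex
  function, where they are nonnegative, and dominated convergence restores the derivative.
  \<open>H\<close> is the extension by zero, so that all integrals run over the plane.\<close>

lemma convex_second_derivative_test:
  fixes h \<phi> :: "complex \<Rightarrow> real"
  assumes h: "convex_on (ball 0 1) h" and \<phi>: "test_function_on (ball 0 1) \<phi>" "\<And>z. 0 \<le> \<phi> z"
  defines "H \<equiv> \<lambda>z. indicator (ball 0 1) z * h z"
  shows "integrable lborel (\<lambda>z. H z * directional_deriv v (directional_deriv v \<phi>) z)"
    and "0 \<le> (LINT z|lborel. H z * directional_deriv v (directional_deriv v \<phi>) z)"
proof -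
  define K where "K = closure {z. \<phi> z \<noteq> 0}"
  define \<psi> where "\<psi> = directional_deriv v (directional_deriv v \<phi>)"
  have K: "compact K" "K \<subseteq> ball 0 1"
    using \<phi>(1) by (auto simp: test_function_on_def K_def)
  obtain d0 L where d0: "0 < d0" and L: "compact L" "K \<subseteq> L" "L \<subseteq> ball 0 1"
    and KL: "\<And>z w. z \<in> K \<Longrightarrow> cmod w \<le> d0 \<Longrightarrow> z + w \<in> L"
    using compact_support_margin[OF K] by blast
  \<comment> \<open>The summand 1 keeps \<open>d\<close> positive even for
    \<open>v = 0\<close>.\<close>
  define d where "d = d0 / (1 + cmod v)"
  have pv: "0 < 1 + cmod v" by (simp add: add_pos_nonneg)
  have d: "0 < d" using d0 pv by (simp add: d_def)
  have dv: "cmod (t *\<^sub>R v) \<le> d0" if "\<bar>t\<bar> \<le> d" for t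
  proof -
    have "cmod (t *\<^sub>R v) \<le> d * (1 + cmod v)" using that d by (auto intro!: mult_mono)
    also have "\<dots> = d0" using pv by (simp add: d_def)
    finally show ?thesis .
  qed
  have kt: "k_times_cont_diff 0 \<phi>" "k_times_cont_diff (Suc (Suc 0)) \<phi>"
    using \<phi>(1) unfolding test_function_on_def by blast+
  have d1: "\<phi> differentiable (at z)" for z using kt(2) by simp
  have d2: "directional_deriv v \<phi> differentiable (at z)" for z
    using kt(2) by (simp add: directional_deriv_def[abs_def])
  have c0: "continuous_on UNIV \<phi>" using kt(1) by simp
  have c2: "continuous_on UNIV \<psi>"
    using kt(2) by (simp add: directional_deriv_def[abs_def] \<psi>_def)
  have [measurable]: "\<phi> \<in> borel_measurable borel" "\<psi> \<in> borel_measurable borel"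
    by (auto intro: borel_measurable_continuous_onI c0 c2)
  have hc: "continuous_on (ball 0 1) h"
    by (rule convex_on_continuous[OF open_ball h])
  have [measurable]: "H \<in> borel_measurable borel"
    using borel_measurable_continuous_on_indicator[OF _ hc] by (simp add: H_def)
  obtain B where B: "0 \<le> B" "\<And>z. z \<in> L \<Longrightarrow> \<bar>H z\<bar> \<le> B"
  proof -
    have "bounded (h ` L)"
      by (intro compact_imp_bounded compact_continuous_image continuous_on_subset[OF hc] L)
    then obtain B where "\<And>z. z \<in> L \<Longrightarrow> \<bar>h z\<bar> \<le> B" by (auto simp: bounded_iff)
    then show ?thesis using L(3)
      by (intro that[of "max B 0"]) (auto simp: H_def indicator_def intro: order_trans max.coboundedI1)
  qed
  have \<phi>0: "\<phi> z = 0" if "z \<notin> K" for z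
    using that closure_subset[of "{z. \<phi> z \<noteq> 0}"] by (auto simp: K_def)
  have \<psi>0: "\<psi> z = 0" if "z \<notin> K" for z
  proof -
    have op: "open (- K)" using K(1) by (simp add: compact_imp_closed open_Compl)
    have "directional_deriv v \<phi> w = 0" if "w \<in> - K" for w
      by (rule directional_deriv_eq_0[OF op that]) (simp add: \<phi>0)
    then show ?thesis unfolding \<psi>_def using that by (intro directional_deriv_eq_0[OF op, where f = "directional_deriv v \<phi>"]) simp_all
  qed
  obtain M where M: "0 \<le> M" "\<And>z. \<bar>\<psi> z\<bar> \<le> M"
    using compactly_supported_bounded[OF K(1) c2 \<psi>0] by blast
  obtain P where P: "\<And>z. \<bar>\<phi> z\<bar> \<le> P"
    using compactly_supported_bounded[OF K(1) c0 \<phi>0] by blast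
  show "integrable lborel (\<lambda>z. H z * directional_deriv v (directional_deriv v \<phi>) z)"
    unfolding \<psi>_def[symmetric]
  proof (rule integrable_bounded_support[OF _ L(1), where B = "B * M"])
    show "\<bar>H z * \<psi> z\<bar> \<le> B * M" if "z \<in> L" for z
      unfolding abs_mult using B M that by (intro mult_mono) auto
    show "H z * \<psi> z = 0" if "z \<notin> L" for z using that \<psi>0[of z] L(2) by auto
  qed measurable
  have sh: "integrable lborel (\<lambda>z. H z * \<phi> (z + w))" if w: "cmod w \<le> d0" for w
  proof (rule integrable_bounded_support[OF _ L(1), where B = "B * P"])
    show "\<bar>H z * \<phi> (z + w)\<bar> \<le> B * P" if "z \<in> L" for z
      unfolding abs_mult using B P that by (intro mult_mono) auto
    show "H z * \<phi> (z + w) = 0" if "z \<notin> L" for z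
      using that KL[of "z + w" "- w"] \<phi>0[of "z + w"] w by auto
  qed measurable
  have sh': "(LINT z|lborel. H z * \<phi> (z + w)) = (LINT z|lborel. H (z - w) * \<phi> z)"
    "integrable lborel (\<lambda>z. H (z - w) * \<phi> z)" if "cmod w \<le> d0" for w
  proof -
    show "(LINT z|lborel. H z * \<phi> (z + w)) = (LINT z|lborel. H (z - w) * \<phi> z)"
      using lborel_integral_translate[of "\<lambda>z. H (z - w) * \<phi> z" w] by (simp add: add.commute)
    show "integrable lborel (\<lambda>z. H (z - w) * \<phi> z)"
    proof (rule integrable_bounded_support[OF _ K(1), where B = "B * P"])
      show "\<bar>H (z - w) * \<phi> z\<bar> \<le> B * P" if "z \<in> K" for z
        unfolding abs_mult using B P KL[OF that, of "- w"] \<open>cmod w \<le> d0\<close> by (intro mult_mono) auto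
    qed (auto simp: \<phi>0)
  qed
  define e where "e n = d / real (Suc n)" for n
  have e: "0 < e n" "\<bar>e n\<bar> \<le> d" for n using d by (auto simp: e_def field_simps)
  have e0: "e \<longlonglongrightarrow> 0"
    using tendsto_mult[OF tendsto_const[of d] LIMSEQ_inverse_real_of_nat] by (simp add: e_def[abs_def] divide_inverse)
  \<comment> \<open>By \<open>second_difference_eq\<close> each \<open>Q n z\<close> is a mean of
    two values of \<psi> near \<open>z\<close>. This gives at once the uniform bound
    \<open>M\<close> and, by continuity of \<psi>, the pointwise limit.\<close>
  define Q where "Q n z = (\<phi> (z + e n *\<^sub>R v) + \<phi> (z - e n *\<^sub>R v) - 2 * \<phi> z) / (e n)\<^sup>2" for n z
  have Q: "\<exists>t. \<bar>t\<bar> \<le> e n \<and> Q n z = (\<psi> (z + t *\<^sub>R v) + \<psi> (z - t *\<^sub>R v)) / 2" for n z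
  proof -
    obtain t where t: "0 < t" "t < e n"
      "\<phi> (z + e n *\<^sub>R v) + \<phi> (z - e n *\<^sub>R v) - 2 * \<phi> z = (e n)\<^sup>2 / 2 * (\<psi> (z + t *\<^sub>R v) + \<psi> (z - t *\<^sub>R v))"
      using second_difference_eq[OF d1 d2 e(1), where z = z] unfolding \<psi>_def by blast
    then show ?thesis
      unfolding Q_def t(3) using e(1)[of n] by (intro exI[of _ t]) (simp add: field_simps)
  qed
  have QM: "\<bar>Q n z\<bar> \<le> M" for n z
  proof -
    obtain t where "Q n z = (\<psi> (z + t *\<^sub>R v) + \<psi> (z - t *\<^sub>R v)) / 2" using Q by blast
    then have "\<bar>Q n z\<bar> \<le> (\<bar>\<psi> (z + t *\<^sub>R v)\<bar> + \<bar>\<psi> (z - t *\<^sub>R v)\<bar>) / 2" by simp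
    also have "\<dots> \<le> (M + M) / 2"
      by (intro divide_right_mono add_mono M(2)) simp
    finally show ?thesis by simp
  qed
  have Qlim: "(\<lambda>n. Q n z) \<longlonglongrightarrow> \<psi> z" for z
  proof -
    obtain t where t: "\<And>n. \<bar>t n\<bar> \<le> e n" "\<And>n. Q n z = (\<psi> (z + t n *\<^sub>R v) + \<psi> (z - t n *\<^sub>R v)) / 2"
      using Q[of _ z] by metis
    have t0: "t \<longlonglongrightarrow> 0"
      by (rule Lim_null_comparison[OF always_eventually e0]) (simp add: t(1))
    have "isCont \<psi> z" using c2 by (simp add: continuous_on_eq_continuous_at)
    moreover have "(\<lambda>n. z + t n *\<^sub>R v) \<longlonglongrightarrow> z + 0 *\<^sub>R v" "(\<lambda>n. z - t n *\<^sub>R v) \<longlonglongrightarrow> z - 0 *\<^sub>R v"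
      by (intro tendsto_intros t0)+
    ultimately have "(\<lambda>n. \<psi> (z + t n *\<^sub>R v)) \<longlonglongrightarrow> \<psi> z" "(\<lambda>n. \<psi> (z - t n *\<^sub>R v)) \<longlonglongrightarrow> \<psi> z"
      using isCont_tendsto_compose[of z \<psi>] by simp_all
    from tendsto_divide[OF tendsto_add[OF this] tendsto_const[of 2]]
    show ?thesis by (simp add: t(2))
  qed
  have lim: "(\<lambda>n. LINT z|lborel. H z * Q n z) \<longlonglongrightarrow> (LINT z|lborel. H z * \<psi> z)"
  proof (rule integral_dominated_convergence[where w = "\<lambda>z. indicator L z * (B * M)"])
    show "integrable lborel (\<lambda>z. indicator L z * (B * M))"
    proof (rule integrable_bounded_support[OF _ L(1), where B = "B * M"])
      show "(\<lambda>z. indicator L z * (B * M)) \<in> borel_measurable borel"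
        using borel_compact[OF L(1)] by simp
    qed (use B M in auto)
    show "AE z in lborel. norm (H z * Q n z) \<le> indicator L z * (B * M)" for n
    proof (rule AE_I2)
      fix z
      show "norm (H z * Q n z) \<le> indicator L z * (B * M)"
      proof (cases "z \<in> L")
        case True
        have "\<bar>H z\<bar> * \<bar>Q n z\<bar> \<le> B * M" using B True QM by (intro mult_mono) auto
        with True show ?thesis by (simp add: abs_mult)
      next
        case False
        have "z + e n *\<^sub>R v \<notin> K" "z - e n *\<^sub>R v \<notin> K" "z \<notin> K"
          using False KL[of "z + e n *\<^sub>R v" "- (e n *\<^sub>R v)"] KL[of "z - e n *\<^sub>R v" "e n *\<^sub>R v"] dv[OF e(2)[of n]] L(2)
          by auto
        then show ?thesis using False by (simp add: Q_def \<phi>0)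
      qed
    qed
    show "AE z in lborel. (\<lambda>n. H z * Q n z) \<longlonglongrightarrow> H z * \<psi> z"
      by (intro AE_I2 tendsto_intros Qlim)
  qed (simp_all add: Q_def)
  moreover have "0 \<le> (LINT z|lborel. H z * Q n z)" for n
  proof -
    let ?w = "e n *\<^sub>R v"
    have w: "cmod ?w \<le> d0" "cmod (- ?w) \<le> d0" "cmod 0 \<le> d0" using dv[OF e(2)] d0 by auto
    have "(LINT z|lborel. H z * Q n z) =
      (LINT z|lborel. (H z * \<phi> (z + ?w) + H z * \<phi> (z + - ?w) - 2 * (H z * \<phi> (z + 0))) / (e n)\<^sup>2)"
      by (intro Bochner_Integration.integral_cong refl) (simp add: Q_def field_simps)
    also have "\<dots> = ((LINT z|lborel. H z * \<phi> (z + ?w)) + (LINT z|lborel. H z * \<phi> (z + - ?w)) - 2 * (LINT z|lborel. H z * \<phi> (z + 0))) / (e n)\<^sup>2"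
      using sh[OF w(1)] sh[OF w(2)] sh[OF w(3)] by simp
    also have "\<dots> = ((LINT z|lborel. H (z - ?w) * \<phi> z) + (LINT z|lborel. H (z - - ?w) * \<phi> z) - 2 * (LINT z|lborel. H (z - 0) * \<phi> z)) / (e n)\<^sup>2"
      unfolding sh'(1)[OF w(1)] sh'(1)[OF w(2)] sh'(1)[OF w(3)] ..
    also have "\<dots> = (LINT z|lborel. H (z - ?w) * \<phi> z + H (z - - ?w) * \<phi> z - 2 * (H (z - 0) * \<phi> z)) / (e n)\<^sup>2"
      using sh'(2)[OF w(1)] sh'(2)[OF w(2)] sh'(2)[OF w(3)] by simp
    also have "0 \<le> \<dots>"
    proof (intro divide_nonneg_nonneg integral_nonneg_AE AE_I2)
      fix z
      show "0 \<le> H (z - ?w) * \<phi> z + H (z - - ?w) * \<phi> z - 2 * (H (z - 0) * \<phi> z)"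
      \<comment> \<open>On the support of \<phi> both translates stay in the disk, so that midpoint
        convexity applies; off the support the integrand is 0, whatever the zero extension does
        there.\<close>
      proof (cases "z \<in> K")
        case True
        have in_ball: "z - ?w \<in> ball 0 1" "z + ?w \<in> ball 0 1" "z \<in> ball 0 1"
          using KL[OF True w(2)] KL[OF True w(1)] L(3) K(2) True by auto
        have mid: "(1 - 1 / 2) *\<^sub>R (z - ?w) + (1 / 2) *\<^sub>R (z + ?w) = z"
          by (simp add: algebra_simps flip: scaleR_left.add)
        have "h ((1 - 1 / 2) *\<^sub>R (z - ?w) + (1 / 2) *\<^sub>R (z + ?w)) \<le> (1 - 1 / 2) * h (z - ?w) + (1 / 2) * h (z + ?w)"
          using in_ball(1,2) by (intro convex_onD[OF h]) auto
        then have "0 \<le> h (z - ?w) + h (z + ?w) - 2 * h z" unfolding mid by simp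
        then have "0 \<le> (h (z - ?w) + h (z + ?w) - 2 * h z) * \<phi> z" using \<phi>(2) by simp
        then show ?thesis using in_ball by (simp add: H_def algebra_simps)
      qed (simp add: \<phi>0)
    qed simp
    finally show ?thesis .
  qed
  ultimately show "0 \<le> (LINT z|lborel. H z * directional_deriv v (directional_deriv v \<phi>) z)"
    unfolding \<psi>_def by (intro LIMSEQ_le_const) auto
qed

lemma finite_measure_disk_area: "finite_measure disk_area"
proof
  have "emeasure disk_area (space disk_area) = (\<integral>\<^sup>+z. 1 \<partial>disk_area)" by simp
  also have "\<dots> = ennreal (1 / pi) * emeasure lborel (ball (0::complex) 1)"
    by (subst nn_integral_disk_area) (simp_all add: nn_integral_cmult_indicator)
  finally show "emeasure disk_area (space disk_area) \<noteq> \<infinity>"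
    by (simp add: emeasure_lborel_complex_ball flip: ennreal_mult')
qed

lemma integral_disk_area:
  fixes F :: "complex \<Rightarrow> real"
  assumes [measurable]: "F \<in> borel_measurable borel"
  shows "(LINT z|disk_area. F z) = (LINT z|lborel. indicator (ball 0 1) z * F z) / pi"
proof -
  have [measurable]: "F \<in> borel_measurable (restrict_space lborel (ball 0 1))"
    by (intro measurable_restrict_space1) simp
  have "(LINT z|disk_area. F z) = (LINT z|restrict_space lborel (ball 0 1). (1 / pi) *\<^sub>R F z)"
    unfolding disk_area_def by (intro integral_density) auto
  also have "\<dots> = (LINT z|lborel. indicator (ball 0 1) z *\<^sub>R ((1 / pi) *\<^sub>R F z))"
    by (intro integral_restrict_space) simp
  also have "\<dots> = (LINT z|lborel. (indicator (ball 0 1) z * F z) / pi)"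
    by (intro Bochner_Integration.integral_cong) auto
  finally show ?thesis by simp
qed

theorem convex_imp_distr_subharmonic:
  assumes h: "convex_on (ball 0 1) h"
  shows "distr_subharmonic_on_disk h"
  unfolding distr_subharmonic_on_disk_def
proof (intro conjI allI impI)
  interpret finite_measure disk_area by (rule finite_measure_disk_area)
  have hc: "continuous_on (ball 0 1) h" by (rule convex_on_continuous[OF open_ball h])
  then have hm [measurable]: "h \<in> borel_measurable disk_area"
    using borel_measurable_continuous_on_restrict[of "ball 0 1" h]
    by (simp add: measurable_cong_sets[OF sets_disk_area refl])
  fix K :: "complex set" assume K: "compact K \<and> K \<subseteq> ball 0 1"
  then have "bounded (h ` K)"
    by (intro compact_imp_bounded compact_continuous_image continuous_on_subset[OF hc]) auto
  then obtain B where B: "\<And>z. z \<in> K \<Longrightarrow> \<bar>h z\<bar> \<le> B" by (auto simp: bounded_iff)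
  have [measurable]: "(indicator K :: complex \<Rightarrow> real) \<in> borel_measurable disk_area"
    using K by (intro measurable_disk_area borel_measurable_indicator borel_compact) simp
  show "set_integrable disk_area K h"
    unfolding set_integrable_def
  proof (rule integrable_const_bound)
    show "AE z in disk_area. norm (indicator K z *\<^sub>R h z) \<le> max B 0"
      using B by (intro AE_I2) (auto simp: indicator_def intro: max.coboundedI1)
  qed measurable
next
  fix \<phi> assume \<phi>: "test_function_on (ball 0 1) \<phi> \<and> (\<forall>z. 0 \<le> \<phi> z)"
  let ?H = "\<lambda>z. indicator (ball 0 1) z * h z"
  let ?\<psi> = "\<lambda>v. directional_deriv v (directional_deriv v \<phi>)"
  note c = convex_second_derivative_test[OF h conjunct1[OF \<phi>] conjunct2[OF \<phi>, rule_format]]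
  have m: "(\<lambda>z. ?H z * ?\<psi> 1 z + ?H z * ?\<psi> \<i> z) \<in> borel_measurable borel"
    using borel_measurable_integrable[OF c(1)[of 1]] borel_measurable_integrable[OF c(1)[of \<i>]]
    by (intro borel_measurable_add) simp_all
  have "(LINT z|disk_area. h z * laplacian \<phi> z) = (LINT z|disk_area. ?H z * ?\<psi> 1 z + ?H z * ?\<psi> \<i> z)"
    by (intro Bochner_Integration.integral_cong refl) (simp add: laplacian_def algebra_simps)
  also have "\<dots> = (LINT z|lborel. indicator (ball 0 1) z * (?H z * ?\<psi> 1 z + ?H z * ?\<psi> \<i> z)) / pi"
    by (rule integral_disk_area[OF m])
  also have "(LINT z|lborel. indicator (ball 0 1) z * (?H z * ?\<psi> 1 z + ?H z * ?\<psi> \<i> z)) =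
    (LINT z|lborel. ?H z * ?\<psi> 1 z + ?H z * ?\<psi> \<i> z)"
    by (intro Bochner_Integration.integral_cong refl) (simp add: indicator_def)
  also have "\<dots> = (LINT z|lborel. ?H z * ?\<psi> 1 z) + (LINT z|lborel. ?H z * ?\<psi> \<i> z)"
    by (rule Bochner_Integration.integral_add[OF c(1) c(1)])
  finally show "0 \<le> (LINT z|disk_area. h z * laplacian \<phi> z)"
    using c(2)[of 1] c(2)[of \<i>] by simp
qed

section \<open>Radial weights\<close>

locale positive_radial_weight =
  fixes \<omega> :: "real \<Rightarrow> real"
  assumes weight: "radial_weight \<omega>"
    and pos: "\<And>r. 0 \<le> r \<Longrightarrow> r < 1 \<Longrightarrow> 0 < \<omega> r"
begin

abbreviation \<mu> :: "complex measure" where "\<mu> \<equiv> weighted_area \<omega>"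

text \<open>Outside \<open>[0, 1)\<close> the function \<open>\<omega>\<close> is arbitrary and need not be measurable.\<close>

definition weight0 :: "real \<Rightarrow> real" where
  "weight0 r = indicator {0..<1} r * \<omega> r"

lemma weight0_integrable: "integrable lborel weight0"
  using weight unfolding radial_weight_def set_integrable_def weight0_def[abs_def] by simp

lemma weight0_measurable [measurable]: "weight0 \<in> borel_measurable borel"
  using borel_measurable_integrable[OF weight0_integrable] by simp

lemma weight0_nonneg: "0 \<le> weight0 r"
  using pos[of r] by (auto simp: weight0_def indicator_def intro: less_imp_le)

lemma weighted_area_eq: "\<mu> = density disk_area (\<lambda>z. ennreal (weight0 (cmod z)))"
proof -
  have eq: "weight0 (cmod z) = \<omega> (cmod z)" if "z \<in> space disk_area" for z
    using that by (simp add: weight0_def)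
  have "(\<lambda>z. ennreal (weight0 (cmod z))) \<in> borel_measurable disk_area" by measurable
  moreover from this have "(\<lambda>z. ennreal (\<omega> (cmod z))) \<in> borel_measurable disk_area"
    by (subst measurable_cong[OF arg_cong[OF eq[symmetric]]])
  ultimately show ?thesis
    unfolding weighted_area_def using eq by (intro density_cong) auto
qed

lemma space_mu [simp]: "space \<mu> = ball 0 1"
  by (simp add: weighted_area_def)

lemma sets_mu: "sets \<mu> = sets (restrict_space borel (ball 0 1))"
  by (simp add: weighted_area_def sets_disk_area)

lemma borel_measurable_mu_iff: "borel_measurable \<mu> = borel_measurable disk_area"
  by (intro measurable_cong_sets) (auto simp: weighted_area_def)

lemma measurable_mu: "f \<in> borel_measurable borel \<Longrightarrow> f \<in> borel_measurable \<mu>"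
  by (simp add: borel_measurable_mu_iff measurable_disk_area)

lemma cmod_measurable_mu [measurable]: "cmod \<in> borel_measurable \<mu>"
  by (simp add: borel_measurable_mu_iff)

lemma monom_measurable_mu [measurable]: "(\<lambda>z. z ^ n) \<in> borel_measurable \<mu>"
  by (rule measurable_mu) simp

lemma continuous_measurable_mu: "continuous_on (ball 0 1) f \<Longrightarrow> f \<in> borel_measurable \<mu>"
  using borel_measurable_continuous_on_restrict[of "ball 0 1" f]
  by (simp add: measurable_cong_sets[OF sets_mu refl])

lemma nn_integral_mu:
  assumes [measurable]: "f \<in> borel_measurable borel"
  shows "(\<integral>\<^sup>+z. f z \<partial>\<mu>) = (\<integral>\<^sup>+z. ennreal (weight0 (cmod z) / pi) * f z \<partial>lborel)"
proof -
  have [measurable]: "f \<in> borel_measurable disk_area"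
    by (rule measurable_disk_area) simp
  have "(\<integral>\<^sup>+z. f z \<partial>\<mu>) = (\<integral>\<^sup>+z. ennreal (weight0 (cmod z)) * f z \<partial>disk_area)"
    unfolding weighted_area_eq by (intro nn_integral_density) measurable
  also have "\<dots> = (\<integral>\<^sup>+z. ennreal (1 / pi) * (ennreal (weight0 (cmod z)) * f z) * indicator (ball 0 1) z \<partial>lborel)"
    by (intro nn_integral_disk_area) measurable
  also have "\<dots> = (\<integral>\<^sup>+z. ennreal (weight0 (cmod z) / pi) * f z \<partial>lborel)"
  proof (intro nn_integral_cong)
    fix z :: complex
    have "ennreal (weight0 (cmod z) / pi) = ennreal (1 / pi) * ennreal (weight0 (cmod z))"
      by (subst ennreal_mult'[symmetric]) simp_all
    then show "ennreal (1 / pi) * (ennreal (weight0 (cmod z)) * f z) * indicator (ball 0 1) z =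
      ennreal (weight0 (cmod z) / pi) * f z"
      by (simp add: indicator_def weight0_def mult.assoc)
  qed
  finally show ?thesis .
qed

lemma nn_integral_mu_radial:
  assumes [measurable]: "g \<in> borel_measurable borel"
  shows "(\<integral>\<^sup>+z. g (cmod z) \<partial>\<mu>) = (\<integral>\<^sup>+r. ennreal (2 * r * weight0 r) * g r \<partial>lborel)"
proof -
  have "(\<integral>\<^sup>+z. g (cmod z) \<partial>\<mu>) = (\<integral>\<^sup>+z. ennreal (weight0 (cmod z)) * g (cmod z) \<partial>disk_area)"
    unfolding weighted_area_eq by (intro nn_integral_density) measurable
  also have "\<dots> = (\<integral>\<^sup>+r. ennreal (2 * r * indicator {0..<1} r) * (ennreal (weight0 r) * g r) \<partial>lborel)"
    by (intro nn_integral_disk_area_radial) measurable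
  also have "\<dots> = (\<integral>\<^sup>+r. ennreal (2 * r * weight0 r) * g r \<partial>lborel)"
  proof (intro nn_integral_cong)
    fix r :: real
    have "ennreal (2 * r * indicator {0..<1} r) * ennreal (weight0 r) = ennreal (2 * r * indicator {0..<1} r * weight0 r)"
      by (intro ennreal_mult''[symmetric] weight0_nonneg)
    also have "2 * r * indicator {0..<1} r * weight0 r = 2 * r * weight0 r"
      by (simp add: weight0_def indicator_def)
    finally show "ennreal (2 * r * indicator {0..<1} r) * (ennreal (weight0 r) * g r) = ennreal (2 * r * weight0 r) * g r"
      by (simp flip: mult.assoc)
  qed
  finally show ?thesis .
qed

sublocale finite_measure \<mu>
proof
  have "emeasure \<mu> (space \<mu>) = (\<integral>\<^sup>+z. 1 \<partial>\<mu>)" by simp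
  also have "\<dots> = (\<integral>\<^sup>+r. ennreal (2 * r * weight0 r) * 1 \<partial>lborel)"
    by (rule nn_integral_mu_radial) simp
  also have "\<dots> \<le> (\<integral>\<^sup>+r. ennreal (2 * weight0 r) \<partial>lborel)"
  proof (intro nn_integral_mono)
    fix r
    have "r * weight0 r \<le> weight0 r"
    proof (cases "r < 1")
      case True
      then show ?thesis using mult_right_mono[of r 1 "weight0 r"] weight0_nonneg[of r] by simp
    qed (simp add: weight0_def)
    then show "ennreal (2 * r * weight0 r) * 1 \<le> ennreal (2 * weight0 r)"
      by (simp add: ennreal_leI)
  qed
  also have "\<dots> = ennreal (LINT r|lborel. 2 * weight0 r)"
    by (intro nn_integral_eq_integral) (auto simp: weight0_integrable weight0_nonneg)
  finally show "emeasure \<mu> (space \<mu>) \<noteq> \<infinity>"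
    by (auto simp: top_unique)
qed

lemma rotation_measurable:
  assumes "cmod c = 1"
  shows "(*) c \<in> \<mu> \<rightarrow>\<^sub>M \<mu>"
  using assms unfolding measurable_cong_sets[OF sets_mu sets_mu]
  by (intro measurable_restrict_space3) (auto simp: norm_mult)

lemma distr_rotation:
  assumes c: "cmod c = 1"
  shows "distr \<mu> \<mu> ((*) c) = \<mu>"
proof (rule measure_eqI)
  fix A assume "A \<in> sets (distr \<mu> \<mu> ((*) c))"
  then have A: "A \<in> sets \<mu>" by simp
  then have [measurable]: "A \<in> sets borel" and sub: "A \<subseteq> ball 0 1"
    unfolding sets_mu by (auto simp: sets_restrict_space)
  note m = rotation_measurable[OF c]
  have [measurable]: "(*) c \<in> borel_measurable borel" by simp
  have vim: "(*) c -` A \<in> sets borel"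
    using measurable_sets[of "(*) c" borel borel A] by simp
  have "emeasure (distr \<mu> \<mu> ((*) c)) A = emeasure \<mu> ((*) c -` A \<inter> space \<mu>)"
    by (rule emeasure_distr[OF m A])
  also have "\<dots> = (\<integral>\<^sup>+z. indicator ((*) c -` A \<inter> space \<mu>) z \<partial>\<mu>)"
    using measurable_sets[OF m A] by (rule nn_integral_indicator[symmetric])
  also have "\<dots> = (\<integral>\<^sup>+z. indicator ((*) c -` A) z \<partial>\<mu>)"
    by (intro nn_integral_cong) (simp add: indicator_def)
  also have "\<dots> = (\<integral>\<^sup>+z. ennreal (weight0 (cmod z) / pi) * indicator ((*) c -` A) z \<partial>lborel)"
    using vim by (intro nn_integral_mu) simp
  also have "\<dots> = (\<integral>\<^sup>+z. ennreal (weight0 (cmod (c * z)) / pi) * indicator A (c * z) \<partial>lborel)"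
    using c by (simp add: norm_mult indicator_def)
  also have "\<dots> = (\<integral>\<^sup>+z. ennreal (weight0 (cmod z) / pi) * indicator A z \<partial>distr lborel borel ((*) c))"
    by (subst nn_integral_distr) auto
  also have "\<dots> = (\<integral>\<^sup>+z. indicator A z \<partial>\<mu>)"
    unfolding lborel_rotation[OF c] by (intro nn_integral_mu[symmetric]) simp
  also have "\<dots> = emeasure \<mu> A"
    using A by simp
  finally show "emeasure (distr \<mu> \<mu> ((*) c)) A = emeasure \<mu> A" .
qed simp

text \<open>Substituting \<open>c * z\<close> for \<open>z\<close> multiplies the integral by
  \<open>l\<close> without changing it. This replaces integration over the angle in all
  orthogonality relations.\<close>

lemma integral_eq_0_if_rotation_eigenfunction:
  fixes f :: "complex \<Rightarrow> complex"
  assumes f: "f \<in> borel_measurable \<mu>" and c: "cmod c = 1" and l: "l \<noteq> 1"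
    and eig: "\<And>z. cmod z < 1 \<Longrightarrow> f (c * z) = l * f z"
  shows "(LINT z|\<mu>. f z) = 0"
proof -
  note m = rotation_measurable[OF c]
  have "(LINT z|\<mu>. f z) = (LINT z|distr \<mu> \<mu> ((*) c). f z)"
    by (simp only: distr_rotation[OF c])
  also have "\<dots> = (LINT z|\<mu>. f (c * z))"
    by (rule integral_distr[OF m f])
  also have "\<dots> = (LINT z|\<mu>. l * f z)"
    by (intro Bochner_Integration.integral_cong) (simp_all add: eig)
  also have "\<dots> = l * (LINT z|\<mu>. f z)" by simp
  finally show ?thesis using l by simp
qed

text \<open>The number \<open>mom (2 * n)\<close> is the squared norm of z^n, and
  \<open>moment \<phi> (2 * n) / mom (2 * n)\<close> is the eigenvalue at z^n of the Toeplitz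
  operator with radial symbol \<phi>.\<close>

definition moment :: "(real \<Rightarrow> real) \<Rightarrow> nat \<Rightarrow> real" where
  "moment \<phi> n = (LINT z|\<mu>. \<phi> (cmod z) * cmod z ^ n)"

abbreviation mom :: "nat \<Rightarrow> real" where "mom \<equiv> moment (\<lambda>_. 1)"

abbreviation imom :: "real set \<Rightarrow> nat \<Rightarrow> real" where "imom B \<equiv> moment (indicator B)"

lemma integrable_bounded_mu:
  fixes f :: "complex \<Rightarrow> 'b::{banach, second_countable_topology}"
  assumes "f \<in> borel_measurable \<mu>" and "\<And>z. cmod z < 1 \<Longrightarrow> norm (f z) \<le> B"
  shows "integrable \<mu> f"
  using assms by (intro integrable_const_bound[where B = B] AE_I2) auto

lemma moment_integrable:
  assumes [measurable]: "\<phi> \<in> borel_measurable borel" and b: "\<And>r. \<bar>\<phi> r\<bar> \<le> 1"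
  shows "integrable \<mu> (\<lambda>z. \<phi> (cmod z) * cmod z ^ n)"
proof (rule integrable_bounded_mu[where B = 1])
  fix z assume "cmod z < 1"
  then have "\<bar>\<phi> (cmod z)\<bar> * cmod z ^ n \<le> 1 * 1"
    by (intro mult_mono b power_le_one) auto
  then show "norm (\<phi> (cmod z) * cmod z ^ n) \<le> 1" by (simp add: abs_mult)
qed measurable

lemma sgn_measurable_mu [measurable]: "(sgn :: complex \<Rightarrow> complex) \<in> borel_measurable \<mu>"
proof -
  have "(\<lambda>z::complex. z / of_real (cmod z)) \<in> borel_measurable borel" by measurable
  then show ?thesis by (intro measurable_mu) (simp add: sgn_eq[abs_def])
qed

text \<open>The index \<open>2 * n + k\<close> arises because z conj(z) contributes |z|^2 for each
  of \<open>n\<close> factors and sgn(z) conj(z) contributes |z| for each of \<open>k\<close>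
  factors. For \<open>k = 0\<close> this is orthogonality of the monomials for every radial
  cut-off.\<close>

lemma integral_sgn_monom:
  assumes [measurable]: "\<phi> \<in> borel_measurable borel"
  shows "(LINT z|\<mu>. of_real (\<phi> (cmod z)) * sgn z ^ k * z ^ n * cnj (z ^ m)) =
    (if m = n + k then of_real (moment \<phi> (2 * n + k)) else 0)"
proof (cases "m = n + k")
  case True
  have "of_real (\<phi> (cmod z)) * sgn z ^ k * z ^ n * cnj (z ^ m) = of_real (\<phi> (cmod z) * cmod z ^ (2 * n + k))" for z
  proof -
    have "sgn z * cnj z = of_real (cmod z)"
      by (cases "z = 0") (simp_all add: sgn_eq field_simps flip: complex_norm_square power2_eq_square)
    moreover have "z * cnj z = of_real (cmod z ^ 2)"
      by (simp flip: complex_norm_square)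
    moreover have "of_real (\<phi> (cmod z)) * sgn z ^ k * z ^ n * cnj (z ^ m) =
      of_real (\<phi> (cmod z)) * (z * cnj z) ^ n * (sgn z * cnj z) ^ k"
      by (simp add: True power_add power_mult_distrib)
    ultimately show ?thesis
      by (simp add: power_add power_mult)
  qed
  then show ?thesis
    unfolding moment_def by (simp only: True if_True integral_complex_of_real refl)
next
  case False
  \<comment> \<open>The frequency of the integrand, taken in the reals since it may be negative.
    Rotating by \<open>pi / d\<close> multiplies the integrand by exactly -1, so a single rotation
    is enough.\<close>
  define d where "d = real (n + k) - real m"
  have d: "d \<noteq> 0" using False by (simp add: d_def)
  define c where "c = cis (pi / d)"
  have c: "cmod c = 1" by (simp add: c_def)
  have "c ^ (n + k) * cnj (c ^ m) = cis (real (n + k) * (pi / d) - real m * (pi / d))"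
    by (simp add: c_def Complex.DeMoivre cis_cnj cis_mult)
  also have "real (n + k) * (pi / d) - real m * (pi / d) = d * (pi / d)"
    unfolding d_def by (simp only: left_diff_distrib)
  also have "d * (pi / d) = pi" using d by simp
  finally have cc: "c ^ (n + k) * cnj (c ^ m) = -1" by simp
  have sg: "sgn (c * z) = c * sgn z" for z
    using c by (cases "c = 0") (simp_all add: sgn_mult sgn_eq norm_mult)
  have "(LINT z|\<mu>. of_real (\<phi> (cmod z)) * sgn z ^ k * z ^ n * cnj (z ^ m)) = 0"
  proof (rule integral_eq_0_if_rotation_eigenfunction[OF _ c])
    have [measurable]: "(\<lambda>z. cnj (z ^ m)) \<in> borel_measurable \<mu>"
      by (auto intro!: measurable_mu borel_measurable_continuous_onI continuous_intros)
    show "(\<lambda>z. of_real (\<phi> (cmod z)) * sgn z ^ k * z ^ n * cnj (z ^ m)) \<in> borel_measurable \<mu>"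
      by measurable
    fix z
    have "of_real (\<phi> (cmod (c * z))) * sgn (c * z) ^ k * (c * z) ^ n * cnj ((c * z) ^ m) =
      (c ^ (n + k) * cnj (c ^ m)) * (of_real (\<phi> (cmod z)) * sgn z ^ k * z ^ n * cnj (z ^ m))"
      using c by (simp add: sg norm_mult power_mult_distrib power_add)
    then show "of_real (\<phi> (cmod (c * z))) * sgn (c * z) ^ k * (c * z) ^ n * cnj ((c * z) ^ m) =
      (- 1) * (of_real (\<phi> (cmod z)) * sgn z ^ k * z ^ n * cnj (z ^ m))"
      unfolding cc .
  qed simp
  then show ?thesis using False by simp
qed

end

section \<open>The inner product space \<open>L2 \<omega>\<close> and its monomials\<close>

context positive_radial_weight
begin

abbreviation l2 :: "(complex \<Rightarrow> complex) set" where "l2 \<equiv> L2 \<omega>"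
abbreviation inn :: "(complex \<Rightarrow> complex) \<Rightarrow> (complex \<Rightarrow> complex) \<Rightarrow> complex" where "inn \<equiv> L2_inner \<omega>"
abbreviation nrm :: "(complex \<Rightarrow> complex) \<Rightarrow> real" where "nrm \<equiv> L2_norm \<omega>"

lemma L2_measurable: "f \<in> l2 \<Longrightarrow> f \<in> borel_measurable \<mu>"
  by (simp add: L2_def)

lemma L2_integrable: "f \<in> l2 \<Longrightarrow> integrable \<mu> (\<lambda>z. (cmod (f z))\<^sup>2)"
  by (simp add: L2_def)

lemma L2_norm_nonneg [simp]: "0 \<le> nrm f"
  by (simp add: L2_norm_def)

lemma L2_norm_sq: "(nrm f)\<^sup>2 = (LINT z|\<mu>. (cmod (f z))\<^sup>2)"
  by (simp add: L2_norm_def)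

lemma L2_I:
  assumes "f \<in> borel_measurable \<mu>" "(\<integral>\<^sup>+z. ennreal ((cmod (f z))\<^sup>2) \<partial>\<mu>) < \<infinity>"
  shows "f \<in> l2"
  using assms by (auto simp: L2_def integrable_iff_bounded)

lemma nn_integral_L2: "f \<in> l2 \<Longrightarrow> (\<integral>\<^sup>+z. ennreal ((cmod (f z))\<^sup>2) \<partial>\<mu>) = ennreal ((nrm f)\<^sup>2)"
  unfolding L2_norm_sq by (intro nn_integral_eq_integral L2_integrable) simp_all

lemma L2_bounded:
  assumes "f \<in> borel_measurable \<mu>" "\<And>z. cmod z < 1 \<Longrightarrow> cmod (f z) \<le> B"
  shows "f \<in> l2"
  unfolding L2_def using assms
  by (auto intro!: integrable_bounded_mu[where B = "B\<^sup>2"] power_mono)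

lemma L2_mult_bounded:
  assumes f: "f \<in> l2" and u [measurable]: "u \<in> borel_measurable \<mu>" and b: "\<And>z. cmod (u z) \<le> 1"
  shows "(\<lambda>z. u z * f z) \<in> l2" "nrm (\<lambda>z. u z * f z) \<le> nrm f"
proof -
  note [measurable] = L2_measurable[OF f]
  have le: "(cmod (u z * f z))\<^sup>2 \<le> (cmod (f z))\<^sup>2" for z
    using mult_right_mono[OF b[of z], of "cmod (f z)"] by (auto intro: power_mono simp: norm_mult)
  have int: "integrable \<mu> (\<lambda>z. (cmod (u z * f z))\<^sup>2)"
    by (rule Bochner_Integration.integrable_bound[OF L2_integrable[OF f]]) (use le in auto)
  then show "(\<lambda>z. u z * f z) \<in> l2" by (auto simp: L2_def)
  show "nrm (\<lambda>z. u z * f z) \<le> nrm f"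
    unfolding L2_norm_def by (intro real_sqrt_le_mono integral_mono int L2_integrable f le)
qed

lemma L2_mult_integrable:
  assumes f: "f \<in> l2" and g: "g \<in> l2"
  shows "integrable \<mu> (\<lambda>z. cmod (f z) * cmod (g z))" "integrable \<mu> (\<lambda>z. f z * cnj (g z))"
proof -
  note [measurable] = L2_measurable[OF f] L2_measurable[OF g]
  have bd: "cmod (f z) * cmod (g z) \<le> (cmod (f z))\<^sup>2 + (cmod (g z))\<^sup>2" for z
    using sum_squares_bound[of "cmod (f z)" "cmod (g z)"]
      mult_nonneg_nonneg[of "cmod (f z)" "cmod (g z)", OF norm_ge_zero norm_ge_zero] by linarith
  have int: "integrable \<mu> (\<lambda>z. (cmod (f z))\<^sup>2 + (cmod (g z))\<^sup>2)"
    by (intro Bochner_Integration.integrable_add L2_integrable f g)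
  show 1: "integrable \<mu> (\<lambda>z. cmod (f z) * cmod (g z))"
    by (rule Bochner_Integration.integrable_bound[OF int]) (use bd in auto)
  have [measurable]: "(\<lambda>z. cnj (g z)) \<in> borel_measurable \<mu>"
    using measurable_compose[OF L2_measurable[OF g], of cnj borel]
    by (simp add: borel_measurable_continuous_onI continuous_on_cnj)
  show "integrable \<mu> (\<lambda>z. f z * cnj (g z))"
    by (rule Bochner_Integration.integrable_bound[OF 1]) (auto simp: norm_mult)
qed

lemma L2_Cauchy_Schwarz_abs:
  assumes f: "f \<in> l2" and g: "g \<in> l2"
  shows "(LINT z|\<mu>. cmod (f z) * cmod (g z)) \<le> nrm f * nrm g"
proof -
  note [measurable] = L2_measurable[OF f] L2_measurable[OF g]
  let ?X = "LINT z|\<mu>. cmod (f z) * cmod (g z)"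
  have X0: "0 \<le> ?X" by (intro integral_nonneg_AE) simp
  have "(ennreal ?X)\<^sup>2 = (\<integral>\<^sup>+z. ennreal (cmod (f z)) * ennreal (cmod (g z)) \<partial>\<mu>)\<^sup>2"
    by (subst nn_integral_eq_integral[OF L2_mult_integrable(1)[OF f g], symmetric])
      (simp_all add: ennreal_mult)
  also have "\<dots> \<le> (\<integral>\<^sup>+z. ennreal (cmod (f z)) ^ 2 \<partial>\<mu>) * (\<integral>\<^sup>+z. ennreal (cmod (g z)) ^ 2 \<partial>\<mu>)"
    by (intro Cauchy_Schwarz_nn_integral) measurable
  also have "\<dots> = ennreal ((nrm f)\<^sup>2) * ennreal ((nrm g)\<^sup>2)"
    by (simp add: ennreal_power nn_integral_L2[OF f] nn_integral_L2[OF g])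
  also have "\<dots> = ennreal ((nrm f * nrm g)\<^sup>2)"
    by (simp add: ennreal_mult power_mult_distrib)
  finally have "?X\<^sup>2 \<le> (nrm f * nrm g)\<^sup>2"
    using X0 by (simp add: ennreal_power)
  then show ?thesis
    by (rule power2_le_imp_le) simp
qed

lemma L2_Cauchy_Schwarz:
  assumes f: "f \<in> l2" and g: "g \<in> l2"
  shows "cmod (inn f g) \<le> nrm f * nrm g"
proof -
  have "cmod (inn f g) \<le> (LINT z|\<mu>. cmod (f z * cnj (g z)))"
    unfolding L2_inner_def by (rule integral_norm_bound)
  also have "\<dots> = (LINT z|\<mu>. cmod (f z) * cmod (g z))"
    by (simp add: norm_mult)
  also have "\<dots> \<le> nrm f * nrm g" by (rule L2_Cauchy_Schwarz_abs[OF f g])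
  finally show ?thesis .
qed

lemma L2_add:
  assumes f: "f \<in> l2" and g: "g \<in> l2"
  shows "(\<lambda>z. f z + g z) \<in> l2" "nrm (\<lambda>z. f z + g z) \<le> nrm f + nrm g"
proof -
  note [measurable] = L2_measurable[OF f] L2_measurable[OF g]
  have le: "(cmod (f z + g z))\<^sup>2 \<le> (cmod (f z))\<^sup>2 + 2 * (cmod (f z) * cmod (g z)) + (cmod (g z))\<^sup>2" for z
    using power_mono[OF norm_triangle_ineq[of "f z" "g z"], of 2]
    by (simp add: power2_sum algebra_simps)
  have int: "integrable \<mu> (\<lambda>z. (cmod (f z))\<^sup>2 + 2 * (cmod (f z) * cmod (g z)) + (cmod (g z))\<^sup>2)"
    by (intro Bochner_Integration.integrable_add integrable_mult_right L2_integrable f g L2_mult_integrable)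
  have int': "integrable \<mu> (\<lambda>z. (cmod (f z + g z))\<^sup>2)"
    by (rule Bochner_Integration.integrable_bound[OF int]) (use le in \<open>auto intro: order_trans\<close>)
  then show "(\<lambda>z. f z + g z) \<in> l2" by (auto simp: L2_def)
  have "(nrm (\<lambda>z. f z + g z))\<^sup>2 \<le> (LINT z|\<mu>. (cmod (f z))\<^sup>2 + 2 * (cmod (f z) * cmod (g z)) + (cmod (g z))\<^sup>2)"
    unfolding L2_norm_sq by (intro integral_mono int int' le)
  also have "\<dots> = (nrm f)\<^sup>2 + 2 * (LINT z|\<mu>. cmod (f z) * cmod (g z)) + (nrm g)\<^sup>2"
    unfolding L2_norm_sq using L2_integrable[OF f] L2_integrable[OF g] L2_mult_integrable(1)[OF f g]
    by simp
  also have "\<dots> \<le> (nrm f)\<^sup>2 + 2 * (nrm f * nrm g) + (nrm g)\<^sup>2"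
    using L2_Cauchy_Schwarz_abs[OF f g] by simp
  also have "\<dots> = (nrm f + nrm g)\<^sup>2" by (simp add: power2_sum)
  finally show "nrm (\<lambda>z. f z + g z) \<le> nrm f + nrm g"
    by (rule power2_le_imp_le) simp
qed

lemma L2_cmult:
  assumes f: "f \<in> l2"
  shows "(\<lambda>z. c * f z) \<in> l2" "nrm (\<lambda>z. c * f z) = cmod c * nrm f"
proof -
  note [measurable] = L2_measurable[OF f]
  show "(\<lambda>z. c * f z) \<in> l2"
    using L2_integrable[OF f] by (auto simp: L2_def norm_mult power_mult_distrib)
  show "nrm (\<lambda>z. c * f z) = cmod c * nrm f"
    by (simp add: L2_norm_def norm_mult power_mult_distrib real_sqrt_mult)
qed

lemma L2_diff:
  assumes f: "f \<in> l2" and g: "g \<in> l2"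
  shows "(\<lambda>z. f z - g z) \<in> l2"
  using L2_add(1)[OF f L2_cmult(1)[OF g, of "-1"]] by simp

lemma L2_sum: "(\<And>i. i \<in> I \<Longrightarrow> f i \<in> l2) \<Longrightarrow> (\<lambda>z. \<Sum>i\<in>I. f i z) \<in> l2"
  by (induction I rule: infinite_finite_induct) (auto intro: L2_add(1) L2_bounded[where B = 0])

lemma inn_diff_left: "f \<in> l2 \<Longrightarrow> g \<in> l2 \<Longrightarrow> h \<in> l2 \<Longrightarrow> inn (\<lambda>z. f z - g z) h = inn f h - inn g h"
  unfolding L2_inner_def using L2_mult_integrable(2) by (simp add: left_diff_distrib)

lemma inn_sum_left: "(\<And>i. i \<in> I \<Longrightarrow> f i \<in> l2) \<Longrightarrow> h \<in> l2 \<Longrightarrow> inn (\<lambda>z. \<Sum>i\<in>I. f i z) h = (\<Sum>i\<in>I. inn (f i) h)"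
  unfolding L2_inner_def sum_distrib_right
  by (intro Bochner_Integration.integral_sum L2_mult_integrable(2))

lemma inn_cmult_left: "inn (\<lambda>z. c * f z) h = c * inn f h"
  unfolding L2_inner_def by (simp add: mult.assoc)

lemma inn_cnj: "inn g f = cnj (inn f g)"
proof -
  have "cnj (inn f g) = (LINT z|\<mu>. cnj (f z * cnj (g z)))"
    unfolding L2_inner_def by (rule Bochner_Integration.integral_cnj[symmetric])
  then show ?thesis by (simp add: L2_inner_def mult.commute)
qed

lemma inn_self: "inn f f = of_real ((nrm f)\<^sup>2)"
  unfolding L2_inner_def L2_norm_sq by (simp flip: integral_complex_of_real complex_norm_square)

lemma nrm_cong: "(\<And>z. cmod z < 1 \<Longrightarrow> f z = g z) \<Longrightarrow> nrm f = nrm g"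
  unfolding L2_norm_def by (intro arg_cong[of _ _ sqrt] Bochner_Integration.integral_cong) auto

lemma inn_cong:
  "(\<And>z. cmod z < 1 \<Longrightarrow> f z = f' z) \<Longrightarrow> (\<And>z. cmod z < 1 \<Longrightarrow> g z = g' z) \<Longrightarrow> inn f g = inn f' g'"
  unfolding L2_inner_def by (intro Bochner_Integration.integral_cong) auto

abbreviation zpow :: "nat \<Rightarrow> complex \<Rightarrow> complex" where "zpow n \<equiv> \<lambda>z. z ^ n"

lemma monom_L2: "(zpow n) \<in> l2"
  by (rule L2_bounded[where B = 1]) (auto simp: norm_power intro: power_le_one)

lemma monom_inn: "inn (zpow n) (zpow m) = (if m = n then of_real (mom (2 * n)) else 0)"
  using integral_sgn_monom[of "\<lambda>_. 1" 0 n m] by (simp add: L2_inner_def)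

lemma nrm_monom: "nrm (zpow n) = sqrt (mom (2 * n))"
proof -
  have "complex_of_real ((nrm (zpow n))\<^sup>2) = of_real (mom (2 * n))"
    using monom_inn[of n n] by (simp only: inn_self if_True refl)
  then have "(nrm (zpow n))\<^sup>2 = mom (2 * n)" by (simp only: of_real_eq_iff)
  then show ?thesis by (intro real_sqrt_unique[symmetric]) simp_all
qed

lemma mom_nonneg: "0 \<le> mom n"
  unfolding moment_def by (intro integral_nonneg_AE) simp

text \<open>Since the weight is positive, the annulus \<open>r \<le> cmod z\<close> has positive
  mass, and this mass serves as \<open>d\<close>. The moments thus decay more slowly than any
  geometric sequence, which later forces series with square-summable weighted coefficients to
  converge in the whole disk.\<close>

lemma mom_lower:
  assumes r: "0 < r" "r < 1"
  obtains d where "0 < d" "\<And>n. d * r ^ n \<le> mom n"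
proof -
  define A where "A = {z \<in> space \<mu>. r \<le> cmod z}"
  have A: "A \<in> sets \<mu>" unfolding A_def by measurable
  have "emeasure \<mu> A = (\<integral>\<^sup>+z. indicator {r..} (cmod z) \<partial>\<mu>)"
    unfolding nn_integral_indicator[OF A, symmetric]
    by (intro nn_integral_cong) (simp add: A_def indicator_def)
  also have "\<dots> = (\<integral>\<^sup>+s. ennreal (2 * s * weight0 s) * indicator {r..} s \<partial>lborel)"
    by (intro nn_integral_mu_radial) simp
  also have "\<dots> \<noteq> 0"
  proof
    assume "(\<integral>\<^sup>+s. ennreal (2 * s * weight0 s) * indicator {r..} s \<partial>lborel) = 0"
    then have "AE s in lborel. ennreal (2 * s * weight0 s) * indicator {r..} s = 0"
      by (subst (asm) nn_integral_0_iff_AE) measurable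
    then have "AE s in lborel. s \<notin> {r..<1}"
    proof eventually_elim
      case (elim s)
      show ?case
      proof
        assume "s \<in> {r..<1}"
        then have "0 < 2 * s * weight0 s" using r positive_radial_weight.pos[OF positive_radial_weight_axioms, of s] by (simp add: weight0_def)
        with elim \<open>s \<in> {r..<1}\<close> show False by (simp add: ennreal_eq_0_iff)
      qed
    qed
    then have "{r..<1} \<in> null_sets lborel"
      by (simp add: AE_iff_null_sets)
    with r show False by (simp add: null_sets_def)
  qed
  finally have pos: "0 < measure \<mu> A"
    by (simp add: measure_def enn2real_positive_iff less_top[symmetric] zero_less_iff_neq_zero)
  have "measure \<mu> A * r ^ n \<le> mom n" for n
  proof -
    have "measure \<mu> A * r ^ n = (LINT z|\<mu>. indicator A z * r ^ n)"
    proof -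
      have "A \<inter> ball 0 1 = A" by (auto simp: A_def)
      then show ?thesis using A by simp
    qed
    also have "\<dots> \<le> (LINT z|\<mu>. 1 * cmod z ^ n)"
    proof (rule integral_mono)
      show "integrable \<mu> (\<lambda>z. indicator A z * r ^ n)"
        by (rule integrable_bounded_mu[where B = "r ^ n"]) (use A r in \<open>auto simp: indicator_def\<close>)
      show "integrable \<mu> (\<lambda>z. 1 * cmod z ^ n)" by (rule moment_integrable) simp_all
      show "indicator A z * r ^ n \<le> 1 * cmod z ^ n" for z
        using r by (auto simp: A_def indicator_def intro: power_mono)
    qed
    finally show ?thesis by (simp add: moment_def)
  qed
  with pos show ?thesis by (rule that)
qed

lemma mom_pos: "0 < mom n"
  using mom_lower[of "1/2"] by (metis half_gt_zero_iff less_le_trans mult_pos_pos zero_less_one zero_less_power field_sum_of_halves less_add_same_cancel1)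

end

section \<open>Parseval and the Bergman projection\<close>

definition taylor :: "(complex \<Rightarrow> complex) \<Rightarrow> nat \<Rightarrow> complex" where
  "taylor f n = (deriv ^^ n) f 0 / fact n"

lemma taylor_sums:
  "f holomorphic_on ball 0 1 \<Longrightarrow> cmod z < 1 \<Longrightarrow> (\<lambda>n. taylor f n * z ^ n) sums f z"
  using holomorphic_power_series[of f 0 1 z] by (simp add: taylor_def)

lemma taylor_unique:
  assumes "\<And>z. cmod z < 1 \<Longrightarrow> (\<lambda>n. c n * z ^ n) sums f z"
  shows "f holomorphic_on ball 0 1" "taylor f = c"
proof -
  show "f holomorphic_on ball 0 1"
    using assms by (intro power_series_holomorphic[of 0 1 c]) auto
  have "conv_radius c \<ge> 1"
  proof (rule conv_radius_geI_ex)
    fix r assume r: "0 < r" "ereal r < 1"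
    then show "\<exists>z. norm z = r \<and> summable (\<lambda>n. c n * z ^ n)"
      using assms[of "of_real r"] by (intro exI[of _ "of_real r"]) (auto simp: sums_iff)
  qed
  then have "f has_fps_expansion Abs_fps c"
    unfolding has_fps_expansion_def
  proof (intro conjI)
    assume 1: "conv_radius c \<ge> 1"
    then show "0 < fps_conv_radius (Abs_fps c)"
      by (simp add: fps_conv_radius_def less_le_trans[OF _ 1])
    have "eventually (\<lambda>z::complex. z \<in> ball 0 1) (nhds 0)"
      by (intro eventually_nhds_in_open) auto
    then show "\<forall>\<^sub>F z in nhds 0. eval_fps (Abs_fps c) z = f z"
      by eventually_elim (use assms in \<open>auto simp: eval_fps_def sums_iff\<close>)
  qed
  then have "fps_nth (Abs_fps c) n = (deriv ^^ n) f 0 / fact n" for n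
    by (rule fps_nth_fps_expansion)
  then show "taylor f = c"
    by (simp add: taylor_def fun_eq_iff)
qed

definition power_series_disk :: "(nat \<Rightarrow> complex) \<Rightarrow> complex \<Rightarrow> complex" where
  "power_series_disk c z = (if cmod z < 1 then \<Sum>n. c n * z ^ n else 0)"

context positive_radial_weight
begin

abbreviation a2 :: "(complex \<Rightarrow> complex) set" where "a2 \<equiv> A2 \<omega>"

text \<open>On a smaller disk the Taylor polynomials converge boundedly, so orthogonality of the
  monomials under the truncated radial measure passes to the limit. No integrability of
  \<open>f\<close> on the full disk enters.\<close>

lemma nn_integral_disk_Parseval:
  assumes hol: "f holomorphic_on ball 0 1" and r: "0 < r" "r < 1"
  shows "(\<integral>\<^sup>+z. ennreal ((cmod (f z))\<^sup>2) * indicator {..r} (cmod z) \<partial>\<mu>) =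
    (\<integral>\<^sup>+z. (\<Sum>n. ennreal ((cmod (taylor f n))\<^sup>2 * cmod z ^ (2 * n))) * indicator {..r} (cmod z) \<partial>\<mu>)"
proof -
  define a where "a = taylor f"
  define \<phi> :: "real \<Rightarrow> real" where "\<phi> = indicator {..r}"
  have [measurable]: "\<phi> \<in> borel_measurable borel" by (simp add: \<phi>_def)
  have \<phi>b: "0 \<le> \<phi> s" "\<phi> s \<le> 1" "\<bar>\<phi> s\<bar> \<le> 1" for s by (auto simp: \<phi>_def indicator_def)
  have [measurable]: "f \<in> borel_measurable \<mu>"
    by (intro continuous_measurable_mu holomorphic_on_imp_continuous_on hol)
  have [measurable]: "(\<lambda>z. cnj (z ^ m)) \<in> borel_measurable \<mu>" for m
    by (auto intro!: measurable_mu borel_measurable_continuous_onI continuous_intros)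
  define P where "P N z = (\<Sum>n<N. a n * z ^ n)" for N and z :: complex
  have [measurable]: "P N \<in> borel_measurable \<mu>" for N
    unfolding P_def[abs_def] by measurable
  \<comment> \<open>Convergence at a radius strictly between \<open>r\<close> and 1 gives absolute
    convergence at \<open>r\<close>.\<close>
  have sm: "summable (\<lambda>n. cmod (a n) * r ^ n)"
  proof -
    define s where "s = (r + 1) / 2"
    have s: "r < s" "s < 1" using r by (auto simp: s_def)
    have "summable (\<lambda>n. a n * of_real s ^ n)"
      using taylor_sums[OF hol, of "of_real s"] s r by (auto simp: a_def sums_iff)
    then have "summable (\<lambda>n. norm (a n * of_real r ^ n))"
      by (rule powser_insidea) (use r s in auto)
    then show ?thesis using r by (simp add: norm_mult norm_power)
  qed
  define K where "K = (\<Sum>n. cmod (a n) * r ^ n)"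
  have Pb: "cmod (P N z) \<le> K" if "cmod z \<le> r" for N z
  proof -
    have "cmod (P N z) \<le> (\<Sum>n<N. cmod (a n * z ^ n))" unfolding P_def by (rule norm_sum)
    also have "\<dots> \<le> (\<Sum>n<N. cmod (a n) * r ^ n)"
      using that by (intro sum_mono) (auto simp: norm_mult norm_power intro!: mult_left_mono power_mono)
    also have "\<dots> \<le> K" unfolding K_def
      by (intro sum_le_suminf sm) (use r in auto)
    finally show ?thesis .
  qed
  have PI: "(LINT z|\<mu>. \<phi> (cmod z) * (cmod (P N z))\<^sup>2) = (\<Sum>n<N. (cmod (a n))\<^sup>2 * moment \<phi> (2 * n))" for N
  proof -
    have int: "integrable \<mu> (\<lambda>z. of_real (\<phi> (cmod z)) * z ^ n * cnj (z ^ m))" for n m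
    proof (rule integrable_bounded_mu[where B = 1])
      fix z :: complex assume "cmod z < 1"
      then have "\<bar>\<phi> (cmod z)\<bar> * cmod z ^ n * cmod z ^ m \<le> 1 * 1 * 1"
        by (intro mult_mono \<phi>b power_le_one) auto
      then show "cmod (of_real (\<phi> (cmod z)) * z ^ n * cnj (z ^ m)) \<le> 1"
        by (simp add: norm_mult norm_power)
    qed measurable
    have "complex_of_real (LINT z|\<mu>. \<phi> (cmod z) * (cmod (P N z))\<^sup>2) =
      (LINT z|\<mu>. of_real (\<phi> (cmod z)) * (P N z * cnj (P N z)))"
      by (simp flip: integral_complex_of_real complex_norm_square)
    also have "\<dots> = (LINT z|\<mu>. (\<Sum>n<N. \<Sum>m<N. (a n * cnj (a m)) * (of_real (\<phi> (cmod z)) * z ^ n * cnj (z ^ m))))"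
      unfolding P_def
      by (intro Bochner_Integration.integral_cong refl)
         (simp add: sum_product sum_distrib_left mult_ac, rule sum.swap)
    also have "\<dots> = (\<Sum>n<N. \<Sum>m<N. (a n * cnj (a m)) * (LINT z|\<mu>. of_real (\<phi> (cmod z)) * z ^ n * cnj (z ^ m)))"
      using int by (simp add: Bochner_Integration.integral_sum del: complex_cnj_power)
    also have "\<dots> = (\<Sum>n<N. \<Sum>m<N. (a n * cnj (a m)) * (if m = n then of_real (moment \<phi> (2 * n)) else 0))"
    proof (intro sum.cong refl)
      fix n m
      show "a n * cnj (a m) * (LINT z|\<mu>. of_real (\<phi> (cmod z)) * z ^ n * cnj (z ^ m)) =
        a n * cnj (a m) * (if m = n then of_real (moment \<phi> (2 * n)) else 0)"
        using integral_sgn_monom[of \<phi> 0 n m] by simp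
    qed
    also have "\<dots> = (\<Sum>n<N. a n * cnj (a n) * of_real (moment \<phi> (2 * n)))"
      by (intro sum.cong refl) (simp add: if_distrib if_distribR cong: if_cong)
    also have "\<dots> = of_real (\<Sum>n<N. (cmod (a n))\<^sup>2 * moment \<phi> (2 * n))"
      by (simp flip: complex_norm_square)
    finally show ?thesis by (simp only: of_real_eq_iff)
  qed
  have lim: "(\<lambda>N. LINT z|\<mu>. \<phi> (cmod z) * (cmod (P N z))\<^sup>2) \<longlonglongrightarrow> (LINT z|\<mu>. \<phi> (cmod z) * (cmod (f z))\<^sup>2)"
  proof (rule integral_dominated_convergence[where w = "\<lambda>_. K\<^sup>2"])
    show "AE z in \<mu>. (\<lambda>N. \<phi> (cmod z) * (cmod (P N z))\<^sup>2) \<longlonglongrightarrow> \<phi> (cmod z) * (cmod (f z))\<^sup>2"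
    proof (rule AE_I2)
      fix z assume "z \<in> space \<mu>"
      then have "(\<lambda>N. P N z) \<longlonglongrightarrow> f z"
        using taylor_sums[OF hol, of z] by (simp add: P_def sums_def a_def)
      then show "(\<lambda>N. \<phi> (cmod z) * (cmod (P N z))\<^sup>2) \<longlonglongrightarrow> \<phi> (cmod z) * (cmod (f z))\<^sup>2"
        by (intro tendsto_intros)
    qed
    show "AE z in \<mu>. norm (\<phi> (cmod z) * (cmod (P N z))\<^sup>2) \<le> K\<^sup>2" for N
      using Pb by (intro AE_I2) (auto simp: \<phi>_def indicator_def intro: power_mono)
  qed (auto intro: integrable_const)
  have "(\<integral>\<^sup>+z. ennreal (\<phi> (cmod z) * (cmod (f z))\<^sup>2) \<partial>\<mu>) = ennreal (LINT z|\<mu>. \<phi> (cmod z) * (cmod (f z))\<^sup>2)"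
  proof (rule nn_integral_eq_integral)
    have fb: "cmod (f z) \<le> K" if "cmod z \<le> r" for z
    proof (rule LIMSEQ_le_const2)
      show "(\<lambda>N. cmod (P N z)) \<longlonglongrightarrow> cmod (f z)"
        using taylor_sums[OF hol, of z] that r by (intro tendsto_norm) (simp add: P_def sums_def a_def)
    qed (use Pb that in auto)
    show "integrable \<mu> (\<lambda>z. \<phi> (cmod z) * (cmod (f z))\<^sup>2)"
      by (rule integrable_bounded_mu[where B = "K\<^sup>2"])
        (use fb in \<open>auto simp: \<phi>_def indicator_def intro: power_mono\<close>)
  qed (use \<phi>b in auto)
  also have "\<dots> = (\<Sum>n. ennreal ((cmod (a n))\<^sup>2 * moment \<phi> (2 * n)))"
  proof -
    have "moment \<phi> n \<ge> 0" for n
      unfolding moment_def by (intro integral_nonneg_AE AE_I2) (simp add: \<phi>b)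
    moreover have "(\<lambda>n. (cmod (a n))\<^sup>2 * moment \<phi> (2 * n)) sums (LINT z|\<mu>. \<phi> (cmod z) * (cmod (f z))\<^sup>2)"
      using lim unfolding PI sums_def .
    ultimately show ?thesis by (intro suminf_ennreal_eq[symmetric]) auto
  qed
  also have "\<dots> = (\<Sum>n. \<integral>\<^sup>+z. ennreal ((cmod (a n))\<^sup>2 * cmod z ^ (2 * n)) * indicator {..r} (cmod z) \<partial>\<mu>)"
  proof (rule suminf_cong)
    fix n
    have "ennreal ((cmod (a n))\<^sup>2 * moment \<phi> (2 * n)) = ennreal (LINT z|\<mu>. (cmod (a n))\<^sup>2 * (\<phi> (cmod z) * cmod z ^ (2 * n)))"
      by (simp add: moment_def)
    also have "\<dots> = (\<integral>\<^sup>+z. ennreal ((cmod (a n))\<^sup>2 * (\<phi> (cmod z) * cmod z ^ (2 * n))) \<partial>\<mu>)"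
      by (intro nn_integral_eq_integral[symmetric] integrable_mult_right moment_integrable)
        (auto simp: \<phi>b)
    also have "\<dots> = (\<integral>\<^sup>+z. ennreal ((cmod (a n))\<^sup>2 * cmod z ^ (2 * n)) * indicator {..r} (cmod z) \<partial>\<mu>)"
      by (intro nn_integral_cong) (simp add: \<phi>_def indicator_def)
    finally show "ennreal ((cmod (a n))\<^sup>2 * moment \<phi> (2 * n)) =
      (\<integral>\<^sup>+z. ennreal ((cmod (a n))\<^sup>2 * cmod z ^ (2 * n)) * indicator {..r} (cmod z) \<partial>\<mu>)" .
  qed
  also have "\<dots> = (\<integral>\<^sup>+z. (\<Sum>n. ennreal ((cmod (a n))\<^sup>2 * cmod z ^ (2 * n)) * indicator {..r} (cmod z)) \<partial>\<mu>)"
    by (intro nn_integral_suminf[symmetric]) measurable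
  finally have "(\<integral>\<^sup>+z. ennreal (\<phi> (cmod z) * (cmod (f z))\<^sup>2) \<partial>\<mu>) =
    (\<integral>\<^sup>+z. (\<Sum>n. ennreal ((cmod (a n))\<^sup>2 * cmod z ^ (2 * n)) * indicator {..r} (cmod z)) \<partial>\<mu>)" .
  moreover have "ennreal (\<phi> (cmod z) * (cmod (f z))\<^sup>2) = ennreal ((cmod (f z))\<^sup>2) * indicator {..r} (cmod z)" for z
    by (simp add: \<phi>_def indicator_def)
  ultimately show ?thesis
    by (simp add: a_def)
qed

text \<open>Stated in extended nonnegative reals, so both sides may be infinite: the identity then
  both computes norms in \<open>a2\<close> and decides whether a power series belongs to
  \<open>a2\<close>. The truncation is removed by monotone convergence along radii increasing to
  1.\<close>

lemma nn_integral_Parseval: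
  assumes hol: "f holomorphic_on ball 0 1"
  shows "(\<integral>\<^sup>+z. ennreal ((cmod (f z))\<^sup>2) \<partial>\<mu>) = (\<Sum>n. ennreal ((cmod (taylor f n))\<^sup>2 * mom (2 * n)))"
proof -
  define r where "r k = 1 - 1 / real (k + 2)" for k :: nat
  have r: "0 < r k" "r k < 1" for k by (auto simp: r_def field_simps)
  have r_mono: "r k \<le> r l" if "k \<le> l" for k l
    using that by (auto simp: r_def field_simps)
  have [measurable]: "f \<in> borel_measurable \<mu>"
    by (intro continuous_measurable_mu holomorphic_on_imp_continuous_on hol)
  have sup: "(\<integral>\<^sup>+z. F z \<partial>\<mu>) = (SUP k. \<integral>\<^sup>+z. F z * indicator {..r k} (cmod z) \<partial>\<mu>)"
    if [measurable]: "F \<in> borel_measurable \<mu>" for F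
  proof -
    have "(\<integral>\<^sup>+z. F z \<partial>\<mu>) = (\<integral>\<^sup>+z. (SUP k. F z * indicator {..r k} (cmod z)) \<partial>\<mu>)"
    proof (intro nn_integral_cong)
      fix z assume "z \<in> space \<mu>"
      then have z: "cmod z < 1" by simp
      then obtain k :: nat where "1 / (1 - cmod z) < real k" using reals_Archimedean2 by blast
      then have "cmod z \<le> r k" using z by (simp add: r_def field_simps)
      then have "F z \<le> F z * indicator {..r k} (cmod z)" by simp
      then show "F z = (SUP k. F z * indicator {..r k} (cmod z))"
        by (intro antisym SUP_upper2[of k] SUP_least) (auto simp: indicator_def)
    qed
    also have "\<dots> = (SUP k. \<integral>\<^sup>+z. F z * indicator {..r k} (cmod z) \<partial>\<mu>)"
    proof (rule nn_integral_monotone_convergence_SUP)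
      show "incseq (\<lambda>k z. F z * indicator {..r k} (cmod z))"
        using r_mono by (auto simp: incseq_def le_fun_def indicator_def intro: order_trans)
    qed measurable
    finally show ?thesis .
  qed
  have "(\<integral>\<^sup>+z. ennreal ((cmod (f z))\<^sup>2) \<partial>\<mu>) = (\<integral>\<^sup>+z. (\<Sum>n. ennreal ((cmod (taylor f n))\<^sup>2 * cmod z ^ (2 * n))) \<partial>\<mu>)"
  proof -
    have "(\<integral>\<^sup>+z. ennreal ((cmod (f z))\<^sup>2) \<partial>\<mu>) =
      (SUP k. \<integral>\<^sup>+z. ennreal ((cmod (f z))\<^sup>2) * indicator {..r k} (cmod z) \<partial>\<mu>)"
      by (rule sup) measurable
    also have "\<dots> = (SUP k. \<integral>\<^sup>+z. (\<Sum>n. ennreal ((cmod (taylor f n))\<^sup>2 * cmod z ^ (2 * n))) * indicator {..r k} (cmod z) \<partial>\<mu>)"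
      by (simp only: nn_integral_disk_Parseval[OF hol r])
    also have "\<dots> = (\<integral>\<^sup>+z. (\<Sum>n. ennreal ((cmod (taylor f n))\<^sup>2 * cmod z ^ (2 * n))) \<partial>\<mu>)"
      by (rule sup[symmetric]) measurable
    finally show ?thesis .
  qed
  also have "\<dots> = (\<Sum>n. \<integral>\<^sup>+z. ennreal ((cmod (taylor f n))\<^sup>2 * cmod z ^ (2 * n)) \<partial>\<mu>)"
    by (intro nn_integral_suminf) measurable
  also have "\<dots> = (\<Sum>n. ennreal ((cmod (taylor f n))\<^sup>2 * mom (2 * n)))"
  proof (rule suminf_cong)
    fix n
    have "(\<integral>\<^sup>+z. ennreal ((cmod (taylor f n))\<^sup>2 * (1 * cmod z ^ (2 * n))) \<partial>\<mu>) =
      ennreal (LINT z|\<mu>. (cmod (taylor f n))\<^sup>2 * (1 * cmod z ^ (2 * n)))"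
      by (intro nn_integral_eq_integral integrable_mult_right moment_integrable) auto
    then show "(\<integral>\<^sup>+z. ennreal ((cmod (taylor f n))\<^sup>2 * cmod z ^ (2 * n)) \<partial>\<mu>) =
      ennreal ((cmod (taylor f n))\<^sup>2 * mom (2 * n))"
      by (simp add: moment_def)
  qed
  finally show ?thesis .
qed

end

section \<open>Taylor coefficients as coordinates on \<open>A2 \<omega>\<close>\<close>

context positive_radial_weight
begin

lemma A2_D:
  assumes "f \<in> a2"
  shows "f \<in> l2" "f holomorphic_on ball 0 1" "\<And>z. 1 \<le> cmod z \<Longrightarrow> f z = 0"
  using assms by (auto simp: A2_def)

lemma holomorphic_L2_sums:
  assumes hol: "f holomorphic_on ball 0 1" and f: "f \<in> l2"
  shows "(\<lambda>n. (cmod (taylor f n))\<^sup>2 * mom (2 * n)) sums (nrm f)\<^sup>2"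
proof -
  have eq: "(\<Sum>n. ennreal ((cmod (taylor f n))\<^sup>2 * mom (2 * n))) = ennreal ((nrm f)\<^sup>2)"
    using nn_integral_Parseval[OF hol] nn_integral_L2[OF f] by simp
  have nn: "0 \<le> (cmod (taylor f n))\<^sup>2 * mom (2 * n)" for n
    by (simp add: mom_nonneg)
  have s: "summable (\<lambda>n. (cmod (taylor f n))\<^sup>2 * mom (2 * n))"
    using eq by (intro summable_suminf_not_top nn) simp
  then have "ennreal (\<Sum>n. (cmod (taylor f n))\<^sup>2 * mom (2 * n)) = ennreal ((nrm f)\<^sup>2)"
    using eq by (simp add: suminf_ennreal2 nn)
  then have "(\<Sum>n. (cmod (taylor f n))\<^sup>2 * mom (2 * n)) = (nrm f)\<^sup>2"
    by (subst (asm) ennreal_inj) (auto intro: suminf_nonneg s nn)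
  with s show ?thesis by (simp add: sums_iff)
qed

text \<open>The terms of the summable series are bounded by some \<open>K\<close>, and
  \<open>mom_lower\<close> at a radius \<open>r\<close> between \<open>cmod z\<close> and 1 turns
  this into the bound \<open>sqrt (K / d)\<close> for |c_n| r^n; hence the power series is dominated
  by a geometric one.\<close>

lemma power_series_disk_sums:
  assumes s: "summable (\<lambda>n. (cmod (c n))\<^sup>2 * mom (2 * n))" and z: "cmod z < 1"
  shows "(\<lambda>n. c n * z ^ n) sums power_series_disk c z"
proof -
  define r where "r = (cmod z + 1) / 2"
  have r: "0 < r" "r < 1" "cmod z < r" using z by (auto simp: r_def add_nonneg_pos)
  obtain d where d: "0 < d" "\<And>n. d * r ^ n \<le> mom n"
    using mom_lower[OF r(1,2)] by blast
  obtain K where K: "\<And>n. (cmod (c n))\<^sup>2 * mom (2 * n) \<le> K"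
    using summable_imp_bounded[OF s] by (auto simp: bounded_iff) (metis abs_ge_self order_trans)
  have "summable (\<lambda>n. norm (c n * z ^ n))"
  proof (rule summable_comparison_test')
    show "summable (\<lambda>n. sqrt (K / d) * (cmod z / r) ^ n)"
      using r by (intro summable_mult summable_geometric) auto
    fix n
    have "(cmod (c n) * r ^ n)\<^sup>2 = (cmod (c n))\<^sup>2 * r ^ (2 * n)"
      by (simp add: power_mult_distrib power_mult[symmetric] mult.commute)
    also have "\<dots> \<le> (cmod (c n))\<^sup>2 * (mom (2 * n) / d)"
      using d(2)[of "2 * n"] d(1) by (intro mult_left_mono) (auto simp: field_simps)
    also have "\<dots> \<le> K / d" using K[of n] d(1) by (simp add: field_simps)
    finally have "cmod (c n) * r ^ n \<le> sqrt (K / d)" by (rule real_le_rsqrt)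
    then have "cmod (c n) * r ^ n * (cmod z / r) ^ n \<le> sqrt (K / d) * (cmod z / r) ^ n"
      using r by (intro mult_right_mono) auto
    then show "norm (norm (c n * z ^ n)) \<le> sqrt (K / d) * (cmod z / r) ^ n"
      using r by (simp add: norm_mult norm_power power_divide)
  qed
  then show ?thesis
    using z by (simp add: power_series_disk_def summable_sums summable_norm_cancel)
qed

lemma power_series_disk_A2:
  assumes s: "summable (\<lambda>n. (cmod (c n))\<^sup>2 * mom (2 * n))"
  shows "power_series_disk c \<in> a2" "taylor (power_series_disk c) = c"
proof -
  note u = taylor_unique[OF power_series_disk_sums[OF s]]
  show "taylor (power_series_disk c) = c" by (rule u(2))
  have "power_series_disk c \<in> l2"
  proof (rule L2_I)
    show "power_series_disk c \<in> borel_measurable \<mu>"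
      by (intro continuous_measurable_mu holomorphic_on_imp_continuous_on u(1))
    show "(\<integral>\<^sup>+z. ennreal ((cmod (power_series_disk c z))\<^sup>2) \<partial>\<mu>) < \<infinity>"
      using s by (simp add: nn_integral_Parseval[OF u(1)] u(2) suminf_ennreal2 mom_nonneg)
  qed
  then show "power_series_disk c \<in> a2"
    using u(1) by (simp add: A2_def) (simp add: power_series_disk_def)
qed

lemma A2_eqI:
  assumes f: "f \<in> a2" and g: "g \<in> a2" and eq: "taylor f = taylor g"
  shows "f = g"
proof
  fix z
  show "f z = g z"
  proof (cases "cmod z < 1")
    case True
    then show ?thesis
      using taylor_sums[OF A2_D(2)[OF f], of z] taylor_sums[OF A2_D(2)[OF g], of z] eq
      by (auto intro: sums_unique2)
  qed (simp add: A2_D(3)[OF f] A2_D(3)[OF g])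
qed

lemma monom_taylor: "taylor (zpow n) = (\<lambda>m. if m = n then 1 else 0)"
proof (rule taylor_unique(2))
  fix z :: complex
  show "(\<lambda>m. (if m = n then 1 else 0) * z ^ m) sums (z ^ n)"
    using sums_single[of n "\<lambda>m. z ^ m"] by (simp add: if_distribR if_distrib cong: if_cong)
qed

text \<open>The monomial cut off outside the disk: \<open>zpow n\<close> itself is in
  \<open>l2\<close> but not in \<open>a2\<close>, whose members vanish off the disk.\<close>

definition monom_disk :: "nat \<Rightarrow> complex \<Rightarrow> complex" where
  "monom_disk n = power_series_disk (\<lambda>m. if m = n then 1 else 0)"

lemma monom_disk_A2: "monom_disk n \<in> a2"
  unfolding monom_disk_def by (intro power_series_disk_A2 summable_finite[of "{n}"]) auto

lemma monom_disk_eq: "cmod z < 1 \<Longrightarrow> monom_disk n z = z ^ n"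
  using sums_single[of n "\<lambda>m. z ^ m"]
  by (simp add: monom_disk_def power_series_disk_def if_distribR sums_iff if_distrib cong: if_cong)

text \<open>The Taylor polynomials of \<open>h\<close> converge to \<open>h\<close> in norm, because
  the squared distance is a tail of the Parseval series. As \<open>F\<close> is an arbitrary element
  of \<open>l2\<close>, it may carry a bounded symbol moved over from the other side.\<close>

lemma inn_sums:
  assumes hol: "h holomorphic_on ball 0 1" and h: "h \<in> l2" and F: "F \<in> l2"
  shows "(\<lambda>m. taylor h m * inn (zpow m) F) sums inn h F"
proof -
  define a where "a = taylor h"
  define P where "P N z = (\<Sum>m<N. a m * z ^ m)" for N and z :: complex
  have PL: "P N \<in> l2" for N
    unfolding P_def[abs_def] by (intro L2_sum L2_cmult monom_L2)
  have Ph: "P N holomorphic_on ball 0 1" for N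
    unfolding P_def[abs_def] by (intro holomorphic_intros)
  have tc: "taylor (\<lambda>z. h z - P N z) = (\<lambda>n. if n < N then 0 else a n)" for N
  proof (rule taylor_unique(2))
    fix z :: complex assume z: "cmod z < 1"
    have "(\<lambda>n. (if n \<in> {..<N} then a n * z ^ n else 0)) sums P N z"
      unfolding P_def by (rule sums_If_finite_set) simp
    then have "(\<lambda>n. a n * z ^ n - (if n \<in> {..<N} then a n * z ^ n else 0)) sums (h z - P N z)"
      using taylor_sums[OF hol z] by (intro sums_diff) (simp_all add: a_def)
    then show "(\<lambda>n. (if n < N then 0 else a n) * z ^ n) sums (h z - P N z)"
      by (rule sums_cong[THEN iffD1, rotated]) simp
  qed
  define b where "b n = (cmod (a n))\<^sup>2 * mom (2 * n)" for n
  have bs: "summable b"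
    using holomorphic_L2_sums[OF hol h] unfolding b_def[abs_def] a_def by (rule sums_summable)
  have nrmP: "(nrm (\<lambda>z. h z - P N z))\<^sup>2 = suminf b - sum b {..<N}" for N
  proof -
    have "(\<lambda>n. (cmod (taylor (\<lambda>z. h z - P N z) n))\<^sup>2 * mom (2 * n)) sums (nrm (\<lambda>z. h z - P N z))\<^sup>2"
      by (intro holomorphic_L2_sums holomorphic_intros hol Ph L2_diff h PL)
    then have "(\<lambda>n. b n - (if n \<in> {..<N} then b n else 0)) sums (nrm (\<lambda>z. h z - P N z))\<^sup>2"
      by (rule sums_cong[THEN iffD1, rotated]) (simp add: tc b_def)
    moreover have "(\<lambda>n. b n - (if n \<in> {..<N} then b n else 0)) sums (suminf b - sum b {..<N})"
      by (intro sums_diff summable_sums bs sums_If_finite_set) simp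
    ultimately show ?thesis by (rule sums_unique2)
  qed
  have "(\<lambda>N. suminf b - sum b {..<N}) \<longlonglongrightarrow> suminf b - suminf b"
    by (intro tendsto_intros summable_LIMSEQ bs)
  then have "(\<lambda>N. sqrt ((nrm (\<lambda>z. h z - P N z))\<^sup>2) * nrm F) \<longlonglongrightarrow> sqrt 0 * nrm F"
    unfolding nrmP by (intro tendsto_intros) simp
  then have lim: "(\<lambda>N. nrm (\<lambda>z. h z - P N z) * nrm F) \<longlonglongrightarrow> 0" by simp
  have "(\<lambda>N. inn h F - inn (P N) F) \<longlonglongrightarrow> 0"
  proof (rule Lim_null_comparison[OF always_eventually lim], rule allI)
    fix N
    show "norm (inn h F - inn (P N) F) \<le> nrm (\<lambda>z. h z - P N z) * nrm F"
      unfolding inn_diff_left[OF h PL F, symmetric]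
      by (intro L2_Cauchy_Schwarz L2_diff h PL F)
  qed
  then have "(\<lambda>N. inn h F - (inn h F - inn (P N) F)) \<longlonglongrightarrow> inn h F - 0"
    by (intro tendsto_diff tendsto_const)
  moreover have "inn (P N) F = (\<Sum>m<N. a m * inn (zpow m) F)" for N
    unfolding P_def[abs_def] by (subst inn_sum_left) (auto intro: L2_cmult monom_L2 F simp: inn_cmult_left)
  ultimately show ?thesis by (simp add: sums_def a_def)
qed

lemma inn_monom_right:
  assumes "h holomorphic_on ball 0 1" "h \<in> l2"
  shows "inn h (zpow n) = taylor h n * of_real (mom (2 * n))"
proof -
  have "(\<lambda>m. taylor h m * inn (zpow m) (zpow n)) sums inn h (zpow n)"
    by (intro inn_sums assms monom_L2)
  moreover have "(\<lambda>m. taylor h m * inn (zpow m) (zpow n)) = (\<lambda>m. if m = n then taylor h m * of_real (mom (2 * m)) else 0)"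
    by (auto simp: monom_inn fun_eq_iff)
  ultimately show ?thesis
    using sums_single[of n "\<lambda>m. taylor h m * of_real (mom (2 * m))"] by (auto intro: sums_unique2)
qed

lemma A2_eqI_inn:
  assumes f: "f \<in> a2" and g: "g \<in> a2" and eq: "\<And>h. h \<in> a2 \<Longrightarrow> inn h f = inn h g"
  shows "f = g"
proof (rule A2_eqI[OF f g], rule ext)
  fix n
  have "inn (zpow n) f = inn (zpow n) g"
    using eq[OF monom_disk_A2[of n]] inn_cong[of _ "\<lambda>z. z ^ n", OF monom_disk_eq refl] by metis
  then have "inn f (zpow n) = inn g (zpow n)"
    by (subst (1 2) inn_cnj) simp
  then show "taylor f n = taylor g n"
    using mom_pos[of "2 * n"] by (simp add: inn_monom_right[OF A2_D(2,1)[OF f]] inn_monom_right[OF A2_D(2,1)[OF g]])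
qed

text \<open>Bessel's inequality for the orthogonal system of monomials, written with the
  unnormalized coefficients that are to become the Taylor coefficients of the projection.\<close>

lemma Bessel_summable:
  assumes f: "f \<in> l2"
  shows "summable (\<lambda>n. (cmod (inn f (zpow n) / of_real (mom (2 * n))))\<^sup>2 * mom (2 * n))"
proof (rule bounded_imp_summable)
  define c where "c n = inn f (zpow n) / of_real (mom (2 * n))" for n
  show "0 \<le> (cmod (inn f (zpow n) / of_real (mom (2 * n))))\<^sup>2 * mom (2 * n)" for n
    by (simp add: mom_nonneg)
  fix N
  define S where "S = (\<Sum>n\<le>N. (cmod (c n))\<^sup>2 * mom (2 * n))"
  define P where "P z = (\<Sum>n\<le>N. c n * z ^ n)" for z :: complex
  have PL: "P \<in> l2" unfolding P_def[abs_def] by (intro L2_sum L2_cmult monom_L2)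
  have eq: "inn P g = (\<Sum>n\<le>N. c n * inn (zpow n) g)" if "g \<in> l2" for g
    unfolding P_def[abs_def] by (subst inn_sum_left) (auto intro: L2_cmult monom_L2 that simp: inn_cmult_left)
  have m: "complex_of_real (mom (2 * n)) \<noteq> 0" for n using mom_pos[of "2 * n"] by simp
  have "inn P f = (\<Sum>n\<le>N. c n * cnj (c n * of_real (mom (2 * n))))"
    unfolding eq[OF f]
  proof (intro sum.cong refl)
    fix n
    have "inn (zpow n) f = cnj (inn f (zpow n))" by (rule inn_cnj)
    then show "c n * inn (zpow n) f = c n * cnj (c n * of_real (mom (2 * n)))"
      using m by (simp add: c_def)
  qed
  also have "\<dots> = of_real S"
    unfolding S_def by (simp add: mult.assoc[symmetric] complex_norm_square[symmetric])
  finally have 1: "inn P f = of_real S" .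
  have "inn P (zpow n) = (if n \<le> N then c n * of_real (mom (2 * n)) else 0)" for n
    by (simp add: eq monom_L2 monom_inn if_distrib cong: if_cong)
  then have "inn P P = (\<Sum>n\<le>N. c n * cnj (c n * of_real (mom (2 * n))))"
    unfolding eq[OF PL]
    by (intro sum.cong refl) (subst inn_cnj, simp)
  also have "\<dots> = of_real S"
    unfolding S_def by (simp add: mult.assoc[symmetric] complex_norm_square[symmetric])
  finally have 2: "(nrm P)\<^sup>2 = S"
    unfolding inn_self by (simp only: of_real_eq_iff)
  have S0: "0 \<le> S" unfolding 2[symmetric] by simp
  \<comment> \<open>The partial sum \<open>S\<close> is at once \<open>inn P f\<close> and the
    squared norm of \<open>P\<close>, so Cauchy-Schwarz gives
    \<open>nrm P \<le> nrm f\<close>.\<close>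
  have "S \<le> nrm P * nrm f"
    using L2_Cauchy_Schwarz[OF PL f] S0 unfolding 1 by simp
  then have "(nrm P)\<^sup>2 \<le> nrm P * nrm f" unfolding 2 .
  then have "nrm P \<le> nrm f"
    using L2_norm_nonneg[of P] L2_norm_nonneg[of f] by (cases "nrm P = 0") (auto simp: power2_eq_square)
  then have "S \<le> (nrm f)\<^sup>2"
    unfolding 2[symmetric] by (intro power_mono) auto
  then show "(\<Sum>n\<le>N. (cmod (inn f (zpow n) / of_real (mom (2 * n))))\<^sup>2 * mom (2 * n)) \<le> (nrm f)\<^sup>2"
    by (simp add: S_def c_def)
qed

text \<open>The projection is written down explicitly: Bessel's inequality places the candidate
  series in \<open>a2\<close>, and orthogonality to the monomials extends to all of
  \<open>a2\<close> by \<open>inn_sums\<close>. Thus no completeness argument enters, and the Taylor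
  coefficients are known.\<close>

lemma bergman_proj_props:
  assumes f: "f \<in> l2"
  shows "bergman_proj \<omega> f \<in> a2"
    and "taylor (bergman_proj \<omega> f) n = inn f (zpow n) / of_real (mom (2 * n))"
    and "h \<in> a2 \<Longrightarrow> inn (bergman_proj \<omega> f) h = inn f h"
proof -
  define g where "g = power_series_disk (\<lambda>n. inn f (zpow n) / of_real (mom (2 * n)))"
  note g = power_series_disk_A2[OF Bessel_summable[OF f], folded g_def]
  have m: "complex_of_real (mom (2 * n)) \<noteq> 0" for n using mom_pos[of "2 * n"] by simp
  have fg: "(\<lambda>z. f z - g z) \<in> l2" by (intro L2_diff f A2_D(1)[OF g(1)])
  have "inn (\<lambda>z. f z - g z) (zpow n) = 0" for n
    using inn_monom_right[OF A2_D(2,1)[OF g(1)], of n] m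
    by (simp add: inn_diff_left[OF f A2_D(1)[OF g(1)] monom_L2] g(2))
  then have "inn (zpow n) (\<lambda>z. f z - g z) = 0" for n
    by (subst inn_cnj) simp
  then have orth0: "inn h (\<lambda>z. f z - g z) = 0" if "h \<in> a2" for h
    using inn_sums[OF A2_D(2,1)[OF that] fg] by (simp add: sums_iff)
  have orth: "inn (\<lambda>z. f z - g z) h = 0" if "h \<in> a2" for h
    using orth0[OF that] by (subst inn_cnj) simp
  have uniq: "g' = g" if g': "g' \<in> a2" "\<forall>h\<in>a2. inn (\<lambda>z. f z - g' z) h = 0" for g'
  proof (rule A2_eqI_inn[OF g'(1) g(1)])
    fix h assume h: "h \<in> a2"
    have "inn g' h = inn g h"
      using g'(2)[rule_format, OF h] orth[OF h] A2_D(1)[OF h] by (simp add: inn_diff_left f A2_D(1) g(1) g'(1))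
    then show "inn h g' = inn h g" by (subst (1 2) inn_cnj) simp
  qed
  have proj: "bergman_proj \<omega> f = g"
    unfolding bergman_proj_def
  proof (rule the_equality)
    show "g \<in> a2 \<and> (\<forall>h\<in>a2. inn (\<lambda>z. f z - g z) h = 0)"
      using g(1) orth by blast
  qed (use uniq in blast)
  show "bergman_proj \<omega> f \<in> a2" using g(1) by (simp add: proj)
  show "taylor (bergman_proj \<omega> f) n = inn f (zpow n) / of_real (mom (2 * n))"
    by (simp add: proj g(2))
  show "inn (bergman_proj \<omega> f) h = inn f h" if "h \<in> a2"
    using orth[OF that] inn_diff_left[OF f A2_D(1)[OF g(1)] A2_D(1)[OF that]] by (simp add: proj)
qed

abbreviation kernel_sq :: "complex \<Rightarrow> real" where
  "kernel_sq a \<equiv> (nrm (bergman_kernel \<omega> a))\<^sup>2"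

text \<open>The kernel is found by matching \<open>inn (zpow n) g\<close> with a^n for every
  \<open>n\<close>. The third claim gives the normalizing constant of the averages:
  \<open>kernel_sq a\<close> is the sum of the weights |a|^(2n) /
  \<open>mom (2 * n)\<close>.\<close>

lemma bergman_kernel_props:
  assumes a: "cmod a < 1"
  shows "bergman_kernel \<omega> a \<in> a2"
    and "taylor (bergman_kernel \<omega> a) n = cnj a ^ n / of_real (mom (2 * n))"
    and "(\<lambda>n. cmod a ^ (2 * n) / mom (2 * n)) sums kernel_sq a"
proof -
  define c where "c n = cnj a ^ n / complex_of_real (mom (2 * n))" for n
  have m: "complex_of_real (mom (2 * n)) \<noteq> 0" for n using mom_pos[of "2 * n"] by simp
  have c2: "(cmod (c n))\<^sup>2 * mom (2 * n) = cmod a ^ (2 * n) / mom (2 * n)" for n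
    using mom_pos[of "2 * n"]
    by (simp add: c_def norm_divide norm_power power_divide power2_eq_square power_mult power_mult_distrib)
  define r where "r = (cmod a + 1) / 2"
  have r: "0 < r" "r < 1" "cmod a < r" using a by (auto simp: r_def add_nonneg_pos)
  obtain d where d: "0 < d" "\<And>n. d * r ^ n \<le> mom n"
    using mom_lower[OF r(1,2)] by blast
  have s: "summable (\<lambda>n. (cmod (c n))\<^sup>2 * mom (2 * n))"
  proof (rule summable_comparison_test')
    show "summable (\<lambda>n. inverse d * ((cmod a / r)\<^sup>2) ^ n)"
      using r by (intro summable_mult summable_geometric) (auto simp: power_less_one_iff)
    fix n
    have "cmod a ^ (2 * n) / mom (2 * n) \<le> cmod a ^ (2 * n) / (d * r ^ (2 * n))"
      using d r mom_pos[of "2 * n"] by (intro divide_left_mono mult_pos_pos) auto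
    also have "\<dots> = inverse d * ((cmod a / r)\<^sup>2) ^ n"
      unfolding power_mult power_divide by (simp add: divide_inverse mult.commute)
    finally show "norm ((cmod (c n))\<^sup>2 * mom (2 * n)) \<le> inverse d * ((cmod a / r)\<^sup>2) ^ n"
      unfolding c2 using mom_pos[of "2 * n"] by simp
  qed
  define g where "g = power_series_disk c"
  note g = power_series_disk_A2[OF s, folded g_def]
  have repr: "f a = inn f g" if f: "f \<in> a2" for f
  proof -
    have "inn (zpow n) g = a ^ n" for n
      using inn_monom_right[OF A2_D(2,1)[OF g(1)], of n] m[of n]
      by (subst inn_cnj) (simp add: g(2) c_def)
    then have "(\<lambda>n. taylor f n * a ^ n) sums inn f g"
      using inn_sums[OF A2_D(2,1)[OF f] A2_D(1)[OF g(1)]] by simp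
    then show ?thesis
      using taylor_sums[OF A2_D(2)[OF f] a] by (rule sums_unique2[rotated])
  qed
  have uniq: "g' = g" if g': "g' \<in> a2" "\<forall>f\<in>a2. f a = inn f g'" for g'
    using A2_eqI_inn[OF g'(1) g(1)] g'(2) repr by simp
  have ker: "bergman_kernel \<omega> a = g"
    unfolding bergman_kernel_def
  proof (rule the_equality)
    show "g \<in> a2 \<and> (\<forall>f\<in>a2. f a = inn f g)"
      using g(1) repr by blast
  qed (use uniq in blast)
  show "bergman_kernel \<omega> a \<in> a2" using g(1) by (simp add: ker)
  show "taylor (bergman_kernel \<omega> a) n = cnj a ^ n / of_real (mom (2 * n))"
    by (simp add: ker g(2) c_def)
  show "(\<lambda>n. cmod a ^ (2 * n) / mom (2 * n)) sums kernel_sq a"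
    using holomorphic_L2_sums[OF A2_D(2,1)[OF g(1)]] by (simp add: ker g(2) c2)
qed

end

section \<open>Compactness, symbols and Toeplitz operators\<close>

context positive_radial_weight
begin

text \<open>Definiteness holds for functions and not just for classes, because members of
  \<open>a2\<close> are determined by their inner products with \<open>a2\<close>.\<close>

lemma A2_Metric_space: "Metric_space a2 (\<lambda>f g. nrm (\<lambda>z. f z - g z))"
proof
  fix f g
  show "0 \<le> nrm (\<lambda>z. f z - g z)" by simp
  show "nrm (\<lambda>z. f z - g z) = nrm (\<lambda>z. g z - f z)"
    by (simp add: L2_norm_def norm_minus_commute)
  show "nrm (\<lambda>z. f z - g z) = 0 \<longleftrightarrow> f = g" if f: "f \<in> a2" and g: "g \<in> a2"
  proof
    assume 0: "nrm (\<lambda>z. f z - g z) = 0"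
    show "f = g"
    proof (rule A2_eqI_inn[OF f g])
      fix h assume h: "h \<in> a2"
      have "cmod (inn (\<lambda>z. f z - g z) h) \<le> nrm (\<lambda>z. f z - g z) * nrm h"
        by (intro L2_Cauchy_Schwarz L2_diff A2_D f g h)
      then have "inn f h = inn g h"
        by (simp add: 0 inn_diff_left[OF A2_D(1)[OF f] A2_D(1)[OF g] A2_D(1)[OF h]])
      then show "inn h f = inn h g" by (subst (1 2) inn_cnj) simp
    qed
  qed (simp add: L2_norm_def)
  show "nrm (\<lambda>z. f z - h z) \<le> nrm (\<lambda>z. f z - g z) + nrm (\<lambda>z. g z - h z)"
    if "f \<in> a2" "g \<in> a2" "h \<in> a2" for h
    using L2_add(2)[OF L2_diff[OF A2_D(1) A2_D(1)] L2_diff[OF A2_D(1) A2_D(1)], of f g g h] that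
    by simp
qed

text \<open>A limit \<open>l\<close> of a subsequence of \<open>S (f j)\<close> would inherit
  components of size at least \<open>c / 2\<close> along normalized monomials of degrees tending to
  infinity, contradicting summability of the Parseval series of \<open>l\<close>.\<close>

lemma not_compact_operator_A2I:
  assumes f: "\<And>j. f j \<in> a2" "\<And>j. nrm (f j) \<le> 1" "\<And>j. S (f j) \<in> a2"
    and m: "filterlim m at_top sequentially" and c: "0 < c"
    and lower: "\<And>j. c * sqrt (mom (2 * m j)) \<le> cmod (inn (S (f j)) (zpow (m j)))"
  shows "\<not> compact_operator_A2 \<omega> S"
proof
  interpret A: Metric_space a2 "\<lambda>f g. nrm (\<lambda>z. f z - g z)" by (rule A2_Metric_space)
  assume "compact_operator_A2 \<omega> S"
  then have comp: "compactin A.mtopology (A.mtopology closure_of (S ` {f \<in> a2. nrm f \<le> 1}))"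
    unfolding compact_operator_A2_def A2_topology_def .
  have sub: "range (\<lambda>j. S (f j)) \<subseteq> A.mtopology closure_of (S ` {f \<in> a2. nrm f \<le> 1})"
  proof -
    \<comment> \<open>A closure is formed inside the \<open>topspace\<close>, so the membership of
      each \<open>S (f j)\<close> in \<open>a2\<close> has to be carried along.\<close>
    have "range (\<lambda>j. S (f j)) \<subseteq> topspace A.mtopology \<inter> S ` {f \<in> a2. nrm f \<le> 1}"
    proof (rule image_subsetI)
      fix j
      have "f j \<in> {f \<in> a2. nrm f \<le> 1}" using f by simp
      then have "S (f j) \<in> S ` {f \<in> a2. nrm f \<le> 1}" by (rule imageI)
      then show "S (f j) \<in> topspace A.mtopology \<inter> S ` {f \<in> a2. nrm f \<le> 1}"
        using f(3) by (simp add: A.topspace_mtopology)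
    qed
    then show ?thesis using closure_of_subset_Int by (rule order_trans)
  qed
  obtain l r where r: "strict_mono (r :: nat \<Rightarrow> nat)"
    and lim: "limitin A.mtopology ((\<lambda>j. S (f j)) \<circ> r) l sequentially"
  proof -
    have "\<forall>\<sigma> :: nat \<Rightarrow> _. range \<sigma> \<subseteq> A.mtopology closure_of (S ` {f \<in> a2. nrm f \<le> 1}) \<longrightarrow>
      (\<exists>l (r :: nat \<Rightarrow> nat). l \<in> A.mtopology closure_of (S ` {f \<in> a2. nrm f \<le> 1}) \<and> strict_mono r \<and>
        limitin A.mtopology (\<sigma> \<circ> r) l sequentially)"
      using comp unfolding A.compactin_sequentially by (rule conjunct2)
    from this[rule_format, OF sub] that show ?thesis by blast
  qed
  have l: "l \<in> a2" using lim by (simp add: A.limit_metric_sequentially)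
  obtain N where N: "\<And>n. n \<ge> N \<Longrightarrow> nrm (\<lambda>z. S (f (r n)) z - l z) < c / 2"
  proof -
    have "0 < c / 2" using c by simp
    then have "\<exists>N. \<forall>n\<ge>N. ((\<lambda>j. S (f j)) \<circ> r) n \<in> a2 \<and>
      nrm (\<lambda>z. ((\<lambda>j. S (f j)) \<circ> r) n z - l z) < c / 2"
      using lim unfolding A.limit_metric_sequentially by blast
    then show ?thesis using that by auto
  qed
  have low: "c / 2 \<le> cmod (taylor l (m (r n))) * sqrt (mom (2 * m (r n)))" if "n \<ge> N" for n
  proof -
    let ?k = "m (r n)"
    have p: "0 < sqrt (mom (2 * ?k))" using mom_pos by simp
    have e: "inn (\<lambda>z. S (f (r n)) z - l z) (zpow ?k) = inn (S (f (r n))) (zpow ?k) - inn l (zpow ?k)"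
      by (intro inn_diff_left A2_D(1) f l monom_L2)
    have "cmod (inn (\<lambda>z. S (f (r n)) z - l z) (zpow ?k)) \<le> nrm (\<lambda>z. S (f (r n)) z - l z) * nrm (zpow ?k)"
      by (intro L2_Cauchy_Schwarz L2_diff A2_D(1) f l monom_L2)
    also have "\<dots> \<le> c / 2 * sqrt (mom (2 * ?k))"
      unfolding nrm_monom using N[OF that] p by (intro mult_right_mono) auto
    finally have "c * sqrt (mom (2 * ?k)) - c / 2 * sqrt (mom (2 * ?k)) \<le> cmod (inn l (zpow ?k))"
      unfolding e using lower[of "r n"] norm_triangle_ineq2[of "inn (S (f (r n))) (zpow ?k)" "inn l (zpow ?k)"]
      by linarith
    also have "cmod (inn l (zpow ?k)) = cmod (taylor l ?k) * (sqrt (mom (2 * ?k)) * sqrt (mom (2 * ?k)))"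
      using mom_nonneg[of "2 * ?k"] by (simp add: inn_monom_right[OF A2_D(2,1)[OF l]] norm_mult)
    finally have "(c / 2) * sqrt (mom (2 * ?k)) \<le> (cmod (taylor l ?k) * sqrt (mom (2 * ?k))) * sqrt (mom (2 * ?k))"
      by (simp add: algebra_simps)
    then show ?thesis using p by (simp only: mult_le_cancel_right_pos)
  qed
  have "(\<lambda>n. (cmod (taylor l n))\<^sup>2 * mom (2 * n)) \<longlonglongrightarrow> 0"
    by (rule summable_LIMSEQ_zero[OF sums_summable[OF holomorphic_L2_sums[OF A2_D(2,1)[OF l]]]])
  then have "(\<lambda>n. (cmod (taylor l (m (r n))))\<^sup>2 * mom (2 * m (r n))) \<longlonglongrightarrow> 0"
    using filterlim_compose[OF m filterlim_subseq[OF r]]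
    by (rule filterlim_compose[where f = "\<lambda>n. m (r n)"])
  then have "\<forall>\<^sub>F n in sequentially. (cmod (taylor l (m (r n))))\<^sup>2 * mom (2 * m (r n)) < (c / 2)\<^sup>2"
    using c by (intro order_tendstoD(2)) auto
  then have "\<forall>\<^sub>F n in sequentially. False"
    using eventually_ge_at_top[of N]
  proof eventually_elim
    case (elim n)
    have "(c / 2)\<^sup>2 \<le> (cmod (taylor l (m (r n))) * sqrt (mom (2 * m (r n))))\<^sup>2"
      using low[OF elim(2)] c by (intro power_mono) auto
    also have "\<dots> = (cmod (taylor l (m (r n))))\<^sup>2 * mom (2 * m (r n))"
      using mom_nonneg by (simp add: power_mult_distrib)
    finally show False using elim(1) by simp
  qed
  then show False by simp
qed

text \<open>In polar coordinates the symbol is \<phi>(r) e^(ik\<theta>); its Toeplitz operator is a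
  weighted shift that raises the degree by \<open>k\<close>.\<close>

definition angular_symbol :: "(real \<Rightarrow> real) \<Rightarrow> nat \<Rightarrow> complex \<Rightarrow> complex" where
  "angular_symbol \<phi> k z = of_real (\<phi> (cmod z)) * sgn z ^ k"

lemma angular_symbol_measurable [measurable]:
  assumes [measurable]: "\<phi> \<in> borel_measurable borel"
  shows "angular_symbol \<phi> k \<in> borel_measurable \<mu>"
  unfolding angular_symbol_def[abs_def] by measurable

lemma angular_symbol_bound: "(\<And>r. \<bar>\<phi> r\<bar> \<le> 1) \<Longrightarrow> cmod (angular_symbol \<phi> k z) \<le> 1"
  by (auto simp: angular_symbol_def norm_mult norm_power norm_sgn intro!: mult_le_one power_le_one)

text \<open>The symbol is moved to the right factor and \<open>f\<close> is expanded; then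
  \<open>g\<close> is expanded against a single shifted monomial, where only its coefficient at
  \<open>n + k\<close> survives. Two single expansions avoid any double series.\<close>

lemma inn_angular_symbol_sums:
  assumes [measurable]: "\<phi> \<in> borel_measurable borel" and b: "\<And>r. \<bar>\<phi> r\<bar> \<le> 1"
    and f: "f holomorphic_on ball 0 1" "f \<in> l2" and g: "g holomorphic_on ball 0 1" "g \<in> l2"
  shows "(\<lambda>n. taylor f n * cnj (taylor g (n + k)) * of_real (moment \<phi> (2 * n + k)))
    sums inn (\<lambda>z. angular_symbol \<phi> k z * f z) g"
proof -
  let ?v = "angular_symbol \<phi> k"
  have v: "?v \<in> borel_measurable \<mu>" "\<And>z. cmod (?v z) \<le> 1"
    by (simp, rule angular_symbol_bound[OF b])
  have cv: "(\<lambda>z. cnj (?v z)) \<in> borel_measurable \<mu>" "\<And>z. cmod (cnj (?v z)) \<le> 1"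
  proof -
    show "(\<lambda>z. cnj (?v z)) \<in> borel_measurable \<mu>"
      using measurable_compose[OF v(1), of cnj borel]
      by (simp add: borel_measurable_continuous_onI continuous_on_cnj)
  qed (simp add: v)
  have adj: "inn (\<lambda>z. ?v z * F z) G = inn F (\<lambda>z. cnj (?v z) * G z)" for F G
    by (simp add: L2_inner_def mult_ac)
  have mono: "inn (\<lambda>z. ?v z * z ^ n) (zpow m) = (if m = n + k then of_real (moment \<phi> (2 * n + k)) else 0)" for n m
    using integral_sgn_monom[of \<phi> k n m] by (simp add: L2_inner_def angular_symbol_def)
  have 1: "inn (zpow n) (\<lambda>z. cnj (?v z) * g z) = cnj (taylor g (n + k)) * of_real (moment \<phi> (2 * n + k))" for n
  proof -
    have "(\<lambda>m. taylor g m * inn (zpow m) (\<lambda>z. ?v z * z ^ n)) sums inn g (\<lambda>z. ?v z * z ^ n)"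
      by (intro inn_sums g L2_mult_bounded monom_L2 v)
    moreover have "inn (zpow m) (\<lambda>z. ?v z * z ^ n) = (if m = n + k then of_real (moment \<phi> (2 * n + k)) else 0)" for m
      by (subst inn_cnj, subst mono) simp
    ultimately have "(\<lambda>m. if m = n + k then taylor g m * of_real (moment \<phi> (2 * n + k)) else 0) sums inn g (\<lambda>z. ?v z * z ^ n)"
      by (simp add: if_distrib cong: if_cong)
    then have "inn g (\<lambda>z. ?v z * z ^ n) = taylor g (n + k) * of_real (moment \<phi> (2 * n + k))"
      using sums_single[of "n + k" "\<lambda>m. taylor g m * of_real (moment \<phi> (2 * n + k))"]
      by (auto intro: sums_unique2)
    then show ?thesis
      unfolding adj[symmetric] by (subst inn_cnj) simp
  qed
  have "(\<lambda>n. taylor f n * inn (zpow n) (\<lambda>z. cnj (?v z) * g z)) sums inn f (\<lambda>z. cnj (?v z) * g z)"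
    by (intro inn_sums f L2_mult_bounded g cv)
  then show ?thesis
    unfolding 1 adj by (simp add: mult.assoc)
qed

lemma toeplitz_radial:
  assumes [measurable]: "\<phi> \<in> borel_measurable borel" and b: "\<And>r. \<bar>\<phi> r\<bar> \<le> 1" and f: "f \<in> a2"
  shows "toeplitz \<omega> (\<lambda>z. of_real (\<phi> (cmod z))) f \<in> a2"
    and "taylor (toeplitz \<omega> (\<lambda>z. of_real (\<phi> (cmod z))) f) n =
      taylor f n * of_real (moment \<phi> (2 * n) / mom (2 * n))"
proof -
  have m: "(\<lambda>z. complex_of_real (\<phi> (cmod z))) \<in> borel_measurable \<mu>" by measurable
  have uf: "(\<lambda>z. complex_of_real (\<phi> (cmod z)) * f z) \<in> l2"
    by (rule L2_mult_bounded(1)[OF A2_D(1)[OF f] m]) (simp add: b)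
  show "toeplitz \<omega> (\<lambda>z. of_real (\<phi> (cmod z))) f \<in> a2"
    unfolding toeplitz_def by (rule bergman_proj_props(1)[OF uf])
  have "(\<lambda>i. taylor f i * cnj (taylor (zpow n) (i + 0)) * of_real (moment \<phi> (2 * i + 0)))
    sums inn (\<lambda>z. angular_symbol \<phi> 0 z * f z) (zpow n)"
    by (intro inn_angular_symbol_sums b A2_D(1,2)[OF f] monom_L2 holomorphic_intros) simp
  then have "(\<lambda>i. if i = n then taylor f i * of_real (moment \<phi> (2 * i)) else 0)
    sums inn (\<lambda>z. of_real (\<phi> (cmod z)) * f z) (zpow n)"
    by (simp add: monom_taylor angular_symbol_def if_distrib if_distribR cong: if_cong)
  then have "inn (\<lambda>z. of_real (\<phi> (cmod z)) * f z) (zpow n) = taylor f n * of_real (moment \<phi> (2 * n))"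
    using sums_single[of n "\<lambda>i. taylor f i * of_real (moment \<phi> (2 * i))"]
    by (auto intro: sums_unique2)
  then show "taylor (toeplitz \<omega> (\<lambda>z. of_real (\<phi> (cmod z))) f) n =
      taylor f n * of_real (moment \<phi> (2 * n) / mom (2 * n))"
    by (simp add: toeplitz_def bergman_proj_props(2)[OF uf])
qed

lemma A2_divide:
  assumes f: "f \<in> a2"
  shows "(\<lambda>z. f z / c) \<in> a2" "taylor (\<lambda>z. f z / c) n = taylor f n / c"
proof -
  have "(\<lambda>z. inverse c * f z) \<in> l2" by (intro L2_cmult A2_D f)
  then show "(\<lambda>z. f z / c) \<in> a2"
    using A2_D(2,3)[OF f] by (auto simp: A2_def divide_inverse mult.commute intro!: holomorphic_intros)
  have "taylor (\<lambda>z. f z / c) = (\<lambda>n. taylor f n / c)"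
  proof (rule taylor_unique(2))
    fix z :: complex assume "cmod z < 1"
    then show "(\<lambda>n. taylor f n / c * z ^ n) sums (f z / c)"
      using sums_divide[OF taylor_sums[OF A2_D(2)[OF f]], of z c] by simp
  qed
  then show "taylor (\<lambda>z. f z / c) n = taylor f n / c" by simp
qed

definition multi_symbol :: "(nat \<Rightarrow> real set) \<Rightarrow> (nat \<Rightarrow> nat) \<Rightarrow> complex \<Rightarrow> complex" where
  "multi_symbol A k z = (\<Sum>j. angular_symbol (indicator (A j)) (k j) z)"

text \<open>At each point at most one annulus is active, so the absolute sum of the symbols is at
  most 1. This also bounds the integrated absolute values by those of \<open>f\<close> times
  \<open>g\<close> and permits termwise integration, which splits the Berezin transform into one
  contribution per scale.\<close>

lemma multi_symbol_props:
  assumes A: "\<And>j. A j \<in> sets borel" and dis: "disjoint_family A"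
  shows "multi_symbol A k \<in> borel_measurable \<mu>" "cmod (multi_symbol A k z) \<le> 1"
    and "\<And>f g. f \<in> l2 \<Longrightarrow> g \<in> l2 \<Longrightarrow>
      (\<lambda>j. inn (\<lambda>z. angular_symbol (indicator (A j)) (k j) z * f z) g) sums inn (\<lambda>z. multi_symbol A k z * f z) g"
proof -
  let ?v = "\<lambda>j. angular_symbol (indicator (A j)) (k j)"
  have [measurable]: "?v j \<in> borel_measurable \<mu>" for j using A by simp
  have vb: "cmod (?v j z) \<le> 1" for j z by (rule angular_symbol_bound) (simp add: indicator_def)
  have fin: "finite {j. ?v j z \<noteq> 0}" "sum (\<lambda>j. cmod (?v j z)) I \<le> 1" if "finite I" for z I
  proof -
    have at: "\<exists>i. {j. ?v j z \<noteq> 0} \<subseteq> {i}"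
    proof (cases "\<exists>i. cmod z \<in> A i")
      case True
      then obtain i where "cmod z \<in> A i" by blast
      then have "j = i" if "cmod z \<in> A j" for j
        using dis that by (auto simp: disjoint_family_on_def)
      then show ?thesis by (intro exI[of _ i]) (auto simp: angular_symbol_def indicator_def split: if_splits)
    qed (auto simp: angular_symbol_def)
    then show "finite {j. ?v j z \<noteq> 0}" using finite_subset by blast
    from at obtain i where i: "{j. ?v j z \<noteq> 0} \<subseteq> {i}" by blast
    have "sum (\<lambda>j. cmod (?v j z)) I \<le> sum (\<lambda>j. cmod (?v j z)) (insert i I)"
      using that by (intro sum_mono2) auto
    also have "\<dots> = sum (\<lambda>j. cmod (?v j z)) {i}"
      using i that by (intro sum.mono_neutral_right) auto
    also have "\<dots> \<le> 1" using vb by simp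
    finally show "sum (\<lambda>j. cmod (?v j z)) I \<le> 1" .
  qed
  have sm: "summable (\<lambda>j. cmod (?v j z))" for z
    using fin(1)[of "{}" z] by (intro summable_finite[of "{j. ?v j z \<noteq> 0}"]) auto
  show "multi_symbol A k \<in> borel_measurable \<mu>"
    unfolding multi_symbol_def[abs_def] by measurable
  have "cmod (multi_symbol A k z) \<le> (\<Sum>j. cmod (?v j z))"
    unfolding multi_symbol_def by (rule summable_norm[OF sm])
  also have "\<dots> \<le> 1" by (intro suminf_le_const sm fin) auto
  finally show "cmod (multi_symbol A k z) \<le> 1" .
  fix f g assume f: "f \<in> l2" and g: "g \<in> l2"
  have I: "integrable \<mu> (\<lambda>z. ?v j z * f z * cnj (g z))" for j
    by (intro L2_mult_integrable(2) L2_mult_bounded f g vb) simp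
  have nI: "integrable \<mu> (\<lambda>z. cmod (?v j z * f z * cnj (g z)))" for j
    using I by (rule integrable_norm)
  have fgI: "integrable \<mu> (\<lambda>z. cmod (f z) * cmod (g z))" by (rule L2_mult_integrable(1)[OF f g])
  have "(\<lambda>j. LINT z|\<mu>. ?v j z * f z * cnj (g z)) sums (LINT z|\<mu>. (\<Sum>j. ?v j z * f z * cnj (g z)))"
  proof (rule sums_integral[OF I])
    show "AE z in \<mu>. summable (\<lambda>j. norm (?v j z * f z * cnj (g z)))"
      using summable_mult2[OF sm] by (intro AE_I2) (simp add: norm_mult mult.assoc)
    show "summable (\<lambda>j. LINT z|\<mu>. norm (?v j z * f z * cnj (g z)))"
    proof (rule bounded_imp_summable)
      show "0 \<le> (LINT z|\<mu>. norm (?v j z * f z * cnj (g z)))" for j by (intro integral_nonneg_AE) simp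
      fix n
      have "(\<Sum>j\<le>n. LINT z|\<mu>. norm (?v j z * f z * cnj (g z))) = (LINT z|\<mu>. (\<Sum>j\<le>n. norm (?v j z * f z * cnj (g z))))"
        by (intro Bochner_Integration.integral_sum[symmetric] nI)
      also have "\<dots> \<le> (LINT z|\<mu>. cmod (f z) * cmod (g z))"
      proof (intro integral_mono fgI Bochner_Integration.integrable_sum nI)
        fix z
        have "(\<Sum>j\<le>n. norm (?v j z * f z * cnj (g z))) = (\<Sum>j\<le>n. cmod (?v j z)) * (cmod (f z) * cmod (g z))"
          by (simp add: norm_mult sum_distrib_right mult.assoc)
        also have "\<dots> \<le> 1 * (cmod (f z) * cmod (g z))"
          by (intro mult_right_mono fin) auto
        finally show "(\<Sum>j\<le>n. norm (?v j z * f z * cnj (g z))) \<le> cmod (f z) * cmod (g z)" by simp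
      qed
      finally show "(\<Sum>j\<le>n. LINT z|\<mu>. norm (?v j z * f z * cnj (g z))) \<le> (LINT z|\<mu>. cmod (f z) * cmod (g z))" .
    qed
  qed
  moreover have "(\<Sum>j. ?v j z * f z * cnj (g z)) = multi_symbol A k z * f z * cnj (g z)" for z
    unfolding multi_symbol_def mult.assoc
    by (rule suminf_mult2[OF summable_norm_cancel[OF sm], symmetric])
  ultimately show "(\<lambda>j. inn (\<lambda>z. ?v j z * f z) g) sums inn (\<lambda>z. multi_symbol A k z * f z) g"
    by (simp add: L2_inner_def)
qed

end

section \<open>Berezin transforms of products of quasi-radial Toeplitz operators\<close>

context
  fixes W :: "nat \<Rightarrow> real" and x S :: real
  assumes W: "\<And>n. 0 < W n" "decseq W" and x: "0 < x" "x < 1"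
    and S: "(\<lambda>n. x ^ (2 * n) / W n) sums S"
begin

text \<open>In the application \<open>x\<close> is \<open>cmod a\<close>, \<open>W n\<close> is
  \<open>mom (2 * n)\<close> and \<open>S\<close> is \<open>kernel_sq a\<close>, so that
  \<open>q n / S\<close> is a probability distribution on the degrees.\<close>

abbreviation q :: "nat \<Rightarrow> real" where "q n \<equiv> x ^ (2 * n) / W n"

lemma weighted_series_pos: "0 < S"
proof -
  have "0 < (\<Sum>n. q n)"
    using S W(1) x by (intro suminf_pos) (auto simp: sums_iff)
  then show ?thesis using S by (simp add: sums_iff)
qed

lemma weighted_partial_sum_le: "(\<Sum>n\<in>I. q n) \<le> S" if "finite I"
  using S W(1) x that by (auto simp: sums_iff less_imp_le intro!: sum_le_suminf)

text \<open>Both blocks are compared with the single value \<open>W N\<close>: below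
  \<open>N\<close> every term is at most \<open>1 / W N\<close>, and from \<open>N\<close> to
  \<open>K\<close> every term is at least \<open>x ^ (2 * K) / W N\<close>. The size of
  \<open>W N\<close> cancels, so monotonicity of the moments is all that matters.\<close>

lemma weighted_block_bound:
  assumes "N < K"
  shows "x ^ (2 * K) * real (K - N) * (\<Sum>n<N. q n) \<le> real N * S"
proof -
  have "(\<Sum>n<N. q n) \<le> (\<Sum>n<N. 1 / W N)"
    using W x by (intro sum_mono frac_le) (auto simp: decseq_def power_le_one less_imp_le)
  also have "\<dots> = real N / W N" by simp
  finally have 1: "(\<Sum>n<N. q n) \<le> real N / W N" .
  have "real (K - N) * (x ^ (2 * K) / W N) = (\<Sum>n\<in>{N..<K}. x ^ (2 * K) / W N)" by simp
  also have "\<dots> \<le> (\<Sum>n\<in>{N..<K}. q n)"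
    using W x by (intro sum_mono frac_le power_decreasing) (auto simp: decseq_def less_imp_le)
  also have "\<dots> \<le> S" by (rule weighted_partial_sum_le) simp
  finally have 2: "real (K - N) * (x ^ (2 * K) / W N) \<le> S" .
  have "x ^ (2 * K) * real (K - N) * (\<Sum>n<N. q n) \<le> x ^ (2 * K) * real (K - N) * (real N / W N)"
    using 1 x by (intro mult_left_mono) auto
  also have "\<dots> = real N * (real (K - N) * (x ^ (2 * K) / W N))" by simp
  also have "\<dots> \<le> real N * S" by (intro mult_left_mono 2) simp
  finally show ?thesis .
qed

lemma weighted_summable:
  assumes b: "\<And>n. 0 \<le> b n" "\<And>n. b n \<le> B"
  shows "summable (\<lambda>n. q n * b n)"
proof (rule summable_comparison_test')
  show "summable (\<lambda>n. q n * B)"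
    using S by (intro summable_mult2) (simp add: sums_iff)
  show "norm (q n * b n) \<le> q n * B" for n
    using b x W(1)[of n] by (auto simp: abs_mult intro!: mult_left_mono divide_right_mono)
qed

lemma weighted_split:
  assumes b: "\<And>n. 0 \<le> b n" "\<And>n. n < N \<Longrightarrow> b n \<le> C" "\<And>n. N \<le> n \<Longrightarrow> b n \<le> e" and C: "0 \<le> C"
  shows "(\<Sum>n. q n * b n) \<le> C * (\<Sum>n<N. q n) + e * S"
proof -
  have e0: "0 \<le> e" using b(1)[of N] b(3)[of N] by linarith
  have pos: "0 \<le> q n" for n using x W(1)[of n] by simp
  have bB: "b n \<le> C + e" for n using b(2,3)[of n] C e0 by (cases "n < N") auto
  have "(\<lambda>n. (if n \<in> {..<N} then q n * C else 0) + q n * e) sums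
    ((\<Sum>n<N. q n * C) + S * e)"
    by (intro sums_add sums_If_finite_set sums_mult2 S) simp
  moreover have "q n * b n \<le> (if n \<in> {..<N} then q n * C else 0) + q n * e" for n
  proof (cases "n < N")
    case True
    have "q n * b n \<le> q n * C"
      using b(2)[OF True] pos by (rule mult_left_mono)
    then show ?thesis using True mult_nonneg_nonneg[OF pos[of n] e0] by simp
  next
    case False
    then show ?thesis using mult_left_mono[OF b(3)[of n] pos[of n]] by simp
  qed
  ultimately have "(\<Sum>n. q n * b n) \<le> (\<Sum>n<N. q n * C) + S * e"
    using weighted_summable[OF b(1) bB] by (intro sums_le[OF _ summable_sums]) auto
  then show ?thesis by (simp add: sum_distrib_left mult.commute)
qed

text \<open>With \<open>P\<close> the share of the indices below \<open>N\<close> and \<open>y = x ^ k\<close>, the block bound gives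
  \<open>y\<^sup>2 * P \<le> N / (k - N)\<close>, and \<open>P \<le> 1\<close> turns this into \<open>y * P \<le> sqrt (N / (k - N))\<close>.\<close>

lemma weighted_average_bound:
  assumes b: "\<And>n. 0 \<le> b n" "\<And>n. n < N \<Longrightarrow> b n \<le> C" "\<And>n. N \<le> n \<Longrightarrow> b n \<le> e" and C: "0 \<le> C"
    and N: "N < k"
  shows "x ^ k * (\<Sum>n. q n * b n) \<le> (C * sqrt (real N / real (k - N)) + e) * S"
proof -
  define T where "T = (\<Sum>n<N. q n)"
  have e0: "0 \<le> e" using b(1)[of N] b(3)[of N] by linarith
  have T: "0 \<le> T" "T \<le> S"
    using x W(1) weighted_partial_sum_le[of "{..<N}"] by (auto simp: T_def intro!: sum_nonneg divide_nonneg_pos)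
  have "(x ^ k * T)\<^sup>2 = x ^ (2 * k) * T * T"
    by (simp add: power2_eq_square power_mult power_mult_distrib)
  also have "\<dots> \<le> x ^ (2 * k) * T * S" using T x by (intro mult_left_mono) auto
  also have "\<dots> \<le> (real N / real (k - N) * S) * S"
  proof (rule mult_right_mono)
    show "x ^ (2 * k) * T \<le> real N / real (k - N) * S"
      using weighted_block_bound[OF N] N by (simp add: T_def field_simps)
  qed (use T in linarith)
  also have "\<dots> = (sqrt (real N / real (k - N)) * S)\<^sup>2"
    unfolding power_mult_distrib by (subst real_sqrt_pow2) (simp_all add: power2_eq_square)
  finally have "(x ^ k * T)\<^sup>2 \<le> (sqrt (real N / real (k - N)) * S)\<^sup>2" .
  then have yT: "x ^ k * T \<le> sqrt (real N / real (k - N)) * S"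
    by (rule power2_le_imp_le) (use T in auto)
  have "x ^ k * (\<Sum>n. q n * b n) \<le> x ^ k * (C * T + e * S)"
    unfolding T_def using x by (intro mult_left_mono weighted_split b C) auto
  also have "\<dots> = C * (x ^ k * T) + x ^ k * (e * S)" by (simp add: algebra_simps)
  also have "\<dots> \<le> C * (sqrt (real N / real (k - N)) * S) + 1 * (e * S)"
    using x e0 T C yT by (intro add_mono mult_left_mono mult_right_mono power_le_one) auto
  also have "\<dots> = (C * sqrt (real N / real (k - N)) + e) * S" by (simp add: algebra_simps)
  finally show ?thesis .
qed

end

text \<open>As \<open>x\<close> tends to 1, any fixed initial block of degrees loses its share to
  the longer block that follows it, so the averages of a null sequence tend to 0.\<close>

lemma weighted_average_vanishing:
  fixes W :: "nat \<Rightarrow> real"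
  assumes W: "\<And>n. 0 < W n" "decseq W" and b: "\<And>n. 0 \<le> b n" "b \<longlonglongrightarrow> 0" and \<epsilon>: "0 < \<epsilon>"
  obtains d where "d < 1"
    and "\<And>x S. d < x \<Longrightarrow> 0 < x \<Longrightarrow> x < 1 \<Longrightarrow> (\<lambda>n. x ^ (2 * n) / W n) sums S \<Longrightarrow>
      (\<Sum>n. x ^ (2 * n) / W n * b n) \<le> \<epsilon> * S"
proof -
  have "eventually (\<lambda>n. b n < \<epsilon> / 2) sequentially"
    using b(2) \<epsilon> by (intro order_tendstoD(2)) auto
  then obtain N where N: "\<And>n. N \<le> n \<Longrightarrow> b n \<le> \<epsilon> / 2"
    by (auto simp: eventually_sequentially intro: less_imp_le)
  have "Bseq b" using b(2) by (intro convergent_imp_Bseq convergentI)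
  then obtain B where B: "0 < B" "\<And>n. b n \<le> B"
    unfolding Bseq_def by (metis abs_ge_self order_trans real_norm_def)
  \<comment> \<open>With x^(2K) above 1/2, the block bound makes \<open>B\<close> times the initial
    sum at most \<open>2 * B * N * S / (K - N)\<close>; requiring this to be at most
    \<open>\<epsilon> / 2 * S\<close> yields the constant 4.\<close>
  obtain K0 :: nat where K0: "4 * B * real N / \<epsilon> \<le> real K0" using real_arch_simple by blast
  define K where "K = N + K0 + 1"
  have K: "N < K" by (simp add: K_def)
  have "((\<lambda>x::real. x ^ (2 * K)) \<longlongrightarrow> 1 ^ (2 * K)) (at_left 1)"
    by (intro tendsto_intros)
  then have "eventually (\<lambda>x::real. 1 / 2 < x ^ (2 * K)) (at_left 1)"
    by (intro order_tendstoD(1)) auto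
  then obtain d :: real where d: "d < 1" "\<And>x. d < x \<Longrightarrow> x < 1 \<Longrightarrow> 1 / 2 < x ^ (2 * K)"
    unfolding eventually_at_left_field by auto
  show ?thesis
  proof (rule that[OF d(1)])
    fix x S assume x: "d < x" "0 < x" "x < 1" and S: "(\<lambda>n. x ^ (2 * n) / W n) sums S"
    note pos = weighted_series_pos[OF W x(2,3) S]
    define T where "T = (\<Sum>n<N. x ^ (2 * n) / W n)"
    have T: "0 \<le> T" unfolding T_def using x W(1) by (intro sum_nonneg divide_nonneg_pos) auto
    have "1 / 2 * real (K - N) * T \<le> x ^ (2 * K) * real (K - N) * T"
      using d(2)[OF x(1,3)] T by (intro mult_right_mono) auto
    also have "\<dots> \<le> real N * S"
      unfolding T_def by (rule weighted_block_bound[OF W x(2,3) S K])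
    finally have "B * T * (real (K - N) / 2) \<le> B * (real N * S)"
      using B(1) by (simp add: field_simps)
    also have "\<dots> \<le> \<epsilon> * S * (real K0 / 4)"
      using K0 \<epsilon> pos B(1) by (simp add: field_simps)
    also have "\<dots> \<le> (\<epsilon> / 2 * S) * (real (K - N) / 2)"
      using \<epsilon> pos by (simp add: K_def field_simps)
    finally have BT: "B * T \<le> \<epsilon> / 2 * S"
      using K by simp
    have "(\<Sum>n. x ^ (2 * n) / W n * b n) \<le> B * T + \<epsilon> / 2 * S"
      unfolding T_def using B N by (intro weighted_split[OF W x(2,3) S] b) auto
    also have "\<dots> \<le> \<epsilon> * S" using BT by (simp add: algebra_simps)
    finally show "(\<Sum>n. x ^ (2 * n) / W n * b n) \<le> \<epsilon> * S" .
  qed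
qed

section \<open>The Berezin transform of the product near the boundary\<close>

context positive_radial_weight
begin

lemma mom_decseq: "decseq (\<lambda>n. mom (2 * n))"
proof (rule decseq_SucI)
  fix n
  show "mom (2 * Suc n) \<le> mom (2 * n)"
    unfolding moment_def
  proof (rule integral_mono)
    show "integrable \<mu> (\<lambda>z. 1 * cmod z ^ (2 * Suc n))" "integrable \<mu> (\<lambda>z. 1 * cmod z ^ (2 * n))"
      by (rule moment_integrable; simp)+
    fix z assume "z \<in> space \<mu>"
    then show "1 * cmod z ^ (2 * Suc n) \<le> 1 * cmod z ^ (2 * n)"
      by (simp add: power_decreasing del: power_Suc mult_Suc_right)
  qed
qed

lemma imom_nonneg: "0 \<le> imom A n"
  unfolding moment_def by (intro integral_nonneg_AE) simp

text \<open>The outer projection disappears because the kernel it is paired with lies in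
  \<open>a2\<close>. Each scale then contributes a diagonal series whose entries combine the weight
  |a|^(2n) a^(k j), the eigenvalue of the inner operator and the shift coefficient of the outer one.
  Multiplying by \<open>kernel_sq a\<close> clears the two normalizations.\<close>

lemma berezin_sums:
  fixes k :: "nat \<Rightarrow> nat"
  assumes U: "U \<in> sets borel" and A: "\<And>j. A j \<in> sets borel" and dis: "disjoint_family A" and a: "cmod a < 1"
  defines "u \<equiv> \<lambda>z. complex_of_real (indicator U (cmod z))"
  obtains t where "t sums berezin \<omega> (toeplitz \<omega> (multi_symbol A k) \<circ> toeplitz \<omega> u) a"
    and "\<And>j. (\<lambda>n. cnj a ^ n * a ^ (n + k j) / of_real (mom (2 * n)) *
        of_real (imom U (2 * n) / mom (2 * n) *
          (imom (A j) (2 * n + k j) / mom (2 * (n + k j))))) sums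
      (t j * of_real (kernel_sq a))"
proof -
  define \<nu> where "\<nu> = nrm (bergman_kernel \<omega> a)"
  have "0 < \<nu>\<^sup>2"
  proof -
    have "0 < (\<Sum>n. cmod a ^ (2 * n) / mom (2 * n))"
      using bergman_kernel_props(3)[OF a] mom_pos
      by (intro suminf_pos2[of _ 0]) (auto simp: sums_iff less_imp_le)
    then show ?thesis using bergman_kernel_props(3)[OF a] by (simp add: sums_iff \<nu>_def)
  qed
  then have \<nu>: "\<nu> \<noteq> 0" by auto
  define f where "f = normalized_kernel \<omega> a"
  have f: "f \<in> a2" "taylor f n = cnj a ^ n / of_real (mom (2 * n)) / of_real \<nu>" for n
    unfolding f_def normalized_kernel_def \<nu>_def
    using A2_divide[OF bergman_kernel_props(1)[OF a]] bergman_kernel_props(2)[OF a] by auto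
  define h where "h = toeplitz \<omega> u f"
  have ind: "indicator U \<in> borel_measurable borel" "\<bar>indicator U r :: real\<bar> \<le> 1" for r :: real
    using U by (simp_all add: indicator_def)
  note h = toeplitz_radial[OF ind f(1), folded u_def, folded h_def]
  note v = multi_symbol_props[OF A dis, where k = k]
  define t where "t j = inn (\<lambda>z. angular_symbol (indicator (A j)) (k j) z * h z) f" for j
  have "berezin \<omega> (toeplitz \<omega> (multi_symbol A k) \<circ> toeplitz \<omega> u) a =
    inn (bergman_proj \<omega> (\<lambda>z. multi_symbol A k z * h z)) f"
    by (simp add: berezin_def f_def h_def toeplitz_def)
  also have "\<dots> = inn (\<lambda>z. multi_symbol A k z * h z) f"
    by (intro bergman_proj_props(3) L2_mult_bounded v A2_D h f)
  finally have ber: "t sums berezin \<omega> (toeplitz \<omega> (multi_symbol A k) \<circ> toeplitz \<omega> u) a"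
    unfolding t_def using v(3)[OF A2_D(1)[OF h(1)] A2_D(1)[OF f(1)]] by simp
  have ts: "(\<lambda>n. cnj a ^ n * a ^ (n + k j) / of_real (mom (2 * n)) *
        of_real (imom U (2 * n) / mom (2 * n) *
          (imom (A j) (2 * n + k j) / mom (2 * (n + k j))))) sums
      (t j * of_real (kernel_sq a))" for j
  proof -
    have indA: "indicator (A j) \<in> borel_measurable borel" "\<bar>indicator (A j) r :: real\<bar> \<le> 1" for r :: real
      using A by (simp_all add: indicator_def)
    have "(\<lambda>n. taylor h n * cnj (taylor f (n + k j)) * of_real (imom (A j) (2 * n + k j))) sums t j"
      unfolding t_def by (intro inn_angular_symbol_sums indA A2_D h(1) f(1))
    from sums_mult2[OF this, of "of_real (\<nu>\<^sup>2)"]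
    show ?thesis
      unfolding h(2) f(2) \<nu>_def[symmetric]
      by (rule sums_cong[THEN iffD1, rotated])
         (use \<nu> in \<open>simp add: power2_eq_square field_simps\<close>)
  qed
  show ?thesis using ber ts by (rule that)
qed

text \<open>For one scale the contribution is at most |a|^(k j) times the average of
  \<open>b j\<close>. The averages tend to 0 since \<open>b j\<close> does, but not uniformly in the
  scale; uniformity comes from \<open>weighted_average_bound\<close>, which keeps the factor |a|^(k
  j) and supplies the summable majorant for Tannery's theorem.\<close>

lemma berezin_tendsto_0:
  fixes k N :: "nat \<Rightarrow> nat" and C :: real and e :: "nat \<Rightarrow> real"
  assumes U: "U \<in> sets borel" and A: "\<And>j. A j \<in> sets borel" and dis: "disjoint_family A"
  defines "u \<equiv> \<lambda>z. complex_of_real (indicator U (cmod z))"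
  defines "b \<equiv> \<lambda>j n. imom U (2 * n) / mom (2 * n) *
          (imom (A j) (2 * n + k j) / mom (2 * (n + k j)))"
  assumes N: "\<And>j. N j < k j" and C: "0 \<le> C"
    and b1: "\<And>j n. n < N j \<Longrightarrow> b j n \<le> C" and b2: "\<And>j n. N j \<le> n \<Longrightarrow> b j n \<le> e j"
    and sm: "summable (\<lambda>j. C * sqrt (real (N j) / real (k j - N j)) + e j)"
    and b3: "\<And>j. b j \<longlonglongrightarrow> 0"
  shows "((\<lambda>a. berezin \<omega> (toeplitz \<omega> (multi_symbol A k) \<circ> toeplitz \<omega> u) a) \<longlongrightarrow> 0)
    (filtercomap cmod (at_left 1))"
proof -
  let ?F = "filtercomap cmod (at_left 1)"
  let ?B = "berezin \<omega> (toeplitz \<omega> (multi_symbol A k) \<circ> toeplitz \<omega> u)"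
  define T where "T a j = (\<Sum>n. cmod a ^ (2 * n) / mom (2 * n) * b j n)" for a j
  define q where "q a j = cmod a ^ k j * T a j / kernel_sq a" for a j
  have b0: "0 \<le> b j n" for j n
    unfolding b_def by (intro mult_nonneg_nonneg divide_nonneg_nonneg imom_nonneg mom_nonneg)
  have bB: "\<exists>B. \<forall>n. b j n \<le> B" for j
    using convergent_imp_Bseq[OF convergentI[OF b3[of j]]] unfolding Bseq_def
    by (metis abs_ge_self order_trans real_norm_def)
  note W = mom_pos mom_decseq
  have "\<exists>t. t sums ?B a \<and> (\<forall>j. cmod (t j) \<le> q a j)" if a: "0 < cmod a" "cmod a < 1" for a
  proof -
    obtain t where t: "t sums ?B a"
      "\<And>j. (\<lambda>n. cnj a ^ n * a ^ (n + k j) / of_real (mom (2 * n)) * of_real (b j n)) sums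
      (t j * of_real (kernel_sq a))"
      using berezin_sums[OF U A dis a(2), where k = k] unfolding u_def b_def by blast
    note S = bergman_kernel_props(3)[OF a(2)]
    note pos = weighted_series_pos[OF W a S]
    have "cmod (t j) \<le> q a j" for j
    proof -
      obtain B where B: "\<And>n. b j n \<le> B" using bB by blast
      have sm: "summable (\<lambda>n. cmod a ^ k j * (cmod a ^ (2 * n) / mom (2 * n) * b j n))"
        by (intro summable_mult weighted_summable[OF W a S b0 B])
      have eq: "norm (cnj a ^ n * a ^ (n + k j) / of_real (mom (2 * n)) * of_real (b j n)) =
        cmod a ^ k j * (cmod a ^ (2 * n) / mom (2 * n) * b j n)" for n
        using b0[of j n] mom_pos[of "2 * n"]
        by (simp add: norm_mult norm_divide norm_power power_add mult_2)
      have "cmod (t j) * kernel_sq a = cmod (t j * of_real (kernel_sq a))"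
        by (simp add: norm_mult norm_power)
      also have "\<dots> = cmod (\<Sum>n. cnj a ^ n * a ^ (n + k j) / of_real (mom (2 * n)) * of_real (b j n))"
        using t(2)[of j] by (simp add: sums_iff)
      also have "\<dots> \<le> (\<Sum>n. norm (cnj a ^ n * a ^ (n + k j) / of_real (mom (2 * n)) * of_real (b j n)))"
        using sm unfolding eq[symmetric] by (rule summable_norm)
      also have "\<dots> = cmod a ^ k j * T a j"
        unfolding eq T_def by (rule suminf_mult[OF weighted_summable[OF W a S b0 B]])
      finally show ?thesis
        unfolding q_def using pos by (simp add: field_simps)
    qed
    with t(1) show ?thesis by blast
  qed
  then obtain t where t: "\<And>a. 0 < cmod a \<Longrightarrow> cmod a < 1 \<Longrightarrow> t a sums ?B a"
    "\<And>a j. 0 < cmod a \<Longrightarrow> cmod a < 1 \<Longrightarrow> cmod (t a j) \<le> q a j"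
    by metis
  have ev1: "eventually (\<lambda>a. d < cmod a \<and> cmod a < 1) ?F" if "d < 1" for d
    unfolding eventually_filtercomap using that eventually_at_left_real[OF that]
    by (intro exI[of _ "\<lambda>x. d < x \<and> x < 1"]) (auto elim!: eventually_mono)
  \<comment> \<open>Tannery's theorem is applied along a proper filter. The maximum with 0 makes the
    witness a modulus even if the bound \<open>b\<close> is negative.\<close>
  have ne: "?F \<noteq> bot"
  proof (rule filtercomap_neq_bot)
    fix P :: "real \<Rightarrow> bool" assume "eventually P (at_left 1)"
    then obtain b where b: "b < 1" "\<And>y. b < y \<Longrightarrow> y < 1 \<Longrightarrow> P y"
      unfolding eventually_at_left_field by auto
    have "P (cmod (of_real (max 0 ((b + 1) / 2))))"
      using b(1) by (intro b) (auto simp: max_def)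
    then show "\<exists>a. P (cmod a)" by blast
  qed
  have "((\<lambda>a. \<Sum>j. t a j) \<longlongrightarrow> (\<Sum>j. 0)) ?F"
  proof (rule tannerys_theorem[THEN conjunct2, THEN conjunct2, OF _ _ sm ne])
    fix j
    show "((\<lambda>a. t a j) \<longlongrightarrow> 0) ?F"
    proof (rule tendstoI)
      fix \<epsilon> :: real assume \<epsilon>: "0 < \<epsilon>"
      then have "0 < \<epsilon> / 2" by simp
      then obtain d where d: "d < 1" "\<And>x S. d < x \<Longrightarrow> 0 < x \<Longrightarrow> x < 1 \<Longrightarrow> (\<lambda>n. x ^ (2 * n) / mom (2 * n)) sums S \<Longrightarrow>
        (\<Sum>n. x ^ (2 * n) / mom (2 * n) * b j n) \<le> \<epsilon> / 2 * S"
        using weighted_average_vanishing[OF W b0 b3, of "\<epsilon> / 2" j] by blast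
      have "eventually (\<lambda>a. max 0 d < cmod a \<and> cmod a < 1) ?F" by (rule ev1) (use d in auto)
      then show "eventually (\<lambda>a. dist (t a j) 0 < \<epsilon>) ?F"
      proof eventually_elim
        case (elim a)
        then have a: "d < cmod a" "0 < cmod a" "cmod a < 1" by auto
        note S = bergman_kernel_props(3)[OF a(3)]
        note pos = weighted_series_pos[OF W a(2,3) S]
        obtain B where B: "\<And>n. b j n \<le> B" using bB by blast
        have s0: "0 \<le> T a j"
          unfolding T_def using b0 mom_nonneg
          by (intro suminf_nonneg weighted_summable[OF W a(2,3) S b0 B] mult_nonneg_nonneg divide_nonneg_nonneg) auto
        \<comment> \<open>For a fixed scale the power of \<open>cmod a\<close> is estimated by 1;
          the decay of \<open>b j\<close> alone gives the limit.\<close>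
        have "q a j \<le> 1 * T a j / kernel_sq a"
          unfolding q_def using a s0 by (intro divide_right_mono mult_right_mono power_le_one) auto
        also have "\<dots> \<le> \<epsilon> / 2"
          using d(2)[OF a S] pos by (simp add: T_def field_simps)
        finally show ?case using t(2)[OF a(2,3), of j] \<epsilon> by simp
      qed
    qed
  next
    have "eventually (\<lambda>a. 0 < cmod a \<and> cmod a < 1) ?F" by (rule ev1) simp
    then have "eventually (\<lambda>(j, a). True \<and> 0 < cmod a \<and> cmod a < 1) (at_top \<times>\<^sub>F ?F)"
      unfolding eventually_prod_filter
      by (intro exI[of _ "\<lambda>_. True"] exI[of _ "\<lambda>a. 0 < cmod a \<and> cmod a < 1"]) auto
    then show "eventually (\<lambda>(j, a). norm (t a j) \<le> C * sqrt (real (N j) / real (k j - N j)) + e j) (at_top \<times>\<^sub>F ?F)"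
    proof (rule eventually_mono, clarsimp)
      fix j a assume a: "a \<noteq> 0" "cmod a < 1"
      then have a': "0 < cmod a" by simp
      note S = bergman_kernel_props(3)[OF a(2)]
      note pos = weighted_series_pos[OF W a' a(2) S]
      have "cmod a ^ k j * T a j \<le>
        (C * sqrt (real (N j) / real (k j - N j)) + e j) * kernel_sq a"
        unfolding T_def by (intro weighted_average_bound[OF W a' a(2) S] b0 b1 b2 C N)
      then have "q a j \<le> C * sqrt (real (N j) / real (k j - N j)) + e j"
        unfolding q_def using pos by (simp add: field_simps)
      then show "cmod (t a j) \<le> C * sqrt (real (N j) / real (k j - N j)) + e j"
        using t(2)[OF a' a(2), of j] by simp
    qed
  qed
  then have "((\<lambda>a. \<Sum>j. t a j) \<longlongrightarrow> 0) ?F" by simp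
  moreover have "eventually (\<lambda>a. (\<Sum>j. t a j) = ?B a) ?F"
  proof -
    have "eventually (\<lambda>a. 0 < cmod a \<and> cmod a < 1) ?F" by (rule ev1) simp
    then show ?thesis by eventually_elim (use t(1) in \<open>auto simp: sums_iff\<close>)
  qed
  ultimately show ?thesis by (rule Lim_transform_eventually)
qed

end

section \<open>The logarithmic weight\<close>

context positive_radial_weight
begin

text \<open>Mass with respect to \<omega>(r) dr rather than area, so that tails have mass
  \<open>weight_hat\<close>. The factor \<open>2 * r\<close> of the area measure goes into the
  moments, whence the exponent \<open>n + 1\<close> in \<open>imom_eq\<close> and
  \<open>moment_lower\<close>.\<close>

definition mass :: "real set \<Rightarrow> real" where
  "mass B = (LINT r|lborel. weight0 r * indicator B r)"

lemma mass_integrable: "B \<in> sets borel \<Longrightarrow> integrable lborel (\<lambda>r. weight0 r * indicator B r)"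
  using integrable_mult_indicator[of B lborel weight0] weight0_integrable by (simp add: mult.commute)

lemma mass_nonneg: "0 \<le> mass B"
  unfolding mass_def by (intro integral_nonneg_AE AE_I2) (simp add: weight0_nonneg)

lemma mass_mono: "B \<in> sets borel \<Longrightarrow> B' \<in> sets borel \<Longrightarrow> B \<subseteq> B' \<Longrightarrow> mass B \<le> mass B'"
  unfolding mass_def using weight0_nonneg
  by (intro integral_mono mass_integrable) (auto simp: indicator_def)

lemma nn_integral_mass:
  "B \<in> sets borel \<Longrightarrow> (\<integral>\<^sup>+r. ennreal (weight0 r * indicator B r) \<partial>lborel) = ennreal (mass B)"
  unfolding mass_def by (intro nn_integral_eq_integral mass_integrable) (auto simp: weight0_nonneg)

lemma imom_eq:
  assumes B: "B \<in> sets borel"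
  shows "ennreal (imom B n) = (\<integral>\<^sup>+r. ennreal (2 * r ^ (n + 1) * (weight0 r * indicator B r)) \<partial>lborel)"
proof -
  have ind: "indicator B \<in> borel_measurable borel" "\<bar>indicator B r :: real\<bar> \<le> 1" for r :: real
    using B by (simp_all add: indicator_def)
  have [measurable]: "(indicator B :: real \<Rightarrow> real) \<in> borel_measurable borel" using B by simp
  have "ennreal (imom B n) = (\<integral>\<^sup>+z. ennreal (indicator B (cmod z) * cmod z ^ n) \<partial>\<mu>)"
    unfolding moment_def by (intro nn_integral_eq_integral[symmetric] moment_integrable ind) simp
  also have "\<dots> = (\<integral>\<^sup>+r. ennreal (2 * r * weight0 r) * ennreal (indicator B r * r ^ n) \<partial>lborel)"
    by (rule nn_integral_mu_radial) measurable
  also have "\<dots> = (\<integral>\<^sup>+r. ennreal (2 * r ^ (n + 1) * (weight0 r * indicator B r)) \<partial>lborel)"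
  proof (intro nn_integral_cong)
    fix r :: real
    show "ennreal (2 * r * weight0 r) * ennreal (indicator B r * r ^ n) = ennreal (2 * r ^ (n + 1) * (weight0 r * indicator B r))"
    proof (cases "0 \<le> r")
      case True
      then show ?thesis using weight0_nonneg[of r]
        by (subst ennreal_mult[symmetric]) (auto simp: mult_ac)
    qed (simp add: weight0_def)
  qed
  finally show ?thesis .
qed

lemma moment_upper:
  assumes B: "B \<in> sets borel" and c: "0 \<le> c" "B \<subseteq> {..c}"
  shows "imom B n \<le> 2 * c ^ n * mass B"
proof -
  have "ennreal (imom B n) \<le> (\<integral>\<^sup>+r. ennreal (2 * c ^ n) * ennreal (weight0 r * indicator B r) \<partial>lborel)"
    unfolding imom_eq[OF B]
  proof (intro nn_integral_mono)
    fix r :: real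
    show "ennreal (2 * r ^ (n + 1) * (weight0 r * indicator B r)) \<le> ennreal (2 * c ^ n) * ennreal (weight0 r * indicator B r)"
    proof (cases "0 \<le> r \<and> r < 1 \<and> r \<in> B")
      case True
      then have "r * r ^ n \<le> 1 * c ^ n" using c by (intro mult_mono power_mono) auto
      then have "2 * r ^ (n + 1) * (weight0 r * indicator B r) \<le> 2 * c ^ n * (weight0 r * indicator B r)"
        using weight0_nonneg[of r] by (intro mult_right_mono) auto
      then show ?thesis
        using weight0_nonneg[of r] c by (subst ennreal_mult[symmetric]) (auto intro: ennreal_leI)
    qed (auto simp: weight0_def indicator_def)
  qed
  also have "\<dots> = ennreal (2 * c ^ n) * ennreal (mass B)"
    unfolding nn_integral_mass[OF B, symmetric] using B by (intro nn_integral_cmult) simp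
  also have "\<dots> = ennreal (2 * c ^ n * mass B)"
    using c mass_nonneg by (intro ennreal_mult[symmetric]) auto
  finally show ?thesis
    using c mass_nonneg by (subst (asm) ennreal_le_iff) auto
qed

lemma moment_upper':
  assumes B: "B \<in> sets borel"
  shows "imom B n \<le> 2 * mass B"
proof -
  have "imom B n = imom (B \<inter> {..1}) n"
    unfolding moment_def by (intro Bochner_Integration.integral_cong) (auto simp: indicator_def)
  also have "\<dots> \<le> 2 * 1 ^ n * mass (B \<inter> {..1})"
    using B by (intro moment_upper) auto
  also have "\<dots> \<le> 2 * mass B"
    using mass_mono[of "B \<inter> {..1}" B] B by simp
  finally show ?thesis .
qed

lemma moment_lower:
  assumes B: "B \<in> sets borel" and c: "0 \<le> c" "B \<subseteq> {c..}"
  shows "2 * c ^ (n + 1) * mass B \<le> imom B n"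
proof -
  have "ennreal (2 * c ^ (n + 1) * mass B) = ennreal (2 * c ^ (n + 1)) * ennreal (mass B)"
    using c mass_nonneg by (intro ennreal_mult) auto
  also have "\<dots> = (\<integral>\<^sup>+r. ennreal (2 * c ^ (n + 1)) * ennreal (weight0 r * indicator B r) \<partial>lborel)"
    unfolding nn_integral_mass[OF B, symmetric] using B by (intro nn_integral_cmult[symmetric]) simp
  also have "\<dots> \<le> ennreal (imom B n)"
    unfolding imom_eq[OF B]
  proof (intro nn_integral_mono)
    fix r :: real
    show "ennreal (2 * c ^ (n + 1)) * ennreal (weight0 r * indicator B r) \<le> ennreal (2 * r ^ (n + 1) * (weight0 r * indicator B r))"
    proof (cases "r \<in> B")
      case True
      then have "c ^ (n + 1) \<le> r ^ (n + 1)" using c by (intro power_mono) auto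
      then have "2 * c ^ (n + 1) * (weight0 r * indicator B r) \<le> 2 * r ^ (n + 1) * (weight0 r * indicator B r)"
        using weight0_nonneg[of r] by (intro mult_right_mono) auto
      then show ?thesis
        using weight0_nonneg[of r] c by (subst ennreal_mult[symmetric]) (auto intro: ennreal_leI)
    qed simp
  qed
  finally show ?thesis
    using imom_nonneg by (subst (asm) ennreal_le_iff) auto
qed

lemma imom_mono:
  assumes "B \<in> sets borel" "B' \<in> sets borel" "B \<inter> {0..<1} \<subseteq> B'"
  shows "imom B n \<le> imom (B') n"
  unfolding moment_def
proof (rule integral_mono)
  show "integrable \<mu> (\<lambda>z. indicator B (cmod z) * cmod z ^ n)" "integrable \<mu> (\<lambda>z. indicator B' (cmod z) * cmod z ^ n)"
    using assms by (auto intro!: moment_integrable simp: indicator_def)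
  show "indicator B (cmod z) * cmod z ^ n \<le> indicator B' (cmod z) * cmod z ^ n" if "z \<in> space \<mu>" for z
    using assms(3) that by (auto simp: indicator_def)
qed

lemma imom_Un:
  assumes "B \<in> sets borel" "B' \<in> sets borel"
  shows "imom (B \<union> B') n \<le> imom B n + imom (B') n"
proof -
  have i: "integrable \<mu> (\<lambda>z. indicator X (cmod z) * cmod z ^ n)" if "X \<in> sets borel" for X
    using that by (auto intro!: moment_integrable simp: indicator_def)
  have "imom (B \<union> B') n \<le> (LINT z|\<mu>. indicator B (cmod z) * cmod z ^ n + indicator B' (cmod z) * cmod z ^ n)"
    unfolding moment_def using assms
    by (intro integral_mono i Bochner_Integration.integrable_add) (auto simp: indicator_def)
  also have "\<dots> = imom B n + imom (B') n"
    unfolding moment_def using assms by (intro Bochner_Integration.integral_add i)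
  finally show ?thesis .
qed

lemma mom_eq_indicator: "mom n = imom UNIV n"
  by (simp add: moment_def)

end

section \<open>Tail mass, doubling and log-convexity of the concrete weight\<close>

locale log_weight =
  fixes \<omega> :: "real \<Rightarrow> real"
  assumes flat: "0 \<le> r \<Longrightarrow> r \<le> 1 - exp (-1) \<Longrightarrow> \<omega> r = exp 1 / 4"
    and tail: "1 - exp (-1) < r \<Longrightarrow> r < 1 \<Longrightarrow> \<omega> r = 1 / ((1 - r) * (ln (exp 1 / (1 - r)))\<^sup>2)"
begin

definition r0 :: real where "r0 = 1 - exp (-1)"

text \<open>With t = 1 - ln(1 - r), which is ln(e / (1 - r)), one has dt = dr / (1 - r), so
  \<open>dens\<close> is the density dt / t^2. The junction \<open>r0\<close> corresponds to t =
  2.\<close>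

definition dens :: "real \<Rightarrow> real" where
  "dens r = 1 / ((1 - r) * (1 - ln (1 - r))\<^sup>2)"

lemma r0: "0 < r0" "r0 < 1" "ln (1 - r0) = -1"
  by (simp_all add: r0_def)

lemma log_pos:
  fixes r :: real
  assumes "0 \<le> r" "r < 1"
  shows "1 \<le> 1 - ln (1 - r)" "ln (1 - r) < 1" "0 < 1 - ln (1 - r)"
  using ln_le_minus_one[of "1 - r"] assms by simp_all

lemma log_pos_r0:
  assumes "r0 \<le> r" "r < 1"
  shows "2 \<le> 1 - ln (1 - r)"
proof -
  have "ln (1 - r) \<le> ln (1 - r0)" using assms r0(2) by (subst ln_le_cancel_iff) auto
  then show ?thesis by (simp add: r0(3))
qed

lemma log_DERIV: "r < 1 \<Longrightarrow> DERIV (\<lambda>r::real. 1 - ln (1 - r)) r :> 1 / (1 - r)"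
  by (auto intro!: derivative_eq_intros)

text \<open>The derivative of \<open>ln dens\<close> changes sign exactly at t = 2, that is at
  \<open>r0\<close>. So \<open>dens\<close> attains its minimum e/4 there, which explains both
  constants in the weight: the flat part continues the minimum inwards.\<close>

lemma log_dens_DERIV:
  fixes r :: real
  assumes "0 \<le> r" "r < 1"
  shows "DERIV (\<lambda>r. - ln (1 - r) - 2 * ln (1 - ln (1 - r))) r :> (1 - 2 / (1 - ln (1 - r))) / (1 - r)"
proof -
  have alg: "1 / y - 2 * (1 / T * (1 / y)) = (1 - 2 / T) / y" if "y \<noteq> 0" "T \<noteq> 0" for y T :: real
    using that by (simp add: field_simps)
  note p = log_pos[OF assms]
  have "DERIV (\<lambda>r. (1 - ln (1 - r)) - 1 - 2 * ln (1 - ln (1 - r))) r :>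
    1 / (1 - r) - 0 - 2 * (1 / (1 - ln (1 - r)) * (1 / (1 - r)))"
    by (intro DERIV_diff DERIV_const log_DERIV assms DERIV_cmult
        DERIV_chain2[OF DERIV_ln_divide[OF p(3)] log_DERIV[OF assms(2)]])
  then show ?thesis
    using alg[of "1 - r" "1 - ln (1 - r)"] assms p by simp
qed

lemma dens_r0: "dens r0 = exp 1 / 4"
  by (simp add: dens_def r0(3)) (simp add: r0_def exp_minus field_simps)

lemma weight_eq: "0 \<le> r \<Longrightarrow> r < 1 \<Longrightarrow> \<omega> r = dens (max r r0)"
proof (cases "r \<le> r0")
  case True
  assume "0 \<le> r"
  with True show ?thesis using flat[of r, folded r0_def] dens_r0 by (simp add: max_def)
next
  case False
  assume "r < 1"
  with False show ?thesis
    using tail[of r] by (simp add: r0_def[symmetric] dens_def max_def ln_div)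
qed

lemma dens_pos: "0 \<le> r \<Longrightarrow> r < 1 \<Longrightarrow> 0 < dens r"
  using log_pos(3)[of r] unfolding dens_def by (intro divide_pos_pos mult_pos_pos zero_less_power) auto

lemma weight_pos: "0 \<le> r \<Longrightarrow> r < 1 \<Longrightarrow> 0 < \<omega> r"
  using r0 by (simp add: weight_eq dens_pos)

text \<open>The antiderivative is -1/t, with limit 0 at the boundary. The fundamental theorem for
  nonnegative integrands provides integrability up to the singular endpoint together with the
  value.\<close>

lemma dens_integral:
  assumes a: "0 \<le> a" "a < 1"
  shows "set_integrable lborel {a<..<1} dens" "(LINT r:{a<..<1}|lborel. dens r) = 1 / (1 - ln (1 - a))"
proof -
  let ?F = "\<lambda>r::real. - (1 / (1 - ln (1 - r)))"
  have F: "DERIV ?F x :> dens x" if "a < x" "x < 1" for x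
  proof -
    have x: "0 \<le> x" "x < 1" using a that by auto
    have alg: "- ((0 * T - 1 * (1 / y)) / (T * T)) = 1 / (y * T\<^sup>2)" if "y \<noteq> 0" "T \<noteq> 0" for y T :: real
      using that by (simp add: field_simps power2_eq_square)
    show ?thesis
      unfolding dens_def using log_pos[OF x] x alg[of "1 - x" "1 - ln (1 - x)"]
        DERIV_minus[OF DERIV_divide[OF DERIV_const log_DERIV[OF x(2)], of 1]] by simp
  qed
  have c: "isCont dens x" if "a < x" "x < 1" for x
    using log_pos[of x] a that unfolding dens_def by (intro continuous_intros) auto
  have A: "((?F \<circ> real_of_ereal) \<longlongrightarrow> ?F a) (at_right (ereal a))"
  proof -
    have "isCont ?F a" using log_pos[OF a] a by (intro continuous_intros) auto
    then have "(?F \<longlongrightarrow> ?F a) (at_right a)"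
      by (simp add: isCont_def filterlim_at_split)
    then show ?thesis by (simp add: ereal_tendsto_simps)
  qed
  have B: "((?F \<circ> real_of_ereal) \<longlongrightarrow> 0) (at_left (ereal 1))"
  proof -
    have "(?F \<longlongrightarrow> 0) (at_left 1)" by real_asymp
    then show ?thesis by (simp only: ereal_tendsto_simps)
  qed
  have nn: "AE x in lborel. ereal a < ereal x \<longrightarrow> ereal x < ereal 1 \<longrightarrow> 0 \<le> dens x"
    using a by (intro AE_I2) (auto intro!: less_imp_le dens_pos)
  have "set_integrable lborel (einterval (ereal a) (ereal 1)) dens"
    "(LBINT x=ereal a..ereal 1. dens x) = 0 - ?F a"
    by (rule interval_integral_FTC_nonneg[of "ereal a" "ereal 1" ?F dens, OF _ _ _ nn A B];
      use a F c in auto)+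
  then show "set_integrable lborel {a<..<1} dens" "(LINT r:{a<..<1}|lborel. dens r) = 1 / (1 - ln (1 - a))"
    using a by (simp_all add: interval_lebesgue_integral_def)
qed

lemma weight_tail_integral:
  assumes a: "r0 \<le> a" "a < 1"
  shows "set_integrable lborel {a..<1} \<omega>" "weight_hat \<omega> a = 1 / (1 - ln (1 - a))"
proof -
  have a0: "0 \<le> a" using a r0 by linarith
  have eq: "indicator {a..<1} r *\<^sub>R \<omega> r = (if r = a then \<omega> a else indicator {a<..<1} r *\<^sub>R dens r)" for r
    using weight_eq[of r] a a0 by (auto simp: indicator_def max_def)
  have ae: "AE r in lborel. indicator {a<..<1} r *\<^sub>R dens r = indicator {a..<1} r *\<^sub>R \<omega> r"
    using AE_lborel_singleton[of a]
  proof eventually_elim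
    case (elim r)
    then show ?case using eq[of r] by simp
  qed
  have m: "(\<lambda>r. indicator {a<..<1} r *\<^sub>R dens r) \<in> borel_measurable lborel"
    using borel_measurable_integrable[OF dens_integral(1)[OF a0 a(2), unfolded set_integrable_def]] .
  have m': "(\<lambda>r. indicator {a..<1} r *\<^sub>R \<omega> r) \<in> borel_measurable lborel"
    unfolding eq by (intro measurable_If m) auto
  show "set_integrable lborel {a..<1} \<omega>"
    unfolding set_integrable_def
    using dens_integral(1)[OF a0 a(2), unfolded set_integrable_def]
    by (rule integrable_cong_AE_imp[OF _ m']) (use ae in \<open>auto elim: eventually_mono\<close>)
  show "weight_hat \<omega> a = 1 / (1 - ln (1 - a))"
    unfolding weight_hat_def dens_integral(2)[OF a0 a(2), symmetric] set_lebesgue_integral_def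
    by (rule integral_cong_AE[OF m' m]) (use ae in \<open>auto elim: eventually_mono\<close>)
qed

lemma flat_integral: "set_integrable lborel {0..<r0} \<omega>" "(LINT r:{0..<r0}|lborel. \<omega> r) \<le> 1 / 2"
proof -
  have eq: "indicator {0..<r0} r *\<^sub>R \<omega> r = indicator {0..<r0} r *\<^sub>R (exp 1 / 4)" for r
    using weight_eq[of r] r0 by (auto simp: indicator_def max_def dens_r0)
  show "set_integrable lborel {0..<r0} \<omega>"
    unfolding set_integrable_def eq using r0 by simp
  have "(LINT r:{0..<r0}|lborel. \<omega> r) = r0 * (exp 1 / 4)"
    unfolding set_lebesgue_integral_def eq using r0 by simp
  also have "\<dots> = (exp 1 - 1) / 4"
    by (simp add: r0_def exp_minus field_simps)
  also have "\<dots> \<le> 1 / 2" using exp_le by simp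
  finally show "(LINT r:{0..<r0}|lborel. \<omega> r) \<le> 1 / 2" .
qed

lemma split0: "{0..<1} = {0..<r0} \<union> {r0..<1}"
  using r0 by auto

lemma radial: "radial_weight \<omega>"
  unfolding radial_weight_def split0
  using weight_pos flat_integral(1) weight_tail_integral(1)[of r0] r0
  by (auto intro!: set_integrable_Un intro: less_imp_le)

sublocale positive_radial_weight \<omega>
  by unfold_locales (auto intro: radial weight_pos)

lemma weight_hat_eq_mass: "0 \<le> r \<Longrightarrow> weight_hat \<omega> r = mass {r..<1}"
  unfolding weight_hat_def mass_def set_lebesgue_integral_def
  by (intro Bochner_Integration.integral_cong refl) (auto simp: weight0_def indicator_def)

lemma mass_tail: "r0 \<le> a \<Longrightarrow> a < 1 \<Longrightarrow> mass {a..<1} = 1 / (1 - ln (1 - a))"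
  using weight_tail_integral(2)[of a] weight_hat_eq_mass[of a] r0 by simp

lemma mass_UNIV: "mass UNIV \<le> 1"
proof -
  have "mass UNIV = weight_hat \<omega> 0"
    unfolding weight_hat_def mass_def set_lebesgue_integral_def
    by (intro Bochner_Integration.integral_cong refl) (auto simp: weight0_def indicator_def)
  also have "\<dots> = (LINT r:{0..<r0}|lborel. \<omega> r) + weight_hat \<omega> r0"
    unfolding weight_hat_def split0
    using flat_integral(1) weight_tail_integral(1)[of r0] r0 by (intro set_integral_Un) auto
  also have "weight_hat \<omega> r0 = 1 / 2"
    using weight_tail_integral(2)[of r0] r0 by simp
  finally show ?thesis using flat_integral(2) by simp
qed

text \<open>Halving the distance to 1 only adds ln 2 to \<open>t\<close>, and the tail is 1/t.
  Beyond \<open>r0\<close> the constant 3 is generous; for smaller \<open>r\<close> the total mass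
  is at most 1, whereas the tail from \<open>(1 + r0) / 2\<close> already has mass 1 / (2 + ln 2),
  at least 1/3.\<close>

lemma in_D_hat: "\<omega> \<in> D_hat"
  unfolding D_hat_def
proof (intro CollectI conjI radial exI[of _ 3] allI impI)
  fix r :: real assume r: "0 \<le> r \<and> r < 1"
  define m where "m = (1 + r) / 2"
  have m: "0 \<le> m" "m < 1" "r \<le> m" "1 - m = (1 - r) / 2" using r by (auto simp: m_def field_simps)
  have ln2: "ln 2 \<le> (1::real)" using ln_le_minus_one[of 2] by simp
  have hm: "weight_hat \<omega> r = mass {r..<1}" "weight_hat \<omega> m = mass {m..<1}"
    using r m by (auto intro: weight_hat_eq_mass)
  show "weight_hat \<omega> r \<le> 3 * weight_hat \<omega> ((1 + r) / 2)"
  proof (cases "r0 \<le> r")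
    case True
    define t where "t = 1 - ln (1 - r)"
    have t: "2 \<le> t" unfolding t_def using True r by (intro log_pos_r0) auto
    have "ln (1 - m) = ln (1 - r) - ln 2" unfolding m(4) using r by (simp add: ln_div)
    then have "mass {m..<1} = 1 / (t + ln 2)" using mass_tail[of m] True m by (simp add: t_def)
    moreover have "mass {r..<1} = 1 / t" using mass_tail[of r] True r by (simp add: t_def)
    moreover have "1 / t \<le> 3 / (t + ln 2)"
    proof -
      have "0 < t" "0 < t + ln 2" using t by (simp_all add: add_pos_pos)
      then have "(t + ln 2) / (t * (t + ln 2)) \<le> (3 * t) / (t * (t + ln 2))"
        using t ln2 by (intro divide_right_mono) auto
      then show ?thesis using \<open>0 < t\<close> \<open>0 < t + ln 2\<close> by simp
    qed
    ultimately show ?thesis by (simp add: hm m_def[symmetric])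
  next
    case False
    define m0 where "m0 = (1 + r0) / 2"
    have m0: "r0 \<le> m0" "m0 < 1" "m \<le> m0" "1 - m0 = (1 - r0) / 2" using False r0 by (auto simp: m0_def m_def field_simps)
    have "ln (1 - m0) = - 1 - ln 2" unfolding m0(4) using r0 by (simp add: ln_div)
    then have "mass {m0..<1} = 1 / (2 + ln 2)"
      using mass_tail[OF m0(1,2)] by simp
    moreover have "1 / 3 \<le> 1 / (2 + ln 2 :: real)"
      using ln2 by (intro frac_le) (auto intro: add_pos_pos)
    ultimately have "1 / 3 \<le> mass {m0..<1}" by simp
    also have "\<dots> \<le> mass {m..<1}" using m0 by (intro mass_mono) auto
    finally have 1: "1 / 3 \<le> mass {m..<1}" .
    have "mass {r..<1} \<le> 1" using mass_mono[of "{r..<1}" UNIV] mass_UNIV by simp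
    with 1 show ?thesis by (simp add: hm m_def[symmetric])
  qed
qed simp

lemma log_dens_convex: "convex_on {r0..<1} (\<lambda>r. - ln (1 - r) - 2 * ln (1 - ln (1 - r)))"
proof (rule f''_ge0_imp_convex)
  let ?f' = "\<lambda>r. (1 - 2 / (1 - ln (1 - r))) / (1 - r)"
  let ?f'' = "\<lambda>r. ((1 - 2 / (1 - ln (1 - r))) + 2 / (1 - ln (1 - r))\<^sup>2) / (1 - r)\<^sup>2"
  fix x assume "x \<in> {r0..<1}"
  then have x: "r0 \<le> x" "0 \<le> x" "x < 1" using r0 by auto
  note p = log_pos[OF x(2,3)]
  show "DERIV (\<lambda>r. - ln (1 - r) - 2 * ln (1 - ln (1 - r))) x :> ?f' x"
    by (rule log_dens_DERIV[OF x(2,3)])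
  have alg: "((0 - (0 * T - 2 * (1 / y)) / (T * T)) * y - (1 - 2 / T) * (0 - 1)) / (y * y) =
    ((1 - 2 / T) + 2 / T\<^sup>2) / y\<^sup>2" if "y \<noteq> 0" "T \<noteq> 0" for y T :: real
    using that by (simp add: field_simps power2_eq_square)
  have y0: "1 - x \<noteq> 0" "1 - ln (1 - x) \<noteq> 0" using x p by auto
  have "DERIV ?f' x :> ((0 - (0 * (1 - ln (1 - x)) - 2 * (1 / (1 - x))) / ((1 - ln (1 - x)) * (1 - ln (1 - x)))) * (1 - x)
    - (1 - 2 / (1 - ln (1 - x))) * (0 - 1)) / ((1 - x) * (1 - x))"
    by (intro DERIV_divide DERIV_diff DERIV_const DERIV_ident log_DERIV x y0)
  then show "DERIV ?f' x :> ?f'' x" unfolding alg[OF y0] .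
  show "0 \<le> ?f'' x"
    using log_pos_r0[OF x(1,3)] by (intro divide_nonneg_nonneg add_nonneg_nonneg) auto
qed (rule convex_real_interval)

lemma log_dens_mono:
  assumes "r0 \<le> a" "a \<le> b" "b < 1"
  shows "- ln (1 - a) - 2 * ln (1 - ln (1 - a)) \<le> - ln (1 - b) - 2 * ln (1 - ln (1 - b))"
proof (rule DERIV_nonneg_imp_nondecreasing[OF assms(2)])
  fix x assume "a \<le> x" "x \<le> b"
  then have x: "r0 \<le> x" "0 \<le> x" "x < 1" using r0 assms by auto
  have "0 \<le> (1 - 2 / (1 - ln (1 - x))) / (1 - x)"
    using log_pos_r0[OF x(1,3)] x by (intro divide_nonneg_nonneg) auto
  then show "\<exists>y. DERIV (\<lambda>r. - ln (1 - r) - 2 * ln (1 - ln (1 - r))) x :> y \<and> 0 \<le> y"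
    using log_dens_DERIV[OF x(2,3)] by blast
qed

text \<open>Besides convexity of the profile its monotonicity is essential, since the modulus of a
  convex combination is only bounded by the combination of the moduli. The maximum with
  \<open>r0\<close> preserves this bound and keeps the argument where both properties hold.\<close>

lemma log_weight_convex: "convex_on (ball 0 1) (\<lambda>z. ln (\<omega> (cmod z)))"
proof -
  define P where "P r = - ln (1 - r) - 2 * ln (1 - ln (1 - r))" for r :: real
  have eq: "ln (\<omega> (cmod z)) = P (max (cmod z) r0)" if "cmod z < 1" for z
  proof -
    have m: "0 \<le> max (cmod z) r0" "max (cmod z) r0 < 1" using that r0 by auto
    show ?thesis
      using log_pos[OF m] m that by (simp add: weight_eq dens_def P_def ln_div ln_mult ln_realpow)
  qed
  show ?thesis
  proof (intro convex_onI)
    fix t :: real and x y :: complex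
    assume t: "0 < t" "t < 1" and xy: "x \<in> ball 0 1" "y \<in> ball 0 1"
    define X Y where "X = max (cmod x) r0" and "Y = max (cmod y) r0"
    have XY: "X \<in> {r0..<1}" "Y \<in> {r0..<1}" using xy r0 by (auto simp: X_def Y_def)
    define w where "w = (1 - t) *\<^sub>R x + t *\<^sub>R y"
    have "cmod w \<le> (1 - t) * cmod x + t * cmod y"
      unfolding w_def by (rule order_trans[OF norm_triangle_ineq]) (use t in simp)
    also have "\<dots> \<le> (1 - t) * X + t * Y"
      using t by (intro add_mono mult_left_mono) (auto simp: X_def Y_def)
    finally have 1: "cmod w \<le> (1 - t) * X + t * Y" .
    have "(1 - t) * r0 + t * r0 \<le> (1 - t) * X + t * Y"
      using t by (intro add_mono mult_left_mono) (auto simp: X_def Y_def)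
    then have 2: "r0 \<le> (1 - t) * X + t * Y" by (simp add: algebra_simps)
    have 3: "(1 - t) * X + t * Y < 1"
      using convexD[OF convex_real_interval(7)[of r0 1] XY, of "1 - t" t] t by simp
    have wb: "cmod w < 1" using 1 3 by linarith
    have "ln (\<omega> (cmod w)) = P (max (cmod w) r0)" by (rule eq[OF wb])
    also have "\<dots> \<le> P ((1 - t) * X + t * Y)"
      unfolding P_def using 1 2 3 by (intro log_dens_mono) auto
    also have "\<dots> \<le> (1 - t) * P X + t * P Y"
      using convex_onD[OF log_dens_convex, of t X Y] t XY by (simp add: P_def)
    finally show "ln (\<omega> (cmod ((1 - t) *\<^sub>R x + t *\<^sub>R y))) \<le> (1 - t) * ln (\<omega> (cmod x)) + t * ln (\<omega> (cmod y))"
      using xy by (simp add: w_def[symmetric] eq X_def Y_def)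
  qed simp
qed

lemma log_subharmonic_weight: "log_subharmonic \<omega>"
  unfolding log_subharmonic_def
  using weight_pos convex_imp_distr_subharmonic[OF log_weight_convex] by (auto intro!: AE_I2)

end

section \<open>Noncompactness from normalized monomials\<close>

context positive_radial_weight
begin

text \<open>The normalized monomial of degree \<open>n j\<close> is tested against degree
  \<open>n j + k j\<close>. In \<open>lower\<close> the two square roots are the norms of the two
  monomials, so \<open>c\<close> bounds a matrix entry from below in an orthonormal basis.\<close>

lemma not_compact_shift:
  fixes k n :: "nat \<Rightarrow> nat"
  assumes U: "U \<in> sets borel" and A: "\<And>j. A j \<in> sets borel" and dis: "disjoint_family A"
  defines "u \<equiv> \<lambda>z. complex_of_real (indicator U (cmod z))"
  assumes lim: "filterlim (\<lambda>j. n j + k j) at_top sequentially" and c: "0 < c"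
    and lower: "\<And>j. c * (sqrt (mom (2 * n j)) * sqrt (mom (2 * (n j + k j)))) \<le>
      imom U (2 * n j) / mom (2 * n j) * imom (A j) (2 * n j + k j)"
  shows "\<not> compact_operator_A2 \<omega> (toeplitz \<omega> (multi_symbol A k) \<circ> toeplitz \<omega> u)"
proof (rule not_compact_operator_A2I[where f = "\<lambda>j z. monom_disk (n j) z / of_real (sqrt (mom (2 * n j)))", OF _ _ _ lim c])
  fix j
  let ?f = "\<lambda>z. monom_disk (n j) z / of_real (sqrt (mom (2 * n j)))"
  let ?S = "toeplitz \<omega> (multi_symbol A k) \<circ> toeplitz \<omega> u"
  have sq: "0 < sqrt (mom (2 * n j))" using mom_pos by simp
  have tc: "taylor (monom_disk (n j)) = (\<lambda>m. if m = n j then 1 else 0)"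
    unfolding monom_disk_def by (intro power_series_disk_A2(2) summable_finite[of "{n j}"]) auto
  show f: "?f \<in> a2"
    by (rule A2_divide(1)[OF monom_disk_A2])
  have "nrm ?f = nrm (\<lambda>z. inverse (of_real (sqrt (mom (2 * n j)))) * z ^ n j)"
    by (rule nrm_cong) (simp add: monom_disk_eq divide_inverse)
  also have "\<dots> = inverse (sqrt (mom (2 * n j))) * sqrt (mom (2 * n j))"
    using sq by (simp add: L2_cmult(2)[OF monom_L2] nrm_monom norm_inverse)
  also have "\<dots> = 1" using sq by simp
  finally show "nrm ?f \<le> 1"
    by simp
  define h where "h = toeplitz \<omega> u ?f"
  have ind: "indicator U \<in> borel_measurable borel" "\<bar>indicator U r :: real\<bar> \<le> 1" for r :: real
    using U by (simp_all add: indicator_def)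
  note h = toeplitz_radial[OF ind f, folded u_def, folded h_def]
  note v = multi_symbol_props[OF A dis, where k = k]
  have vh: "(\<lambda>z. multi_symbol A k z * h z) \<in> l2"
    by (intro L2_mult_bounded v A2_D h)
  define g where "g = bergman_proj \<omega> (\<lambda>z. multi_symbol A k z * h z)"
  have Sf: "?S ?f = g"
    by (simp add: g_def h_def toeplitz_def)
  have g: "g \<in> a2" "taylor g l = inn (\<lambda>z. multi_symbol A k z * h z) (zpow l) / of_real (mom (2 * l))" for l
    unfolding g_def by (rule bergman_proj_props[OF vh])+
  show "?S ?f \<in> a2"
    unfolding Sf by (rule g(1))
  define m where "m = n j + k j"
  define l where "l = imom U (2 * n j) / mom (2 * n j) / sqrt (mom (2 * n j))"
  have l0: "0 \<le> l"
    unfolding l_def by (intro divide_nonneg_nonneg imom_nonneg mom_nonneg real_sqrt_ge_zero)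
  have hc: "taylor h i = (if i = n j then of_real l else 0)" for i
    using sq by (simp add: h(2) A2_divide(2)[OF monom_disk_A2] tc l_def)
  \<comment> \<open>Other scales could also reach degree \<open>m\<close>, but every contribution is
    nonnegative, so nothing cancels and scale \<open>j\<close> alone gives the lower bound.\<close>
  define x where "x i = (if n j + k i = m then l * imom (A i) (2 * n j + k i) else 0)" for i
  have x0: "0 \<le> x i" for i
    unfolding x_def using l0 imom_nonneg by auto
  have vi: "inn (\<lambda>z. angular_symbol (indicator (A i)) (k i) z * h z) (zpow m) = of_real (x i)" for i
  proof -
    have indA: "indicator (A i) \<in> borel_measurable borel" "\<bar>indicator (A i) r :: real\<bar> \<le> 1" for r :: real
      using A by (simp_all add: indicator_def)
    have "(\<lambda>q. taylor h q * cnj (taylor (zpow m) (q + k i)) * of_real (imom (A i) (2 * q + k i)))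
      sums inn (\<lambda>z. angular_symbol (indicator (A i)) (k i) z * h z) (zpow m)"
      by (intro inn_angular_symbol_sums indA A2_D(1,2) h(1) monom_L2 holomorphic_intros)
    moreover have "taylor h q * cnj (taylor (zpow m) (q + k i)) * of_real (imom (A i) (2 * q + k i))
      = (if q = n j then of_real (x i) else 0)" for q
      by (simp add: hc monom_taylor x_def)
    ultimately show ?thesis
      using sums_single[of "n j" "\<lambda>_. complex_of_real (x i)"] by (auto intro: sums_unique2)
  qed
  have "(\<lambda>i. complex_of_real (x i)) sums inn (\<lambda>z. multi_symbol A k z * h z) (zpow m)"
    using v(3)[OF A2_D(1)[OF h(1)] monom_L2[of m]] by (simp add: vi)
  then have xs: "summable x" and eq: "inn (\<lambda>z. multi_symbol A k z * h z) (zpow m) = of_real (suminf x)"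
    by (auto simp: sums_iff summable_of_real_iff suminf_of_real)
  have "c * sqrt (mom (2 * m)) \<le> x j"
  proof -
    have "c * sqrt (mom (2 * m)) * sqrt (mom (2 * n j)) \<le> imom U (2 * n j) / mom (2 * n j) * imom (A j) (2 * n j + k j)"
      using lower[of j] by (simp add: m_def mult_ac)
    then show ?thesis using sq by (simp add: x_def m_def l_def field_simps)
  qed
  also have "x j \<le> suminf x"
    using sum_le_suminf[OF xs, of "{j}"] x0 by simp
  also have "\<dots> = cmod (inn g (zpow m))"
  proof -
    have "inn g (zpow m) = of_real (suminf x)"
      using mom_pos[of "2 * m"] by (simp add: inn_monom_right[OF A2_D(2,1)[OF g(1)]] g(2) eq)
    then show ?thesis using suminf_nonneg[OF xs x0] by simp
  qed
  finally show "c * sqrt (mom (2 * (n j + k j))) \<le> cmod (inn ((?S)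
    ?f) (zpow (n j + k j)))"
    unfolding Sf by (simp add: m_def)
qed

end

section \<open>Moments in the coordinate \<open>t\<close>\<close>

context log_weight
begin

text \<open>The inverse of the coordinate t = 1 - ln(1 - r), with \<open>rad 2 = r0\<close>; hence
  the recurring hypothesis \<open>2 \<le> t\<close>.\<close>

definition rad :: "real \<Rightarrow> real" where "rad t = 1 - exp (1 - t)"

lemma rad:
  assumes "2 \<le> t"
  shows "r0 \<le> rad t" "rad t < 1" "0 < rad t" "1 - ln (1 - rad t) = t"
proof -
  show "r0 \<le> rad t" using assms by (simp add: rad_def r0_def)
  then show "0 < rad t" using r0(1) by linarith
qed (simp_all add: rad_def)

lemma rad_mono: "s \<le> t \<Longrightarrow> rad s \<le> rad t"
  by (simp add: rad_def)

text \<open>Together with \<open>rad_power_ge\<close> this locates the transition: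
  \<open>rad t ^ n\<close> is of order 1 for \<open>n\<close> well below e^t and negligible well
  above it. So the moment of order \<open>n\<close> essentially sees only the mass with
  \<open>t\<close> beyond ln n.\<close>

lemma rad_power_le: "2 \<le> t \<Longrightarrow> rad t ^ n \<le> exp (- real n * exp (1 - t))"
proof -
  assume t: "2 \<le> t"
  have "rad t ^ n \<le> exp (- exp (1 - t)) ^ n"
    using rad(3)[OF t] exp_ge_add_one_self[of "- exp (1 - t)"] by (intro power_mono) (auto simp: rad_def)
  then show ?thesis by (simp flip: exp_of_nat_mult)
qed

lemma rad_power_ge:
  assumes "2 \<le> t" "real n * exp (1 - t) \<le> 1 / 2"
  shows "1 / 2 \<le> rad t ^ n"
proof -
  have "1 + real n * (- exp (1 - t)) \<le> (1 + (- exp (1 - t))) ^ n"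
    using rad(3)[OF assms(1)] by (intro Bernoulli_inequality) (simp add: rad_def)
  then show ?thesis using assms(2) by (simp add: rad_def)
qed

lemma mass_rad: "2 \<le> t \<Longrightarrow> mass {rad t..<1} = 1 / t"
  using mass_tail[of "rad t"] rad[of t] by simp

lemma mass_rad_annulus:
  assumes "2 \<le> s" "s \<le> t"
  shows "mass {rad s..<rad t} = 1 / s - 1 / t"
proof -
  have "mass {rad s..<1} = (LINT r|lborel. weight0 r * indicator {rad s..<rad t} r + weight0 r * indicator {rad t..<1} r)"
    unfolding mass_def using rad_mono[OF assms(2)] rad(2)[of t] assms
    by (intro Bochner_Integration.integral_cong refl) (auto simp: indicator_def)
  also have "\<dots> = mass {rad s..<rad t} + mass {rad t..<1}"
    unfolding mass_def by (intro Bochner_Integration.integral_add mass_integrable) auto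
  finally show ?thesis using assms by (simp add: mass_rad)
qed

lemma moment_inner:
  assumes "B \<in> sets borel" "B \<subseteq> {..rad t}" "2 \<le> t"
  shows "imom B n \<le> 2 * exp (- real n * exp (1 - t))"
proof -
  have "imom B n \<le> 2 * rad t ^ n * mass B"
    using assms rad(3)[of t] by (intro moment_upper) auto
  also have "\<dots> \<le> 2 * exp (- real n * exp (1 - t)) * 1"
  proof (intro mult_mono)
    show "mass B \<le> 1" using mass_mono[of B UNIV] mass_UNIV assms(1) by simp
  qed (use rad_power_le[OF assms(3), of n] rad(3)[OF assms(3)] mass_nonneg in auto)
  finally show ?thesis by simp
qed

lemma moment_outer:
  assumes "B \<in> sets borel" "B \<inter> {..<1} \<subseteq> {rad t..<1}" "2 \<le> t"
  shows "imom B n \<le> 2 / t"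
proof -
  have "imom B n \<le> imom ({rad t..<1}) n"
    using assms by (intro imom_mono) auto
  also have "\<dots> \<le> 2 * mass {rad t..<1}" by (rule moment_upper') simp
  finally show ?thesis using assms(3) by (simp add: mass_rad)
qed

lemma mom_upper: "2 \<le> t \<Longrightarrow> mom n \<le> 2 / t + 2 * exp (- real n * exp (1 - t))"
proof -
  assume t: "2 \<le> t"
  have "mom n \<le> imom ({..rad t} \<union> {rad t..<1}) n"
    unfolding mom_eq_indicator by (intro imom_mono) auto
  also have "\<dots> \<le> imom ({..rad t}) n + imom ({rad t..<1}) n"
    by (intro imom_Un) auto
  also have "\<dots> \<le> 2 * exp (- real n * exp (1 - t)) + 2 / t"
    using t by (intro add_mono moment_inner moment_outer) auto
  finally show ?thesis by simp
qed

lemma mom_lower_log: "1 / (2 + ln (1 + real n)) \<le> mom n"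
proof -
  \<comment> \<open>Chosen so that \<open>(n + 1) * exp (1 - t)\<close> equals 1/e, which is below
    1/2 as \<open>rad_power_ge\<close> demands; the exponent \<open>n + 1\<close> comes from
    \<open>moment_lower\<close>.\<close>
  define t where "t = 2 + ln (1 + real n)"
  have t: "2 \<le> t" by (simp add: t_def)
  have e: "real (n + 1) * exp (1 - t) = exp (-1)"
  proof -
    have "exp (1 - t) = exp (-1) / exp (ln (1 + real n))"
      by (simp add: t_def exp_diff[of "-1"])
    then show ?thesis by simp
  qed
  have "exp (-1) \<le> (1 / 2 :: real)"
    using exp_ge_add_one_self[of "1::real"] by (simp add: exp_minus field_simps)
  then have "1 / 2 \<le> rad t ^ (n + 1)" using e by (intro rad_power_ge t) simp
  then have "1 / t \<le> 2 * rad t ^ (n + 1) * (1 / t)" using t by (simp add: field_simps)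
  also have "\<dots> = 2 * rad t ^ (n + 1) * mass {rad t..<1}" using t by (simp add: mass_rad)
  also have "\<dots> \<le> imom ({rad t..<1}) n"
    using rad(3)[OF t] by (intro moment_lower) auto
  also have "\<dots> \<le> mom n"
    unfolding mom_eq_indicator by (intro imom_mono) auto
  finally show ?thesis by (simp add: t_def)
qed

lemma divide_mom_le: "0 \<le> x \<Longrightarrow> x / mom n \<le> x * (2 + ln (1 + real n))"
proof -
  assume x: "0 \<le> x"
  have "0 < 2 + ln (1 + real n)" by (simp add: add_pos_nonneg)
  moreover have "1 \<le> mom n * (2 + ln (1 + real n))"
    using mom_lower_log[of n] calculation by (simp add: field_simps)
  ultimately have "1 / mom n \<le> 2 + ln (1 + real n)"
    using mom_pos[of n] by (simp add: field_simps)
  from mult_left_mono[OF this x] show ?thesis by simp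
qed

end

section \<open>Choice of the scales\<close>

context log_weight
begin

definition lg :: "nat \<Rightarrow> real" where "lg n = 2 + ln (1 + real n)"

lemma lg_ge: "2 \<le> lg n" by (simp add: lg_def)

lemma lg_mono: "m \<le> n \<Longrightarrow> lg m \<le> lg n" by (simp add: lg_def)

text \<open>Beyond \<open>cutoff s\<close> the part of the first symbol with t up to 2s is
  invisible. The exponents of \<open>base\<close> and \<open>shift\<close> start from the inner
  edges t = s and t = 4s of the two annuli; the reduction by 4 keeps the corresponding powers of the
  edge radii at least 1/2.\<close>

definition cutoff :: "nat \<Rightarrow> nat" where "cutoff s = nat \<lceil>exp (3 * real s)\<rceil>"
definition shift :: "nat \<Rightarrow> nat" where "shift s = nat \<lfloor>exp (4 * real s - 4)\<rfloor>"
definition base :: "nat \<Rightarrow> nat" where "base s = nat \<lfloor>exp (real s - 4)\<rfloor>"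

lemma nat_floor_bounds: "0 \<le> x \<Longrightarrow> real (nat \<lfloor>x\<rfloor>) \<le> x" "x - 1 \<le> real (nat \<lfloor>x\<rfloor>)"
  by linarith+

lemma cutoff_bounds: "exp (3 * real s) \<le> real (cutoff s)" "real (cutoff s) \<le> exp (3 * real s) + 1"
proof -
  show "exp (3 * real s) \<le> real (cutoff s)" unfolding cutoff_def by (rule real_nat_ceiling_ge)
  have "0 \<le> \<lceil>exp (3 * real s)\<rceil>" by (simp add: order_trans[OF _ exp_ge_zero] less_le_trans[OF _ exp_ge_zero] zero_le_ceiling)
  then show "real (cutoff s) \<le> exp (3 * real s) + 1"
    unfolding cutoff_def using ceiling_correct[of "exp (3 * real s)"] by simp
qed

lemma shift_bounds: "real (shift s) \<le> exp (4 * real s - 4)" "exp (4 * real s - 4) - 1 \<le> real (shift s)"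
  unfolding shift_def by (rule nat_floor_bounds; simp)+

lemma base_bounds: "real (base s) \<le> exp (real s - 4)" "exp (real s - 4) - 1 \<le> real (base s)"
  unfolding base_def by (rule nat_floor_bounds; simp)+

text \<open>For \<open>n \<ge> cutoff s\<close>, \<open>inner_rate n\<close> bounds what the scales up to \<open>s\<close> contribute to the
  eigenvalue of \<open>T\<^sub>u\<close> times the coefficient of \<open>T\<^sub>v\<close>, and \<open>outer_rate s n / s'\<close> what the scales from \<open>s'\<close> on contribute.\<close>

definition inner_rate :: "nat \<Rightarrow> real" where
  "inner_rate n = lg (2 * n) * lg (2 * n + 2 * n\<^sup>2) * (2 * exp (- (real n powr (1 / 3))))"

definition outer_rate :: "nat \<Rightarrow> nat \<Rightarrow> real" where
  "outer_rate s n = 4 * (lg (2 * n) * lg (2 * (n + shift s)) * exp (- real (2 * n) * exp (1 - 8 * real s)))"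

text \<open>The bounds by (1/2)^j make the majorant over the scales summable; the factor 3 is the
  constant of \<open>near_bound\<close>. The last condition makes \<open>mom (2 * base s)\<close> of
  order \<open>1 / s\<close>, by splitting at t = s/2.\<close>

definition admissible :: "nat \<Rightarrow> nat \<Rightarrow> bool" where
  "admissible j s \<longleftrightarrow> 8 \<le> s \<and> cutoff s < shift s \<and>
    3 * sqrt (real (cutoff s) / real (shift s - cutoff s)) \<le> (1 / 2) ^ j \<and>
    (\<forall>n. exp (3 * real s) \<le> real n \<longrightarrow> inner_rate n \<le> (1 / 2) ^ j) \<and>
    exp (- real (2 * base s) * exp (1 - real s / 2)) \<le> 1 / real s"

lemma inner_rate_tendsto: "inner_rate \<longlonglongrightarrow> 0"
  unfolding inner_rate_def[abs_def] lg_def by real_asymp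

lemma outer_rate_tendsto: "outer_rate s \<longlonglongrightarrow> 0"
proof -
  have "(\<lambda>n. 4 * ((2 + ln (1 + real (2 * n))) * (2 + ln (1 + real (2 * (n + K)))) * exp (- real (2 * n) * c))) \<longlonglongrightarrow> 0"
    if "0 < c" for c :: real and K :: nat
    using that by real_asymp
  from this[of "exp (1 - 8 * real s)" "shift s"] show ?thesis
    unfolding outer_rate_def[abs_def] lg_def by simp
qed

lemma eventually_admissible: "eventually (admissible j) sequentially"
proof -
  have h: "0 < (1 / 2 :: real) ^ j" by simp
  have 1: "eventually (\<lambda>s. 8 \<le> s) sequentially" by (rule eventually_ge_at_top)
  have 2: "eventually (\<lambda>s. 0 < exp (4 * real s - 4) - exp (3 * real s) - 2) sequentially"
    by real_asymp
  have "(\<lambda>s. 3 * sqrt ((exp (3 * real s) + 1) / (exp (4 * real s - 4) - exp (3 * real s) - 2))) \<longlonglongrightarrow> 0"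
    by real_asymp
  then have 3: "eventually (\<lambda>s. 3 * sqrt ((exp (3 * real s) + 1) / (exp (4 * real s - 4) - exp (3 * real s) - 2)) < (1 / 2) ^ j) sequentially"
    using h by (rule order_tendstoD(2))
  obtain n0 where n0: "\<And>n. n0 \<le> n \<Longrightarrow> inner_rate n < (1 / 2) ^ j"
    using order_tendstoD(2)[OF inner_rate_tendsto h] by (auto simp: eventually_sequentially)
  have 4: "eventually (\<lambda>s. real n0 < exp (3 * real s)) sequentially"
    by real_asymp
  have 5: "eventually (\<lambda>s. exp (- (2 * (exp (real s - 4) - 1)) * exp (1 - real s / 2)) \<le> 1 / real s) sequentially"
    by real_asymp
  show ?thesis
    using 1 2 3 4 5
  proof eventually_elim
    case (elim s)
    \<comment> \<open>The 2 absorbs one unit of rounding in \<open>shift s\<close> and one in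
      \<open>cutoff s\<close>.\<close>
    let ?D = "exp (4 * real s - 4) - exp (3 * real s) - 2"
    have lt: "cutoff s < shift s"
      using cutoff_bounds(2)[of s] shift_bounds(2)[of s] elim(2) by linarith
    have D: "?D \<le> real (shift s - cutoff s)"
      using cutoff_bounds(2)[of s] shift_bounds(2)[of s] lt by (simp add: of_nat_diff)
    have "real (cutoff s) / real (shift s - cutoff s) \<le> (exp (3 * real s) + 1) / ?D"
      using D elim(2) cutoff_bounds(2) by (intro frac_le) (auto intro: add_nonneg_nonneg)
    then have "sqrt (real (cutoff s) / real (shift s - cutoff s)) \<le> sqrt ((exp (3 * real s) + 1) / ?D)"
      by (rule real_sqrt_le_mono)
    then have a: "3 * sqrt (real (cutoff s) / real (shift s - cutoff s)) \<le> (1 / 2) ^ j"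
      using elim(3) by linarith
    have b: "inner_rate n \<le> (1 / 2) ^ j" if "exp (3 * real s) \<le> real n" for n
      using n0[of n] that elim(4) by (intro less_imp_le) simp
    have "- real (2 * base s) * exp (1 - real s / 2) \<le> - (2 * (exp (real s - 4) - 1)) * exp (1 - real s / 2)"
      using base_bounds(2)[of s] by (intro mult_right_mono) auto
    then have "exp (- real (2 * base s) * exp (1 - real s / 2)) \<le> exp (- (2 * (exp (real s - 4) - 1)) * exp (1 - real s / 2))"
      by (simp only: exp_le_cancel_iff)
    then have c: "exp (- real (2 * base s) * exp (1 - real s / 2)) \<le> 1 / real s"
      using elim(5) by (rule order_trans)
    show ?case unfolding admissible_def using elim(1) lt a b c by blast
  qed
qed

text \<open>For fixed \<open>s\<close> the sequence \<open>outer_rate s\<close> converges and is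
  therefore bounded, but the bound depends on \<open>s\<close>. The next scale is chosen afterwards,
  large enough to divide this bound down to (1/2)^j.\<close>

lemma exists_scales:
  obtains s :: "nat \<Rightarrow> nat" where "\<And>j. admissible j (s j)" "\<And>j. 8 * s j \<le> s (Suc j)"
    "\<And>j n. outer_rate (s j) n / real (s (Suc j)) \<le> (1 / 2) ^ j"
proof -
  have "\<exists>f. \<forall>j. admissible j (f j) \<and>
    (8 * f j \<le> f (Suc j) \<and> (\<forall>n. outer_rate (f j) n / real (f (Suc j)) \<le> (1 / 2) ^ j))"
  proof (rule dependent_nat_choice)
    show "\<exists>s. admissible 0 s"
      using eventually_happens[OF eventually_admissible[of 0]] by auto
    fix s j assume "admissible j s"
    have "Bseq (outer_rate s)"
      by (intro convergent_imp_Bseq convergentI[OF outer_rate_tendsto])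
    then obtain K where K: "\<And>n. \<bar>outer_rate s n\<bar> \<le> K" unfolding Bseq_def by auto
    have "eventually (\<lambda>s'. K * 2 ^ j \<le> real s') sequentially"
      using filterlim_real_sequentially unfolding filterlim_at_top by blast
    then have "eventually (\<lambda>s'. admissible (Suc j) s' \<and> 8 * s \<le> s' \<and> 0 < s' \<and> K * 2 ^ j \<le> real s') sequentially"
      using eventually_admissible[of "Suc j"] eventually_ge_at_top[of "8 * s"] eventually_gt_at_top[of 0]
      by eventually_elim auto
    then obtain s' where s': "admissible (Suc j) s'" "8 * s \<le> s'" "0 < s'" "K * 2 ^ j \<le> real s'"
      using eventually_happens by force
    have "outer_rate s n / real s' \<le> (1 / 2) ^ j" for n
    proof -
      have "outer_rate s n * 2 ^ j \<le> K * 2 ^ j"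
        using K[of n] by (intro mult_right_mono) auto
      then have "outer_rate s n * 2 ^ j \<le> real s'" using s'(4) by (rule order_trans)
      then show ?thesis using s'(3) by (simp add: field_simps)
    qed
    then show "\<exists>y. admissible (Suc j) y \<and> (8 * s \<le> y \<and> (\<forall>n. outer_rate s n / real y \<le> (1 / 2) ^ j))"
      using s' by blast
  qed
  then show ?thesis using that by blast
qed

abbreviation annulus :: "nat \<Rightarrow> real set" where
  "annulus s \<equiv> {rad (4 * real s)..<rad (8 * real s)}"

text \<open>The eigenvalue of the inner operator is at most 1. The annulus has moments at most
  2/(4s), and the moment in the denominator is at least 1/(2 + 4s) because its order does not exceed
  e^(4s); the quotient is 2 + 1/s, hence at most 3.\<close>

lemma near_bound:
  assumes s: "8 \<le> s" and n: "n < cutoff s" and lt: "cutoff s < shift s" and U: "U \<in> sets borel"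
  shows "imom U (2 * n) / mom (2 * n) *
    (imom (annulus s) (2 * n + shift s) / mom (2 * (n + shift s))) \<le> 3"
proof -
  have "imom U (2 * n) \<le> mom (2 * n)"
    unfolding mom_eq_indicator using U by (intro imom_mono) auto
  then have 1: "imom U (2 * n) / mom (2 * n) \<le> 1"
    using mom_pos[of "2 * n"] by simp
  have k: "real (shift s) \<le> exp (4 * real s - 4)" "1 \<le> real (shift s)"
    using shift_bounds(1) lt by auto
  \<comment> \<open>As \<open>5 \<le> exp 4\<close>, the factor 5 is paid for by the 4 subtracted in
    the exponent of \<open>shift\<close>.\<close>
  have "1 + real (2 * (n + shift s)) \<le> 5 * real (shift s)" using k n lt by simp
  also have "\<dots> \<le> exp 4 * exp (4 * real s - 4)"
    using k(1) exp_ge_add_one_self[of "4::real"] by (intro mult_mono) auto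
  also have "\<dots> = exp (4 * real s)" by (simp flip: exp_add)
  finally have "ln (1 + real (2 * (n + shift s))) \<le> ln (exp (4 * real s))"
    by (subst ln_le_cancel_iff) (simp_all add: add_pos_nonneg)
  then have lg: "2 + ln (1 + real (2 * (n + shift s))) \<le> 2 + 4 * real s" by simp
  have m: "imom (annulus s) (2 * n + shift s) \<le> 2 / (4 * real s)"
    using s rad(2)[of "8 * real s"] by (intro moment_outer) auto
  have "imom (annulus s) (2 * n + shift s) / mom (2 * (n + shift s)) \<le>
    imom (annulus s) (2 * n + shift s) * (2 + ln (1 + real (2 * (n + shift s))))"
    by (intro divide_mom_le imom_nonneg)
  also have "\<dots> \<le> 2 / (4 * real s) * (2 + 4 * real s)"
    using m lg s imom_nonneg by (intro mult_mono) (auto simp: add_nonneg_nonneg)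
  also have "\<dots> \<le> 3" using s by (simp add: field_simps)
  finally have 2: "imom (annulus s) (2 * n + shift s) / mom (2 * (n + shift s)) \<le> 3" .
  have "imom U (2 * n) / mom (2 * n) *
    (imom (annulus s) (2 * n + shift s) / mom (2 * (n + shift s))) \<le> 1 * 3"
    by (intro mult_mono 1 2 divide_nonneg_nonneg imom_nonneg mom_nonneg) simp
  then show ?thesis by simp
qed

text \<open>The moment of \<open>U\<close> splits into the scales up to \<open>s\<close>,
  exponentially small past \<open>cutoff s\<close>, and the later ones, at most
  \<open>2 / s'\<close> without decay in \<open>n\<close>. For the former the annulus moment is
  bounded by 1; for the latter its own exponential decay in \<open>n\<close> is used, which beats
  the logarithmic factors coming from the denominators.\<close>

lemma far_bound:
  assumes s: "8 \<le> s" "8 * s \<le> s'" and n: "cutoff s \<le> n"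
    and U: "U \<in> sets borel" "U \<inter> {0..<1} \<subseteq> {..rad (2 * s)} \<union> {rad s'..<1}"
  shows "imom U (2 * n) / mom (2 * n) *
    (imom (annulus s) (2 * n + shift s) / mom (2 * (n + shift s))) \<le>
    inner_rate n + outer_rate s n / real s'"
proof -
  let ?M = "imom (annulus s) (2 * n + shift s)"
  have ns: "exp (3 * real s) \<le> real n" using cutoff_bounds(1)[of s] n by linarith
  then have n0: "0 < real n" using less_le_trans[OF exp_gt_zero] by blast
  have root: "exp (real s) \<le> real n powr (1 / 3)"
  proof -
    have "exp (real s) = exp (3 * real s) powr (1 / 3)" by (simp add: powr_def)
    also have "\<dots> \<le> real n powr (1 / 3)" using ns by (intro powr_mono2) auto
    finally show ?thesis .
  qed
  have cube: "real n = (real n powr (1 / 3)) ^ 3"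
    using n0 by (simp flip: powr_numeral add: powr_powr)
  \<comment> \<open>Writing n = x^3 with x at least e^s, two of the three factors cancel e^(2s) and
    one remains. This trades the dependence on \<open>s\<close> for a decay rate in \<open>n\<close>
    only.\<close>
  have e1: "real n powr (1 / 3) \<le> real (2 * n) * exp (1 - 2 * real s)"
  proof -
    define x where "x = real n powr (1 / 3)"
    have x: "exp (real s) \<le> x" "real n = x ^ 3" "0 < x" using root cube n0 by (auto simp: x_def)
    have "exp (2 * real s) = exp (real s) ^ 2" by (simp flip: exp_of_nat_mult)
    also have "\<dots> \<le> x ^ 2" using x by (intro power_mono) auto
    finally have "x * exp (2 * real s) \<le> x * x ^ 2" using x by (intro mult_left_mono) auto
    also have "\<dots> = real n" using x(2) by (simp add: power3_eq_cube power2_eq_square)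
    also have "\<dots> \<le> real (2 * n) * exp 1" using n0 exp_ge_add_one_self[of "1::real"]
      by (simp add: mult_le_cancel_left1 order_trans[of _ "real n * 2"])
    finally show ?thesis
      by (simp add: x_def exp_diff field_simps)
  qed
  \<comment> \<open>Replacing \<open>shift s\<close> by n^2 inside a logarithm costs little and
    makes \<open>inner_rate\<close> independent of the scale.\<close>
  have sn: "shift s \<le> n\<^sup>2"
  proof -
    have "real (shift s) \<le> exp (4 * real s - 4)" by (rule shift_bounds)
    also have "\<dots> \<le> exp (3 * real s) * exp (3 * real s)" by (simp flip: exp_add)
    also have "\<dots> \<le> real n * real n" using ns by (intro mult_mono) auto
    finally show ?thesis by (simp add: power2_eq_square flip: of_nat_mult)
  qed
  have m1: "imom U (2 * n) \<le> 2 * exp (- real (2 * n) * exp (1 - 2 * real s)) + 2 / real s'"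
  proof -
    have "imom U (2 * n) \<le> imom (({..rad (2 * s)} \<union> {rad s'..<1})) (2 * n)"
      using U by (intro imom_mono) auto
    also have "\<dots> \<le> imom ({..rad (2 * s)}) (2 * n) + imom ({rad s'..<1}) (2 * n)"
      by (intro imom_Un) auto
    also have "\<dots> \<le> 2 * exp (- real (2 * n) * exp (1 - 2 * real s)) + 2 / real s'"
      using s by (intro add_mono moment_inner moment_outer) auto
    finally show ?thesis .
  qed
  have M1: "?M \<le> 1"
  proof -
    have "?M \<le> 2 / (4 * real s)"
      using s rad(2)[of "8 * real s"] by (intro moment_outer) auto
    also have "\<dots> \<le> 1" using s by simp
    finally show ?thesis .
  qed
  have M2: "?M \<le> 2 * exp (- real (2 * n) * exp (1 - 8 * real s))"
  proof -
    have "?M \<le> 2 * exp (- real (2 * n + shift s) * exp (1 - 8 * real s))"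
      using s by (intro moment_inner) auto
    also have "\<dots> \<le> 2 * exp (- real (2 * n) * exp (1 - 8 * real s))"
    proof -
      have "- real (2 * n + shift s) * exp (1 - 8 * real s) \<le> - real (2 * n) * exp (1 - 8 * real s)"
        by (intro mult_right_mono) simp_all
      then show ?thesis by simp
    qed
    finally show ?thesis .
  qed
  let ?L = "lg (2 * n) * lg (2 * (n + shift s))"
  have L0: "0 \<le> ?L" using lg_ge[of "2 * n"] lg_ge[of "2 * (n + shift s)"] by (intro mult_nonneg_nonneg) linarith+
  have M0: "0 \<le> ?M" by (rule imom_nonneg)
  have "imom U (2 * n) / mom (2 * n) * (?M / mom (2 * (n + shift s))) \<le>
    (imom U (2 * n) * lg (2 * n)) * (?M * lg (2 * (n + shift s)))"
    unfolding lg_def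
    by (intro mult_mono divide_mom_le imom_nonneg divide_nonneg_nonneg mom_nonneg mult_nonneg_nonneg)
      (simp add: add_nonneg_nonneg)
  also have "\<dots> = ?L * (imom U (2 * n) * ?M)" by (simp add: mult_ac)
  also have "\<dots> \<le> ?L * ((2 * exp (- real (2 * n) * exp (1 - 2 * real s)) + 2 / real s') * ?M)"
    by (intro mult_left_mono mult_right_mono m1 L0 M0)
  also have "\<dots> = ?L * (2 * exp (- real (2 * n) * exp (1 - 2 * real s)) * ?M + 2 / real s' * ?M)"
    by (simp add: distrib_right)
  also have "\<dots> \<le> ?L * (2 * exp (- (real n powr (1 / 3))) * 1 + 2 / real s' * (2 * exp (- real (2 * n) * exp (1 - 8 * real s))))"
  proof (rule mult_left_mono[OF add_mono L0])
    show "2 * exp (- real (2 * n) * exp (1 - 2 * real s)) * ?M \<le> 2 * exp (- (real n powr (1 / 3))) * 1"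
      using e1 M1 M0 by (intro mult_mono) auto
    show "2 / real s' * ?M \<le> 2 / real s' * (2 * exp (- real (2 * n) * exp (1 - 8 * real s)))"
      by (intro mult_left_mono M2) simp
  qed
  also have "\<dots> = ?L * (2 * exp (- (real n powr (1 / 3)))) + outer_rate s n / real s'"
    by (simp add: outer_rate_def distrib_left mult_ac)
  also have "?L * (2 * exp (- (real n powr (1 / 3)))) \<le> inner_rate n"
    unfolding inner_rate_def
  proof (intro mult_right_mono mult_left_mono lg_mono)
    show "2 * (n + shift s) \<le> 2 * n + 2 * n\<^sup>2" using sn by simp
    show "0 \<le> lg (2 * n)" using lg_ge[of "2 * n"] by linarith
  qed simp
  finally show ?thesis by simp
qed

text \<open>All four quantities are of order \<open>1 / s\<close>: the two moments of the monomials
  by \<open>mom_upper\<close> at t = s/2, and the two annulus moments because the edge powers are at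
  least 1/2 and the annuli have masses 1/(2s) and 1/(8s).\<close>

lemma peak_bound:
  assumes s: "8 \<le> s" and ad: "exp (- real (2 * base s) * exp (1 - real s / 2)) \<le> 1 / real s"
    and U: "U \<in> sets borel" "{rad s..<rad (2 * s)} \<subseteq> U"
  shows "1 / 576 * (sqrt (mom (2 * base s)) * sqrt (mom (2 * (base s + shift s)))) \<le>
    imom U (2 * base s) / mom (2 * base s) *
    imom (annulus s) (2 * base s + shift s)"
proof -
  let ?n = "base s"
  have e2: "2 \<le> exp (1 :: real)" using exp_ge_add_one_self[of "1::real"] by simp
  have e3: "8 \<le> exp (3 :: real)"
    using power_mono[OF e2, of 3] by (simp flip: exp_of_nat_mult)
  have em3: "exp (-3 :: real) \<le> 1 / 8" using e3 by (simp add: exp_minus field_simps)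
  \<comment> \<open>The edge estimates consist of three and four such terms, counted with
    multiplicity, so each sum stays within the 1/2 allowed by \<open>rad_power_ge\<close>.\<close>
  have small: "exp (- x) \<le> 1 / 8" if "3 \<le> x" for x :: real
    using em3 that by (intro order_trans[OF _ em3]) simp
  have mW: "mom (2 * ?n) \<le> 6 / real s"
    using mom_upper[of "real s / 2" "2 * ?n"] s ad by (simp add: field_simps)
  have mW': "mom (2 * (?n + shift s)) \<le> 6 / real s"
    using mom_decseq mW unfolding decseq_def by (meson le_add1 order_trans)
  have "real (2 * ?n + 1) * exp (1 - real s) \<le> (2 * exp (real s - 4) + 1) * exp (1 - real s)"
    using base_bounds(1)[of s] by (intro mult_right_mono) auto
  also have "\<dots> = 2 * exp (-3) + exp (- (real s - 1))"
    by (simp add: distrib_right flip: exp_add)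
  also have "\<dots> \<le> 2 * (1 / 8) + 1 / 8"
    using s by (intro add_mono mult_left_mono small em3) auto
  finally have r1: "1 / 2 \<le> rad s ^ (2 * ?n + 1)"
    using s by (intro rad_power_ge) auto
  have "real (2 * ?n + shift s + 1) * exp (1 - 4 * real s) \<le>
    (2 * exp (real s - 4) + exp (4 * real s - 4) + 1) * exp (1 - 4 * real s)"
    using base_bounds(1)[of s] shift_bounds(1)[of s] by (intro mult_right_mono) auto
  also have "\<dots> = 2 * exp (- (3 * real s + 3)) + exp (-3) + exp (- (4 * real s - 1))"
    by (simp add: distrib_right flip: exp_add)
  also have "\<dots> \<le> 2 * (1 / 8) + 1 / 8 + 1 / 8"
    using s by (intro add_mono mult_left_mono small em3) auto
  finally have r2: "1 / 2 \<le> rad (4 * s) ^ (2 * ?n + shift s + 1)"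
    using s by (intro rad_power_ge) auto
  have "1 / (2 * real s) = 2 * (1 / 2) * (1 / s - 1 / (2 * s))" using s by (simp add: field_simps)
  also have "\<dots> \<le> 2 * rad s ^ (2 * ?n + 1) * (1 / s - 1 / (2 * s))"
    using r1 s by (intro mult_right_mono mult_left_mono) (auto simp: field_simps)
  also have "\<dots> = 2 * rad s ^ (2 * ?n + 1) * mass {rad s..<rad (2 * s)}"
    using mass_rad_annulus[of "real s" "2 * real s"] s by simp
  also have "\<dots> \<le> imom ({rad s..<rad (2 * s)}) (2 * ?n)"
    using rad(3)[of "real s"] s by (intro moment_lower) auto
  also have "\<dots> \<le> imom U (2 * ?n)"
    using U by (intro imom_mono) auto
  finally have u: "1 / (2 * real s) \<le> imom U (2 * ?n)" .
  have "1 / (8 * real s) = 2 * (1 / 2) * (1 / (4 * s) - 1 / (8 * s))" using s by (simp add: field_simps)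
  also have "\<dots> \<le> 2 * rad (4 * s) ^ (2 * ?n + shift s + 1) * (1 / (4 * s) - 1 / (8 * s))"
    using r2 s by (intro mult_right_mono mult_left_mono) (auto simp: field_simps)
  also have "\<dots> = 2 * rad (4 * s) ^ (2 * ?n + shift s + 1) * mass (annulus s)"
    using mass_rad_annulus[of "4 * real s" "8 * real s"] s by simp
  also have "\<dots> \<le> imom (annulus s) (2 * ?n + shift s)"
    using rad(3)[of "4 * real s"] s by (intro moment_lower) auto
  finally have a: "1 / (8 * real s) \<le> imom (annulus s) (2 * ?n + shift s)" .
  have "sqrt (mom (2 * ?n)) * sqrt (mom (2 * (?n + shift s))) \<le> sqrt (6 / real s) * sqrt (6 / real s)"
    using mW mW' mom_nonneg s by (intro mult_mono) auto
  also have "\<dots> = 6 / real s" using s by simp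
  finally have "1 / 576 * (sqrt (mom (2 * ?n)) * sqrt (mom (2 * (?n + shift s)))) \<le> 1 / 576 * (6 / real s)" by simp
  \<comment> \<open>Origin of the constant: 576 = 6 * 6 * 2 * 8, from the upper bound 6/s used twice
    and the lower bounds 1/(2s) and 1/(8s).\<close>
  also have "\<dots> = (1 / (2 * real s)) / (6 / real s) * (1 / (8 * real s))"
    using s by (simp add: field_simps)
  also have "\<dots> \<le> imom U (2 * ?n) / mom (2 * ?n) * imom (annulus s) (2 * ?n + shift s)"
    using u a mW mom_pos[of "2 * ?n"] s imom_nonneg
    by (intro mult_mono frac_le divide_nonneg_nonneg mom_nonneg) auto
  finally show ?thesis .
qed

theorem berezin_vanishing_noncompact_product:
  "\<exists>u\<in>Linf. \<exists>v\<in>Linf.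
     \<not> compact_operator_A2 \<omega> (toeplitz \<omega> v \<circ> toeplitz \<omega> u) \<and>
     ((\<lambda>a. berezin \<omega> (toeplitz \<omega> v \<circ> toeplitz \<omega> u) a) \<longlongrightarrow> 0) (filtercomap cmod (at_left 1))"
proof -
  obtain s :: "nat \<Rightarrow> nat" where ad: "\<And>j. admissible j (s j)" and s8: "\<And>j. 8 * s j \<le> s (Suc j)"
    and outer: "\<And>j n. outer_rate (s j) n / real (s (Suc j)) \<le> (1 / 2) ^ j"
    using exists_scales by blast
  have s: "8 \<le> s j" "cutoff (s j) < shift (s j)" for j using ad[of j] by (auto simp: admissible_def)
  have smono: "8 * s i \<le> s j" if "i < j" for i j
    using that
  proof (induction j)
    case (Suc j)
    show ?case
    proof (cases "i = j")
      case False
      then have "8 * s i \<le> s j" using Suc by simp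
      then show ?thesis using s8[of j] by simp
    qed (simp add: s8)
  qed simp
  define U where "U = (\<Union>j. {rad (s j)..<rad (2 * s j)})"
  define A where "A j = annulus (s j)" for j
  define k where "k j = shift (s j)" for j
  define u where "u = (\<lambda>z. complex_of_real (indicator U (cmod z)))"
  define v where "v = multi_symbol A k"
  have U: "U \<in> sets borel" unfolding U_def by (intro sets.countable_UN) auto
  have A: "A j \<in> sets borel" for j by (simp add: A_def)
  have "A i \<inter> A j = {}" if "i < j" for i j
  proof -
    have "rad (8 * s i) \<le> rad (4 * s j)" using smono[OF that] by (intro rad_mono) simp
    then show ?thesis by (auto simp: A_def)
  qed
  then have dis: "disjoint_family A"
    unfolding disjoint_family_on_def by (metis Int_commute linorder_neqE_nat)
  \<comment> \<open>Every annulus of \<open>U\<close> belongs to a scale up to \<open>j\<close> or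
    to a later one, so nothing lies between \<open>2 * s j\<close> and \<open>s (Suc j)\<close>;
    this gap is what \<open>far_bound\<close> exploits.\<close>
  have Usub: "U \<inter> {0..<1} \<subseteq> {..rad (2 * s j)} \<union> {rad (s (Suc j))..<1}" for j
  proof
    fix r assume r: "r \<in> U \<inter> {0..<1}"
    then obtain i where i: "rad (s i) \<le> r" "r < rad (2 * s i)" by (auto simp: U_def)
    show "r \<in> {..rad (2 * s j)} \<union> {rad (s (Suc j))..<1}"
    proof (cases "i \<le> j")
      case True
      then have "s i \<le> s j" using smono[of i j] by (cases "i = j") auto
      then have "rad (2 * s i) \<le> rad (2 * s j)" by (intro rad_mono) simp
      then show ?thesis using i by auto
    next
      case False
      then have "s (Suc j) \<le> s i" using smono[of "Suc j" i] by (cases "i = Suc j") auto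
      then have "rad (s (Suc j)) \<le> rad (s i)" by (intro rad_mono) simp
      then show ?thesis using i r by auto
    qed
  qed
  have uL: "u \<in> Linf"
  proof -
    have [measurable]: "(indicator U :: real \<Rightarrow> real) \<in> borel_measurable borel" using U by simp
    have "u \<in> borel_measurable disk_area" unfolding u_def by measurable
    then show ?thesis by (auto simp: Linf_def u_def indicator_def intro!: exI[of _ 1])
  qed
  have vL: "v \<in> Linf"
    using multi_symbol_props(1,2)[OF A dis, of k]
    by (auto simp: Linf_def v_def borel_measurable_mu_iff intro!: exI[of _ 1])
  let ?b = "\<lambda>j n. imom U (2 * n) / mom (2 * n) *
    (imom (A j) (2 * n + k j) / mom (2 * (n + k j)))"
  have "((\<lambda>a. berezin \<omega> (toeplitz \<omega> v \<circ> toeplitz \<omega> u) a) \<longlongrightarrow> 0) (filtercomap cmod (at_left 1))"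
    unfolding v_def u_def
  \<comment> \<open>Half of \<open>e j\<close> bounds \<open>inner_rate\<close>, the other half the
    later scales; the square-root term adds a third (1/2)^j to the majorant.\<close>
  proof (rule berezin_tendsto_0[OF U A dis, where C = 3 and N = "\<lambda>j. cutoff (s j)" and e = "\<lambda>j. 2 * (1 / 2) ^ j"])
    show "cutoff (s j) < k j" for j using s by (simp add: k_def)
    show "?b j n \<le> 3" if "n < cutoff (s j)" for j n
      unfolding A_def k_def using s that U by (intro near_bound) auto
    show "?b j n \<le> 2 * (1 / 2) ^ j" if n: "cutoff (s j) \<le> n" for j n
    proof -
      have "?b j n \<le> inner_rate n + outer_rate (s j) n / real (s (Suc j))"
        unfolding A_def k_def using s s8 n U Usub by (intro far_bound) auto
      moreover have "inner_rate n \<le> (1 / 2) ^ j"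
        using ad[of j] cutoff_bounds(1)[of "s j"] n by (auto simp: admissible_def)
      ultimately show ?thesis using outer[of j n] by linarith
    qed
    show "summable (\<lambda>j. 3 * sqrt (real (cutoff (s j)) / real (k j - cutoff (s j))) + 2 * (1 / 2) ^ j)"
    proof (rule summable_comparison_test')
      show "summable (\<lambda>j. 3 * (1 / 2 :: real) ^ j)" by (intro summable_mult summable_geometric) simp
      show "norm (3 * sqrt (real (cutoff (s j)) / real (k j - cutoff (s j))) + 2 * (1 / 2) ^ j) \<le> 3 * (1 / 2) ^ j" for j
      proof -
        have "3 * sqrt (real (cutoff (s j)) / real (k j - cutoff (s j))) \<le> (1 / 2) ^ j"
          using ad[of j] unfolding admissible_def k_def by blast
        moreover have "0 \<le> 3 * sqrt (real (cutoff (s j)) / real (k j - cutoff (s j)))"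
          by (intro mult_nonneg_nonneg real_sqrt_ge_zero divide_nonneg_nonneg of_nat_0_le_iff) simp
        moreover have "(0::real) \<le> (1 / 2) ^ j" by simp
        ultimately show ?thesis unfolding real_norm_def by linarith
      qed
    qed
    show "?b j \<longlonglongrightarrow> 0" for j
    proof (rule tendsto_sandwich[OF always_eventually _ tendsto_const])
      show "\<forall>n. 0 \<le> ?b j n"
        by (intro allI mult_nonneg_nonneg divide_nonneg_nonneg imom_nonneg mom_nonneg)
      have "eventually (\<lambda>n. cutoff (s j) \<le> n) sequentially" by (rule eventually_ge_at_top)
      then show "eventually (\<lambda>n. ?b j n \<le> inner_rate n + outer_rate (s j) n / real (s (Suc j))) sequentially"
        unfolding A_def k_def
      proof eventually_elim
        case (elim n)
        then show ?case using s s8 U Usub by (intro far_bound) auto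
      qed
      show "(\<lambda>n. inner_rate n + outer_rate (s j) n / real (s (Suc j))) \<longlonglongrightarrow> 0"
        using tendsto_add[OF inner_rate_tendsto tendsto_divide[OF outer_rate_tendsto tendsto_const, of "real (s (Suc j))"]] s[of "Suc j"]
        by simp
    qed
  qed simp
  moreover have "\<not> compact_operator_A2 \<omega> (toeplitz \<omega> v \<circ> toeplitz \<omega> u)"
    unfolding v_def u_def
  proof (rule not_compact_shift[OF U A dis, where n = "\<lambda>j. base (s j)" and c = "1 / 576"])
    \<comment> \<open>The target degrees escape to infinity through the shifts: \<open>j\<close> is
      at most \<open>s j\<close>, which is below the cutoff and hence below
      \<open>k j\<close>.\<close>
    have "j \<le> base (s j) + k j" for j
    proof -
      have "j \<le> s j"
      proof (induction j)
        case (Suc j)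
        then show ?case using s8[of j] s(1)[of j] by linarith
      qed simp
      moreover have "real (s j) \<le> real (cutoff (s j))"
        using cutoff_bounds(1)[of "s j"] exp_ge_add_one_self[of "3 * real (s j)"] by linarith
      ultimately show ?thesis using s(2)[of j] by (simp add: k_def)
    qed
    then show "filterlim (\<lambda>j. base (s j) + k j) at_top sequentially"
      by (intro filterlim_at_top_mono[OF filterlim_ident] always_eventually) auto
    show "1 / 576 * (sqrt (mom (2 * base (s j))) * sqrt (mom (2 * (base (s j) + k j)))) \<le>
      imom U (2 * base (s j)) / mom (2 * base (s j)) * imom (A j) (2 * base (s j) + k j)" for j
      unfolding A_def k_def
      using ad[of j] U by (intro peak_bound) (auto simp: admissible_def U_def)
  qed simp
  ultimately show ?thesis using uL vL by blast
qed

end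

theorem proposition1p2:
  fixes \<omega> :: "real \<Rightarrow> real"
  assumes "\<And>r. 0 \<le> r \<Longrightarrow> r \<le> 1 - exp (-1) \<Longrightarrow> \<omega> r = exp 1 / 4"
    and "\<And>r. 1 - exp (-1) < r \<Longrightarrow> r < 1 \<Longrightarrow>
           \<omega> r = 1 / ((1 - r) * (ln (exp 1 / (1 - r)))\<^sup>2)"
  shows "radial_weight \<omega> \<and> log_subharmonic \<omega> \<and> \<omega> \<in> D_hat \<and>
    (\<exists>u\<in>Linf. \<exists>v\<in>Linf.
       \<not> compact_operator_A2 \<omega> (toeplitz \<omega> v \<circ> toeplitz \<omega> u) \<and>
       ((\<lambda>a. berezin \<omega> (toeplitz \<omega> v \<circ> toeplitz \<omega> u) a) \<longlongrightarrow> 0)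
         (filtercomap cmod (at_left 1)))"
proof -
  interpret log_weight \<omega> by (rule log_weight.intro[OF assms])
  show ?thesis
    using radial log_subharmonic_weight in_D_hat berezin_vanishing_noncompact_product by blast
qed

end
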